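(* Let $g,k\ge 2$ be integers with $k-1\mid g$, let $n=g/(k-1)$, and let $p_{g,k}:\Sigma_g\to\Sigma_0$ be the balanced superelliptic cover of degree $k$ with branch set $\mathcal{B}$ of $2n+2$ points. For $k=2$, $\mathrm{LMod}_{g,k}(\Sigma_0,\mathcal{B})=\mathrm{Mod}(\Sigma_0,\mathcal{B})$. For $k\geq 3$, the index is $$[\mathrm{Mod}(\Sigma_0,\mathcal{B}):\mathrm{LMod}_{g,k}(\Sigma_0,\mathcal{B})]=\frac{(2n+2)!}{2((n+1)!)^2}.$$
   Context: Balanced superelliptic cover: let $g,k\ge 2$ be integers with $k-1\mid g$ and $n=g/(k-1)$. Embed the closed orientable surface $\Sigma_g$ of genus $g$ in $\mathbb{R}^3$, invariant under rotation by $2\pi/k$ about the $z$-axis, so that its intersection with the plane $z=a$ is: empty for $a<0$ and $a>2n+1$; the point on the $z$-axis for $a=0$ and $a=2n+1$; homeomorphic to a circle for $2m<a<2m+1$, $m\in\{0,\dots,n\}$; a rose with $k$ petals for $a\in\{1,\dots,2n\}$ (with its vertex on the $z$-axis); $k$ disjoint simple closed curves permuted by the rotation for $2m-1<a<2m$, $m\in\{1,\dots,n\}$ (for $a=2m-1/2$ they are circles with centers on the rays $\theta=2\pi d/k$, $0\le d\le k-1$). Let $\zeta:\Sigma_g\to\Sigma_g$ be this rotation; it has order $k$ and fixes exactly the $2n+2$ points of $\Sigma_g$ on the $z$-axis. The quotient $\Sigma_g/\langle\zeta\rangle$ is a sphere $\Sigma_0$, and the quotient map $p_{g,k}:\Sigma_g\to\Sigma_0$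 is a $k$-fold cyclic branched cover with deck group $\langle\zeta\rangle$, branched over the set $\mathcal{B}$ of images of the $2n+2$ fixed points. (It is modeled by the normalization of $y^k=(x-a_1)(x-a_2)^{k-1}\cdots(x-a_{2n+1})(x-a_{2n+2})^{k-1}$ with the $a_i$ distinct.) $\mathrm{Mod}(\Sigma_0,\mathcal{B})$ is the group of homotopy classes of orientation-preserving homeomorphisms of $\Sigma_0$, where homeomorphisms and homotopies preserve $\mathcal{B}$ (setwise). $\mathrm{LMod}_{g,k}(\Sigma_0,\mathcal{B})\le \mathrm{Mod}(\Sigma_0,\mathcal{B})$ is the subgroup of classes of homeomorphisms $f$ that lift, i.e. for which there is a homeomorphism $\tilde f$ of $\Sigma_g$ with $p_{g,k}\tilde f=f p_{g,k}$. *)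

theory Defs
  imports "HOL-Analysis.Analysis" "HOL-Homology.Homology"
begin

section \<open>The embedded surface\<close>

text \<open>A closed connected topological 2-manifold which is orientable (\<open>H\<^sub>2 = \<int>\<close>) and has
  genus \<open>g\<close> (\<open>H\<^sub>1 = \<int>\<^sup>2\<^sup>g\<close>).\<close>

definition closed_orientable_surface :: "nat \<Rightarrow> 'a::euclidean_space set \<Rightarrow> bool" where
  "closed_orientable_surface g S \<longleftrightarrow>
     compact S \<and> connected S \<and>
     (\<forall>x\<in>S. \<exists>U. x \<in> U \<and> openin (top_of_set S) U \<and> U homeomorphic (UNIV :: (real^2) set)) \<and>
     homology_group 2 (top_of_set S) \<cong> integer_group \<and>
     homology_group 1 (top_of_set S) \<cong> free_Abelian_group {..<2 * g}"

definition rotz :: "real \<Rightarrow> real^3 \<Rightarrow> real^3" where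
  "rotz t v = vector [cos t * v$1 - sin t * v$2, sin t * v$1 + cos t * v$2, v$3]"

definition zeta :: "nat \<Rightarrow> real^3 \<Rightarrow> real^3" where
  "zeta k = rotz (2 * pi / real k)"

definition zslice :: "(real^3) set \<Rightarrow> real \<Rightarrow> (real^3) set" where
  "zslice S a = {v \<in> S. v$3 = a}"

definition simple_closed_curve :: "'a::topological_space set \<Rightarrow> bool" where
  "simple_closed_curve C \<longleftrightarrow> C homeomorphic (sphere 0 1 :: (real^2) set)"

definition is_rose :: "nat \<Rightarrow> 'a::topological_space \<Rightarrow> 'a set \<Rightarrow> bool" where
  "is_rose k v R \<longleftrightarrow>
     (\<exists>P :: nat \<Rightarrow> 'a set.
        (\<forall>d<k. simple_closed_curve (P d) \<and> v \<in> P d) \<and>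
        (\<forall>d<k. \<forall>e<k. d \<noteq> e \<longrightarrow> P d \<inter> P e = {v}) \<and>
        R = (\<Union>d<k. P d))"

text \<open>The curves \<open>C 0, \<dots>, C (k - 1)\<close> are permuted cyclically by the rotation.\<close>

definition permuted_curves :: "nat \<Rightarrow> (nat \<Rightarrow> (real^3) set) \<Rightarrow> bool" where
  "permuted_curves k C \<longleftrightarrow>
     (\<forall>d<k. simple_closed_curve (C d)) \<and>
     (\<forall>d<k. \<forall>e<k. d \<noteq> e \<longrightarrow> C d \<inter> C e = {}) \<and>
     (\<forall>d<k. zeta k ` C d = C (Suc d mod k))"

definition round_circle :: "real^3 \<Rightarrow> real \<Rightarrow> (real^3) set" where
  "round_circle c r = {v. v$3 = c$3 \<and> dist v c = r}"

definition balanced_superelliptic_surface :: "nat \<Rightarrow> nat \<Rightarrow> nat \<Rightarrow> (real^3) set \<Rightarrow> bool" where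
  "balanced_superelliptic_surface g k n S \<longleftrightarrow>
     closed_orientable_surface g S \<and>
     zeta k ` S = S \<and>
     (\<forall>a::real. a < 0 \<or> a > 2 * real n + 1 \<longrightarrow> zslice S a = {}) \<and>
     (\<forall>a\<in>{0, 2 * real n + 1}. zslice S a = {vector [0, 0, a]}) \<and>
     (\<forall>m\<le>n. \<forall>a. 2 * real m < a \<and> a < 2 * real m + 1 \<longrightarrow> simple_closed_curve (zslice S a)) \<and>
     (\<forall>j\<in>{1..2 * n}. is_rose k (vector [0, 0, real j]) (zslice S (real j))) \<and>
     (\<forall>m\<in>{1..n}. \<forall>a. 2 * real m - 1 < a \<and> a < 2 * real m \<longrightarrow>
        (\<exists>C. permuted_curves k C \<and> zslice S a = (\<Union>d<k. C d))) \<and>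
     (\<forall>m\<in>{1..n}. \<exists>C. permuted_curves k C \<and> zslice S (2 * real m - 1/2) = (\<Union>d<k. C d) \<and>
        (\<forall>d<k. \<exists>s>0. \<exists>r>0. C d =
           round_circle (vector [s * cos (2 * pi * real d / real k),
                                 s * sin (2 * pi * real d / real k),
                                 2 * real m - 1/2]) r))"


section \<open>The branched cover\<close>

text \<open>The quotient sphere is identified with the standard sphere \<open>nsphere 2\<close>: the map \<open>p\<close> is
  a quotient map whose fibres are exactly the orbits of the rotation.\<close>

definition balanced_superelliptic_cover ::
    "nat \<Rightarrow> (real^3) set \<Rightarrow> (real^3 \<Rightarrow> (nat \<Rightarrow> real)) \<Rightarrow> bool" where
  "balanced_superelliptic_cover k S p \<longleftrightarrow>
     quotient_map (top_of_set S) (nsphere 2) p \<and>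
     (\<forall>x\<in>S. \<forall>y\<in>S. p x = p y \<longleftrightarrow> (\<exists>i::nat. y = (zeta k ^^ i) x))"

definition branch_set ::
    "nat \<Rightarrow> (real^3) set \<Rightarrow> (real^3 \<Rightarrow> (nat \<Rightarrow> real)) \<Rightarrow> (nat \<Rightarrow> real) set" where
  "branch_set k S p = p ` {x \<in> S. zeta k x = x}"


section \<open>Mapping class groups of the marked sphere\<close>

definition marked_homeos :: "(nat \<Rightarrow> real) set \<Rightarrow> ((nat \<Rightarrow> real) \<Rightarrow> (nat \<Rightarrow> real)) set" where
  "marked_homeos B =
     {f. homeomorphic_map (nsphere 2) (nsphere 2) f \<and> Brouwer_degree2 2 f = 1 \<and> f ` B = B}"

text \<open>Preservation of the marked set by the stages of a homotopy means that marked points go to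
  marked points and unmarked points to unmarked points. For homeomorphisms the second clause is
  automatic; for homotopies it is essential, since homotopies of maps of pairs
  \<open>(S\<^sup>2, B) \<rightarrow> (S\<^sup>2, B)\<close> would only remember the permutation of \<open>B\<close>.\<close>

definition preserves_marked :: "(nat \<Rightarrow> real) set \<Rightarrow> ((nat \<Rightarrow> real) \<Rightarrow> (nat \<Rightarrow> real)) \<Rightarrow> bool" where
  "preserves_marked B f \<longleftrightarrow>
     f ` B = B \<and> f ` (topspace (nsphere 2) - B) \<subseteq> topspace (nsphere 2) - B"

definition mapping_class ::
    "(nat \<Rightarrow> real) set \<Rightarrow> ((nat \<Rightarrow> real) \<Rightarrow> (nat \<Rightarrow> real)) \<Rightarrow> ((nat \<Rightarrow> real) \<Rightarrow> (nat \<Rightarrow> real)) set" where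
  "mapping_class B f =
     {h \<in> marked_homeos B. homotopic_with (preserves_marked B) (nsphere 2) (nsphere 2) f h}"

definition Mod_group :: "(nat \<Rightarrow> real) set \<Rightarrow> ((nat \<Rightarrow> real) \<Rightarrow> (nat \<Rightarrow> real)) set monoid" where
  "Mod_group B =
     \<lparr>carrier = mapping_class B ` marked_homeos B,
      mult = (\<lambda>U V. \<Union>f\<in>U. \<Union>h\<in>V. mapping_class B (f \<circ> h)),
      one = mapping_class B id\<rparr>"

definition liftable ::
    "(real^3) set \<Rightarrow> (real^3 \<Rightarrow> (nat \<Rightarrow> real)) \<Rightarrow> ((nat \<Rightarrow> real) \<Rightarrow> (nat \<Rightarrow> real)) \<Rightarrow> bool" where
  "liftable S p f \<longleftrightarrow>
     (\<exists>F. homeomorphic_map (top_of_set S) (top_of_set S) F \<and> (\<forall>x\<in>S. p (F x) = f (p x)))"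

definition LMod ::
    "(real^3) set \<Rightarrow> (real^3 \<Rightarrow> (nat \<Rightarrow> real)) \<Rightarrow> (nat \<Rightarrow> real) set
      \<Rightarrow> ((nat \<Rightarrow> real) \<Rightarrow> (nat \<Rightarrow> real)) set set" where
  "LMod S p B = mapping_class B ` {f \<in> marked_homeos B. liftable S p f}"


subsection \<open>Well-definedness\<close>

lemma marked_homeos_continuous:
  "f \<in> marked_homeos B \<Longrightarrow> continuous_map (nsphere 2) (nsphere 2) f"
  by (simp add: marked_homeos_def homeomorphic_imp_continuous_map)

lemma preserves_marked_comp:
  "preserves_marked B f \<Longrightarrow> preserves_marked B h \<Longrightarrow> preserves_marked B (f \<circ> h)"
  unfolding preserves_marked_def image_comp [symmetric] by (auto simp: image_subset_iff)

lemma preserves_marked_cong: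
  assumes "B \<subseteq> topspace (nsphere 2)" "\<And>x. x \<in> topspace (nsphere 2) \<Longrightarrow> f x = h x"
  shows "preserves_marked B f \<longleftrightarrow> preserves_marked B h"
proof -
  have "f ` B = h ` B" "f ` (topspace (nsphere 2) - B) = h ` (topspace (nsphere 2) - B)"
    using assms by (auto intro!: image_cong)
  then show ?thesis by (simp add: preserves_marked_def)
qed

lemma marked_homeos_preserves:
  assumes "f \<in> marked_homeos B" "B \<subseteq> topspace (nsphere 2)"
  shows "preserves_marked B f"
proof -
  have f: "homeomorphic_map (nsphere 2) (nsphere 2) f" and B: "f ` B = B"
    using assms(1) by (auto simp: marked_homeos_def)
  have "inj_on f (topspace (nsphere 2))" "f ` topspace (nsphere 2) = topspace (nsphere 2)"
    using f homeomorphic_imp_injective_map homeomorphic_imp_surjective_map by blast+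
  then have "f ` (topspace (nsphere 2) - B) = topspace (nsphere 2) - B"
    using assms(2) by (metis B Diff_subset inj_on_image_set_diff)
  then show ?thesis
    using B by (simp add: preserves_marked_def)
qed

lemma marked_homeos_id: "id \<in> marked_homeos B"
  by (simp add: marked_homeos_def)

lemma marked_homeos_comp:
  assumes "f \<in> marked_homeos B" "h \<in> marked_homeos B"
  shows "f \<circ> h \<in> marked_homeos B"
proof -
  have "(f \<circ> h) ` B = B"
    using assms unfolding image_comp [symmetric] by (simp add: marked_homeos_def)
  then show ?thesis
    using assms unfolding marked_homeos_def
    by (auto simp: Brouwer_degree2_compose homeomorphic_imp_continuous_map
        intro: homeomorphic_map_compose)
qed

lemma marked_homeos_inv:
  assumes "f \<in> marked_homeos B" "B \<subseteq> topspace (nsphere 2)"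
  obtains h where "h \<in> marked_homeos B" "homeomorphic_maps (nsphere 2) (nsphere 2) f h"
proof -
  obtain h where h: "homeomorphic_maps (nsphere 2) (nsphere 2) f h"
    using assms(1) by (auto simp: marked_homeos_def homeomorphic_map_maps)
  have "Brouwer_degree2 2 h = 1"
    using Brouwer_degree2_homeomorphic_maps [OF h] assms(1) by (auto simp: marked_homeos_def)
  moreover have "homeomorphic_map (nsphere 2) (nsphere 2) h"
    using h homeomorphic_maps_map by blast
  moreover have "h ` B = B"
  proof -
    have "h ` (f ` B) = B"
      using h assms(2) by (force simp: homeomorphic_maps_def image_image)
    then show ?thesis using assms(1) by (simp add: marked_homeos_def)
  qed
  ultimately show ?thesis
    using that h by (simp add: marked_homeos_def)
qed

abbreviation (input) mhtp :: "(nat \<Rightarrow> real) set \<Rightarrow> ((nat \<Rightarrow> real) \<Rightarrow> (nat \<Rightarrow> real))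
    \<Rightarrow> ((nat \<Rightarrow> real) \<Rightarrow> (nat \<Rightarrow> real)) \<Rightarrow> bool" where
  "mhtp B \<equiv> homotopic_with (preserves_marked B) (nsphere 2) (nsphere 2)"

lemma mhtp_comp:
  assumes "mhtp B f f'" "mhtp B h h'"
  shows "mhtp B (f \<circ> h) (f' \<circ> h')"
proof -
  have c: "continuous_map (nsphere 2) (nsphere 2) h" "continuous_map (nsphere 2) (nsphere 2) f'"
    and P: "preserves_marked B h" "preserves_marked B f'"
    using assms homotopic_with_imp_continuous_maps homotopic_with_imp_property by blast+
  have "mhtp B (f \<circ> h) (f' \<circ> h)"
    by (rule homotopic_with_compose_continuous_map_right [OF assms(1) c(1)])
       (rule preserves_marked_comp [OF _ P(1)])
  moreover have "mhtp B (f' \<circ> h) (f' \<circ> h')"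
    by (rule homotopic_with_compose_continuous_map_left [OF assms(2) c(2)])
       (rule preserves_marked_comp [OF P(2)])
  ultimately show ?thesis
    by (rule homotopic_with_trans)
qed

lemma mapping_class_self:
  assumes "f \<in> marked_homeos B" "B \<subseteq> topspace (nsphere 2)"
  shows "f \<in> mapping_class B f"
  using assms by (simp add: mapping_class_def marked_homeos_continuous marked_homeos_preserves)

lemma mapping_class_eqI:
  assumes "mhtp B f h"
  shows "mapping_class B f = mapping_class B h"
proof -
  have "mhtp B f j \<longleftrightarrow> mhtp B h j" for j
    using assms homotopic_with_trans homotopic_with_symD by metis
  then show ?thesis by (simp add: mapping_class_def)
qed

lemma mult_mapping_class:
  assumes "B \<subseteq> topspace (nsphere 2)" "f \<in> marked_homeos B" "h \<in> marked_homeos B"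
  shows "mapping_class B f \<otimes>\<^bsub>Mod_group B\<^esub> mapping_class B h = mapping_class B (f \<circ> h)"
proof -
  have "mapping_class B (f' \<circ> h') = mapping_class B (f \<circ> h)"
    if "f' \<in> mapping_class B f" "h' \<in> mapping_class B h" for f' h'
  proof -
    have "mhtp B f f'" "mhtp B h h'"
      using that by (simp_all add: mapping_class_def)
    then show ?thesis
      by (intro mapping_class_eqI [symmetric] mhtp_comp)
  qed
  then have "(\<Union>f'\<in>mapping_class B f. \<Union>h'\<in>mapping_class B h. mapping_class B (f' \<circ> h')) =
      (\<Union>f'\<in>mapping_class B f. \<Union>h'\<in>mapping_class B h. mapping_class B (f \<circ> h))"
    by simp
  also have "\<dots> = mapping_class B (f \<circ> h)"
    using mapping_class_self [OF assms(2,1)] mapping_class_self [OF assms(3,1)] by blast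
  finally show ?thesis
    by (simp add: Mod_group_def)
qed

lemma mapping_class_inverse:
  assumes "B \<subseteq> topspace (nsphere 2)" "homeomorphic_maps (nsphere 2) (nsphere 2) f h"
    "f \<in> marked_homeos B" "h \<in> marked_homeos B"
  shows "mapping_class B (h \<circ> f) = mapping_class B id"
proof (rule mapping_class_eqI, rule homotopic_with_equal)
  show "preserves_marked B (h \<circ> f)" "preserves_marked B id"
    using assms marked_homeos_preserves marked_homeos_comp marked_homeos_id by blast+
  show "continuous_map (nsphere 2) (nsphere 2) (h \<circ> f)"
    using assms marked_homeos_comp marked_homeos_continuous by blast
  show "\<And>x. x \<in> topspace (nsphere 2) \<Longrightarrow> (h \<circ> f) x = id x"
    using assms by (simp add: homeomorphic_maps_def)
qed

lemma group_Mod_group: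
  assumes B: "B \<subseteq> topspace (nsphere 2)"
  shows "group (Mod_group B)"
proof (rule groupI)
  let ?c = "mapping_class B"
  have car: "carrier (Mod_group B) = ?c ` marked_homeos B"
    and one: "\<one>\<^bsub>Mod_group B\<^esub> = ?c id"
    by (simp_all add: Mod_group_def)
  show "\<one>\<^bsub>Mod_group B\<^esub> \<in> carrier (Mod_group B)"
    by (simp add: car one marked_homeos_id)
  show "U \<otimes>\<^bsub>Mod_group B\<^esub> V \<in> carrier (Mod_group B)"
    if "U \<in> carrier (Mod_group B)" "V \<in> carrier (Mod_group B)" for U V
    using that by (auto simp: car mult_mapping_class [OF B] marked_homeos_comp)
  show "U \<otimes>\<^bsub>Mod_group B\<^esub> V \<otimes>\<^bsub>Mod_group B\<^esub> W = U \<otimes>\<^bsub>Mod_group B\<^esub> (V \<otimes>\<^bsub>Mod_group B\<^esub> W)"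
    if "U \<in> carrier (Mod_group B)" "V \<in> carrier (Mod_group B)" "W \<in> carrier (Mod_group B)" for U V W
    using that by (auto simp: car mult_mapping_class [OF B] marked_homeos_comp comp_assoc)
  show "\<one>\<^bsub>Mod_group B\<^esub> \<otimes>\<^bsub>Mod_group B\<^esub> U = U" if "U \<in> carrier (Mod_group B)" for U
    using that by (auto simp: car one mult_mapping_class [OF B] marked_homeos_id)
  show "\<exists>V\<in>carrier (Mod_group B). V \<otimes>\<^bsub>Mod_group B\<^esub> U = \<one>\<^bsub>Mod_group B\<^esub>"
    if U: "U \<in> carrier (Mod_group B)" for U
  proof -
    obtain f where f: "f \<in> marked_homeos B" "U = ?c f"
      using U by (auto simp: car)
    obtain h where h: "h \<in> marked_homeos B" "homeomorphic_maps (nsphere 2) (nsphere 2) f h"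
      using marked_homeos_inv [OF f(1) B] .
    have "?c h \<otimes>\<^bsub>Mod_group B\<^esub> U = \<one>\<^bsub>Mod_group B\<^esub>"
      by (simp add: f one mult_mapping_class [OF B h(1) f(1)] mapping_class_inverse [OF B h(2) f(1) h(1)])
    then show ?thesis using h by (auto simp: car)
  qed
qed

lemma balanced_superelliptic_cover_surj:
  assumes "balanced_superelliptic_cover k S p"
  shows "p ` S = topspace (nsphere 2)"
proof -
  have "quotient_map (top_of_set S) (nsphere 2) p"
    using assms by (simp add: balanced_superelliptic_cover_def)
  from quotient_imp_surjective_map [OF this] show ?thesis
    by simp
qed

lemma branch_set_subset:
  assumes "balanced_superelliptic_cover k S p"
  shows "branch_set k S p \<subseteq> topspace (nsphere 2)"
proof -
  have "p ` S = topspace (nsphere 2)"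
    by (rule balanced_superelliptic_cover_surj [OF assms])
  then show ?thesis unfolding branch_set_def by blast
qed

lemma liftable_comp:
  assumes "liftable S p f" "liftable S p h"
  shows "liftable S p (f \<circ> h)"
proof -
  obtain F H where FH: "homeomorphic_map (top_of_set S) (top_of_set S) F" "\<forall>x\<in>S. p (F x) = f (p x)"
    "homeomorphic_map (top_of_set S) (top_of_set S) H" "\<forall>x\<in>S. p (H x) = h (p x)"
    using assms by (auto simp: liftable_def)
  have "H x \<in> S" if "x \<in> S" for x
    using homeomorphic_imp_surjective_map [OF FH(3)] that by auto
  then have "\<forall>x\<in>S. p ((F \<circ> H) x) = (f \<circ> h) (p x)"
    using FH(2,4) by simp
  moreover have "homeomorphic_map (top_of_set S) (top_of_set S) (F \<circ> H)"
    using FH homeomorphic_map_compose by blast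
  ultimately show ?thesis unfolding liftable_def by blast
qed

lemma liftable_inv:
  assumes "liftable S p f" "p ` S = topspace (nsphere 2)" "homeomorphic_maps (nsphere 2) (nsphere 2) f h"
  shows "liftable S p h"
proof -
  obtain F where F: "homeomorphic_map (top_of_set S) (top_of_set S) F" "\<forall>x\<in>S. p (F x) = f (p x)"
    using assms by (auto simp: liftable_def)
  then obtain H where H: "homeomorphic_maps (top_of_set S) (top_of_set S) F H"
    using homeomorphic_map_maps by blast
  have HS: "H x \<in> S" "F (H x) = x" if "x \<in> S" for x
    using H that by (auto simp: homeomorphic_maps_def continuous_map_def)
  have "p (H x) = h (p x)" if x: "x \<in> S" for x
  proof -
    have "p x = f (p (H x))"
      using F HS x by metis
    moreover have "p (H x) \<in> topspace (nsphere 2)"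
      using HS x assms(2) by auto
    ultimately show ?thesis
      using assms(3) by (simp add: homeomorphic_maps_def)
  qed
  moreover have "homeomorphic_map (top_of_set S) (top_of_set S) H"
    using H homeomorphic_maps_map by blast
  ultimately show ?thesis unfolding liftable_def by blast
qed

lemma subgroup_LMod:
  assumes p: "balanced_superelliptic_cover k S p"
  defines "B \<equiv> branch_set k S p"
  shows "subgroup (LMod S p B) (Mod_group B)"
proof -
  have B: "B \<subseteq> topspace (nsphere 2)"
    unfolding B_def by (rule branch_set_subset [OF p])
  interpret group "Mod_group B"
    by (rule group_Mod_group [OF B])
  have pS: "p ` S = topspace (nsphere 2)"
    by (rule balanced_superelliptic_cover_surj [OF p])
  have lid: "liftable S p id"
    unfolding liftable_def by (rule exI [of _ id]) auto
  show ?thesis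
  proof (rule subgroupI)
    show "LMod S p B \<subseteq> carrier (Mod_group B)"
      by (auto simp: LMod_def Mod_group_def)
    show "LMod S p B \<noteq> {}"
      using lid marked_homeos_id by (auto simp: LMod_def)
    show "U \<otimes>\<^bsub>Mod_group B\<^esub> V \<in> LMod S p B" if "U \<in> LMod S p B" "V \<in> LMod S p B" for U V
      using that by (auto simp: LMod_def mult_mapping_class [OF B] marked_homeos_comp liftable_comp)
    show "inv\<^bsub>Mod_group B\<^esub> U \<in> LMod S p B" if U: "U \<in> LMod S p B" for U
    proof -
      obtain f where f: "f \<in> marked_homeos B" "U = mapping_class B f" "liftable S p f"
        using U by (auto simp: LMod_def)
      obtain h where h: "h \<in> marked_homeos B" "homeomorphic_maps (nsphere 2) (nsphere 2) f h"
        using marked_homeos_inv [OF f(1) B] .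
      have "mapping_class B h \<otimes>\<^bsub>Mod_group B\<^esub> U = \<one>\<^bsub>Mod_group B\<^esub>"
        unfolding f(2) mult_mapping_class [OF B h(1) f(1)] mapping_class_inverse [OF B h(2) f(1) h(1)]
        by (simp add: Mod_group_def)
      then have "inv\<^bsub>Mod_group B\<^esub> U = mapping_class B h"
        using f h by (intro inv_equality) (auto simp: Mod_group_def)
      then show ?thesis
        using h liftable_inv [OF f(3) pS h(2)] by (auto simp: LMod_def)
    qed
  qed
qed

end

theory Submission
  imports Defs "HOL-Complex_Analysis.Complex_Analysis"
begin

text \<open>
  Write a point of \<open>S\<close> as a complex number \<open>q\<close> together with its height. As \<open>q \<circ> \<zeta> = \<omega> q\<close> with
  \<open>\<omega> = e\<^sup>2\<^sup>\<pi>\<^sup>i\<^sup>/\<^sup>k\<close>, the function \<open>q\<^sup>k\<close> descends to a function \<open>hh\<close> on the sphere; its zeros are the branch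
  points \<open>bb 0, \<dots>, bb (2 n + 1)\<close>, and the cover adjoins a \<open>k\<close>-th root of \<open>hh\<close>. So \<open>f\<close> lifts iff
  \<open>hh \<circ> f = hh\<^sup>u r\<^sup>k\<close> for some exponent \<open>u\<close> and some continuous \<open>r\<close>. Maps from a punctured sphere
  to the nonzero complex numbers are classified, up to factors with a continuous logarithm
  (\<open>logeq\<close>), by their local orders at the punctures, so lifting is a congruence modulo \<open>k\<close> between
  the orders of \<open>hh\<close> at \<open>b\<close> and at \<open>f b\<close>. Following the winding of \<open>hh\<close> along the horizontal slices
  shows that the order at \<open>bb i\<close> is \<open>\<plusminus>(-1)\<^sup>i\<close> modulo \<open>k\<close>. Hence for \<open>k = 2\<close> everything lifts, while for
  \<open>k \<ge> 3\<close> the map \<open>f\<close> lifts iff it preserves or exchanges the two classes of alternate branch points.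
  Since every permutation of the branch points is realised by a homeomorphism, the cosets correspond
  to the splittings of the branch points into two halves.
\<close>

section \<open>Continuous logarithms\<close>

text \<open>The hypotheses describe the slices of the surface one at a time and say nothing about
  how slices at different heights fit together. So the winding of \<open>hh\<close> cannot be
  followed along a continuous family of loops upstairs. Downstairs the slices \<open>LL a\<close>
  are the levels of a function with connected fibres, and exponents on them are measured against one
  function \<open>t\<close> with a zero at the lower and a pole at the upper end. Between heights
  \<open>2 m - 1\<close> and \<open>2 m\<close> a slice upstairs consists of rotates of one curve
  missing 0, so \<open>hh\<close> is a \<open>k\<close>-th power there and its exponent is divisible
  by \<open>k\<close>. Between \<open>2 m\<close> and \<open>2 m + 1\<close> the exponent is a sign;
  that it does not depend on \<open>m\<close> is carried across the intermediate heights by a second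
  function \<open>hc c\<close>, obtained by moving the zeros of \<open>hh\<close> off the axis.
  These exponents are partial sums of the orders, whence the alternation. A separate obstacle is
  that \<open>marked_homeos\<close> fixes orientation by a homological degree, whereas orders see
  the local degree; the two are compared by deforming a map to the identity.\<close>

definition logeq :: "'a::topological_space set \<Rightarrow> ('a \<Rightarrow> complex) \<Rightarrow> ('a \<Rightarrow> complex) \<Rightarrow> bool" where
  "logeq K g h \<longleftrightarrow> (\<exists>l. continuous_on K l \<and> (\<forall>x\<in>K. g x = h x * exp (l x)))"

lemma logeqI:
  assumes "continuous_on K l" "\<And>x. x \<in> K \<Longrightarrow> g x = h x * exp (l x)"
  shows "logeq K g h"
  using assms unfolding logeq_def by blast

lemma logeqE:
  assumes "logeq K g h"
  obtains l where "continuous_on K l" "\<And>x. x \<in> K \<Longrightarrow> g x = h x * exp (l x)"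
  using assms unfolding logeq_def by blast

lemma logeq_eq: "(\<And>x. x \<in> K \<Longrightarrow> g x = h x) \<Longrightarrow> logeq K g h"
  by (rule logeqI [where l="\<lambda>_. 0"]) auto

lemma logeq_refl [simp]: "logeq K g g"
  by (rule logeq_eq) auto

lemma logeq_cong:
  assumes "\<And>x. x \<in> K \<Longrightarrow> g x = g' x" "\<And>x. x \<in> K \<Longrightarrow> h x = h' x"
  shows "logeq K g h \<longleftrightarrow> logeq K g' h'"
  using assms unfolding logeq_def by auto

lemma logeq_sym:
  assumes "logeq K g h" shows "logeq K h g"
proof -
  obtain l where "continuous_on K l" "\<And>x. x \<in> K \<Longrightarrow> g x = h x * exp (l x)"
    using assms unfolding logeq_def by blast
  then show ?thesis
    by (intro logeqI [where l="\<lambda>x. - l x"] continuous_intros) (auto simp: exp_minus)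
qed

lemma logeq_trans [trans]:
  assumes "logeq K g h" "logeq K h j" shows "logeq K g j"
proof -
  obtain l where "continuous_on K l" "\<And>x. x \<in> K \<Longrightarrow> g x = h x * exp (l x)"
    using assms(1) unfolding logeq_def by blast
  moreover obtain m where "continuous_on K m" "\<And>x. x \<in> K \<Longrightarrow> h x = j x * exp (m x)"
    using assms(2) unfolding logeq_def by blast
  ultimately show ?thesis
    by (intro logeqI [where l="\<lambda>x. m x + l x"] continuous_intros) (auto simp: exp_add)
qed

lemma logeq_subset: "logeq K g h \<Longrightarrow> L \<subseteq> K \<Longrightarrow> logeq L g h"
  unfolding logeq_def by (meson continuous_on_subset subsetD)

lemma logeq_mult:
  assumes "logeq K g h" "logeq K g' h'"
  shows "logeq K (\<lambda>x. g x * g' x) (\<lambda>x. h x * h' x)"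
proof -
  obtain l where "continuous_on K l" "\<And>x. x \<in> K \<Longrightarrow> g x = h x * exp (l x)"
    using assms(1) unfolding logeq_def by blast
  moreover obtain m where "continuous_on K m" "\<And>x. x \<in> K \<Longrightarrow> g' x = h' x * exp (m x)"
    using assms(2) unfolding logeq_def by blast
  ultimately show ?thesis
    by (intro logeqI [where l="\<lambda>x. l x + m x"] continuous_intros) (auto simp: exp_add)
qed

lemma logeq_powi:
  assumes "logeq K g h"
  shows "logeq K (\<lambda>x. g x powi n) (\<lambda>x. h x powi n)"
proof -
  obtain l where "continuous_on K l" "\<And>x. x \<in> K \<Longrightarrow> g x = h x * exp (l x)"
    using assms(1) unfolding logeq_def by blast
  then show ?thesis
    by (intro logeqI [where l="\<lambda>x. of_int n * l x"] continuous_intros)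
       (auto simp: power_int_mult_distrib exp_power_int)
qed

lemma logeq_inverse:
  assumes "logeq K g h"
  shows "logeq K (\<lambda>x. inverse (g x)) (\<lambda>x. inverse (h x))"
proof -
  obtain l where "continuous_on K l" "\<And>x. x \<in> K \<Longrightarrow> g x = h x * exp (l x)"
    using assms unfolding logeq_def by blast
  then show ?thesis
    by (intro logeqI [where l="\<lambda>x. - l x"] continuous_intros) (auto simp: exp_minus)
qed

lemma logeq_divide:
  assumes "logeq K g h" "logeq K g' h'"
  shows "logeq K (\<lambda>x. g x / g' x) (\<lambda>x. h x / h' x)"
  using logeq_mult [OF assms(1) logeq_inverse [OF assms(2)]] by (simp add: divide_inverse)

lemma logeq_prod:
  assumes "\<And>i. i \<in> I \<Longrightarrow> logeq K (g i) (h i)"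
  shows "logeq K (\<lambda>x. \<Prod>i\<in>I. g i x) (\<lambda>x. \<Prod>i\<in>I. h i x)"
  using assms
proof (induction I rule: infinite_finite_induct)
  case (insert i I)
  then show ?case using logeq_mult [of K "g i" "h i"] by (simp add: insert.hyps)
qed auto

lemma logeq_compose:
  assumes "logeq K g h" "continuous_on L \<phi>" "\<phi> ` L \<subseteq> K"
  shows "logeq L (\<lambda>x. g (\<phi> x)) (\<lambda>x. h (\<phi> x))"
proof -
  obtain l where "continuous_on K l" "\<And>x. x \<in> K \<Longrightarrow> g x = h x * exp (l x)"
    using assms(1) unfolding logeq_def by blast
  then show ?thesis
    using assms(2,3)
    by (intro logeqI [where l="\<lambda>x. l (\<phi> x)"] continuous_on_compose2 [of K l L \<phi>]) auto
qed

lemma logeq_const: "c \<noteq> 0 \<Longrightarrow> logeq K (\<lambda>_. c) (\<lambda>_. 1)"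
  by (rule logeqI [where l="\<lambda>_. Ln c"]) auto

lemma logeq_near_1:
  assumes "continuous_on K g" "\<And>x. x \<in> K \<Longrightarrow> norm (g x - 1) < 1"
  shows "logeq K g (\<lambda>_. 1)"
proof -
  have *: "Re (g x) > 0" if "x \<in> K" for x
    using assms(2) [OF that] abs_Re_le_cmod [of "g x - 1"] by simp
  have "g x \<notin> \<real>\<^sub>\<le>\<^sub>0" if "x \<in> K" for x
    using * [OF that] by (auto simp: complex_nonpos_Reals_iff)
  moreover have "g x \<noteq> 0" if "x \<in> K" for x
    using * [OF that] by auto
  ultimately show ?thesis
    using assms(1) by (intro logeqI [where l="\<lambda>x. Ln (g x)"] continuous_on_Ln') auto
qed

text \<open>Rouche's inequality: the quotient stays in the disc of radius 1 about 1, where the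
  principal logarithm is continuous.\<close>

lemma logeq_near:
  assumes "continuous_on K g" "continuous_on K h"
    "\<And>x. x \<in> K \<Longrightarrow> norm (g x - h x) < norm (h x)"
  shows "logeq K g h"
proof -
  have nz: "h x \<noteq> 0" if "x \<in> K" for x
    using assms(3) [OF that] by auto
  have "norm (g x / h x - 1) < 1" if "x \<in> K" for x
  proof -
    have "g x / h x - 1 = (g x - h x) / h x" using nz [OF that] by (simp add: divide_simps)
    then show ?thesis using assms(3) [OF that] nz [OF that] by (simp add: norm_divide)
  qed
  then have "logeq K (\<lambda>x. g x / h x) (\<lambda>_. 1)"
    using nz by (intro logeq_near_1 continuous_intros assms) auto
  from logeq_mult [OF this logeq_refl [of K h]] show ?thesis
    by (rule iffD1 [OF logeq_cong, rotated 2]) (use nz in auto)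
qed

lemma logeq_divide_iff:
  assumes "\<And>x. x \<in> K \<Longrightarrow> h x \<noteq> 0"
  shows "logeq K (\<lambda>x. g x / h x) (\<lambda>_. 1) \<longleftrightarrow> logeq K g h"
  unfolding logeq_def using assms by (auto simp: divide_simps mult.commute)

lemma logeq_log:
  assumes "logeq K g (\<lambda>_. 1)"
  obtains l where "continuous_on K l" "\<And>x. x \<in> K \<Longrightarrow> g x = exp (l x)"
  using assms by (auto elim: logeqE)

lemma logeq_on_contractible:
  fixes K :: "'a::real_normed_vector set"
  assumes "contractible K" "continuous_on K g" "\<And>x. x \<in> K \<Longrightarrow> g x \<noteq> 0"
  shows "logeq K g (\<lambda>_. 1)"
  using continuous_logarithm_on_contractible [OF assms(2,1,3)]
  by (metis logeqI mult_1)

text \<open>Having a logarithm is an open condition. Tietze extends the logarithm from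
  \<open>K\<close> to all of \<open>U\<close>; the corrected function \<open>h * exp m\<close>
  agrees with \<open>g\<close> on \<open>K\<close>, so Rouche's inequality holds on a neighbourhood
  of \<open>K\<close>.\<close>

lemma logeq_extend_nbhd:
  fixes K :: "'a::{metric_space,second_countable_topology} set"
  assumes K: "closedin (top_of_set U) K" and cont: "continuous_on U g" "continuous_on U h"
    and nz: "\<And>x. x \<in> U \<Longrightarrow> h x \<noteq> 0" and eq: "logeq K g h"
  obtains W where "openin (top_of_set U) W" "K \<subseteq> W" "logeq W g h"
proof -
  obtain l where l: "continuous_on K l" "\<And>x. x \<in> K \<Longrightarrow> g x = h x * exp (l x)"
    using eq unfolding logeq_def by blast
  obtain m where m: "continuous_on U m" "\<And>x. x \<in> K \<Longrightarrow> m x = l x"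
    using Tietze_unbounded [OF l(1) K] by metis
  let ?d = "\<lambda>x. norm (g x - h x * exp (m x)) - norm (h x * exp (m x))"
  define W where "W = U \<inter> ?d -` {..<0}"
  have "openin (top_of_set U) W"
    unfolding W_def
    by (intro continuous_openin_preimage_gen continuous_intros cont m)
  moreover have "K \<subseteq> W"
    using K closedin_imp_subset nz l(2) m(2) by (fastforce simp: W_def)
  moreover have "logeq W g (\<lambda>x. h x * exp (m x))"
    by (rule logeq_near)
       (auto simp: W_def intro!: continuous_intros continuous_on_subset [OF cont(1)]
         continuous_on_subset [OF cont(2)] continuous_on_subset [OF m(1)])
  moreover have "logeq W (\<lambda>x. h x * exp (m x)) h"
    using continuous_on_subset [OF m(1), of W] by (intro logeqI [where l=m]) (auto simp: W_def)
  ultimately show thesis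
    using that logeq_trans by blast
qed

text \<open>A continuous map from a compact space to a Hausdorff space is closed, hence a quotient
  map onto its image.\<close>

lemma continuous_on_descend:
  fixes \<phi> :: "'a::t2_space \<Rightarrow> 'b::t2_space" and m :: "'a \<Rightarrow> 'c::topological_space"
  assumes "compact A" "continuous_on A \<phi>" "continuous_on A m"
    and eq: "\<And>x y. x \<in> A \<Longrightarrow> y \<in> A \<Longrightarrow> \<phi> x = \<phi> y \<Longrightarrow> m x = m y"
  obtains l where "continuous_on (\<phi> ` A) l" "\<And>x. x \<in> A \<Longrightarrow> l (\<phi> x) = m x"
proof -
  define l where "l y = m (SOME x. x \<in> A \<and> \<phi> x = y)" for y
  have l: "l (\<phi> x) = m x" if "x \<in> A" for x
  proof -
    have "(SOME x'. x' \<in> A \<and> \<phi> x' = \<phi> x) \<in> A \<and> \<phi> (SOME x'. x' \<in> A \<and> \<phi> x' = \<phi> x) = \<phi> x"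
      by (rule someI [of _ x]) (use that in auto)
    then show ?thesis
      unfolding l_def using eq that by blast
  qed
  have "closedin (top_of_set (\<phi> ` A)) (\<phi> ` A \<inter> l -` C)" if "closed C" for C
  proof -
    have "l (\<phi> x) \<in> C \<longleftrightarrow> m x \<in> C" if "x \<in> A" for x
      using l [OF that] by simp
    then have "\<phi> ` A \<inter> l -` C = \<phi> ` (A \<inter> m -` C)"
      by blast
    moreover have "compact (A \<inter> m -` C)"
      by (rule closedin_compact [OF assms(1) continuous_closedin_preimage [OF assms(3) that]])
    ultimately have "compact (\<phi> ` A \<inter> l -` C)"
      using compact_continuous_image [OF continuous_on_subset [OF assms(2)], of "A \<inter> m -` C"] by simp
    then show ?thesis
      by (intro closed_subset compact_imp_closed) auto
  qed
  then have "continuous_on (\<phi> ` A) l"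
    unfolding continuous_closedin_preimage_eq by blast
  then show thesis using that l by blast
qed

section \<open>Winding along Jordan curves\<close>

lemma path_logarithm:
  assumes "path \<gamma>" "c \<notin> path_image \<gamma>"
  obtains P where "continuous_on {0..1} P" "\<And>t. t \<in> {0..1} \<Longrightarrow> \<gamma> t - c = exp (P t)"
    "P 1 - P 0 = 2 * of_real pi * \<i> * winding_number \<gamma> c"
proof -
  have cont: "continuous_on {0..1} (\<lambda>t. \<gamma> t - c)"
    using assms(1) by (intro continuous_intros) (auto simp: path_def)
  have nz: "\<gamma> t - c \<noteq> 0" if "t \<in> {0..1}" for t
    using assms(2) that by (auto simp: path_image_def)
  obtain P where P: "continuous_on {0..1} P" "\<And>t. t \<in> {0..1} \<Longrightarrow> \<gamma> t - c = exp (P t)"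
    using continuous_logarithm_on_contractible [OF cont convex_imp_contractible nz]
    by (metis convex_real_interval(5))
  have "winding_number \<gamma> c = winding_number (\<lambda>t. \<gamma> t - c) 0"
    by (rule winding_number_offset)
  also have "\<dots> = winding_number (exp \<circ> P) 0"
    by (rule winding_number_cong) (simp add: P(2))
  also have "\<dots> = (P 1 - P 0) / (2 * of_real pi * \<i>)"
    using winding_number_compose_exp [of P] P(1) by (simp add: path_def pathfinish_def pathstart_def)
  finally have "P 1 - P 0 = 2 * of_real pi * \<i> * winding_number \<gamma> c"
    by (simp add: field_simps)
  with P show thesis using that by blast
qed

text \<open>The values of \<open>d\<close> are integer multiples of \<open>2 pi i\<close>, and
  distinct multiples are at least \<open>2 pi\<close> apart.\<close>

lemma exp_eq_1_imp_constant:
  fixes d :: "'a::topological_space \<Rightarrow> complex"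
  assumes "connected S" "continuous_on S d" "\<And>x. x \<in> S \<Longrightarrow> exp (d x) = 1"
  obtains n :: int where "\<And>x. x \<in> S \<Longrightarrow> d x = of_int n * (2 * of_real pi * \<i>)"
proof -
  let ?p = "2 * of_real pi * \<i> :: complex"
  have "\<exists>n::int. d x = of_int n * ?p" if x: "x \<in> S" for x
  proof -
    have "exp (d x) = exp 0" using assms(3)[OF x] by simp
    then obtain n :: int where "d x = 0 + of_int (2 * n) * pi * \<i>" using exp_eq by blast
    then show ?thesis by (intro exI [of _ n]) simp
  qed
  then obtain n where n: "\<And>x. x \<in> S \<Longrightarrow> d x = of_int (n x) * ?p"
    by metis
  have "d constant_on S"
  proof (rule continuous_discrete_range_constant [OF assms(1,2)])
    show "\<exists>e>0. \<forall>y. y \<in> S \<and> d y \<noteq> d x \<longrightarrow> e \<le> cmod (d y - d x)" if "x \<in> S" for x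
    proof (intro exI [of _ "2 * pi"] conjI allI impI)
      fix y assume y: "y \<in> S \<and> d y \<noteq> d x"
      have "n y \<noteq> n x" using n that y by metis
      then have "1 \<le> \<bar>n y - n x\<bar>" by linarith
      then have "1 \<le> cmod (of_int (n y - n x))"
        by (simp only: norm_of_int)
      moreover have "d y - d x = of_int (n y - n x) * ?p"
        using n that y by (simp add: algebra_simps)
      ultimately show "2 * pi \<le> cmod (d y - d x)"
        by (simp only: norm_mult) simp
    qed simp
  qed
  then obtain c where c: "\<And>x. x \<in> S \<Longrightarrow> d x = c"
    by (auto simp: constant_on_def)
  show thesis
  proof (cases "S = {}")
    case False
    then show ?thesis using that n c by (metis all_not_in_conv)
  qed (use that in auto)
qed

lemma exp_eq_const_diff:
  fixes P Q :: "real \<Rightarrow> complex"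
  assumes "continuous_on {0..1} P" "continuous_on {0..1} Q" "\<And>t. t \<in> {0..1} \<Longrightarrow> exp (P t) = exp (Q t)"
  shows "P 1 - P 0 = Q 1 - Q 0"
proof -
  obtain n :: int where d: "\<And>t. t \<in> {0..1} \<Longrightarrow> P t - Q t = of_int n * (2 * of_real pi * \<i>)"
    by (rule exp_eq_1_imp_constant [of "{0..1}" "\<lambda>t. P t - Q t"])
      (use assms in \<open>auto intro!: continuous_intros simp: exp_diff\<close>)
  have "P 1 - Q 1 = P 0 - Q 0" using d [of 0] d [of 1] by simp
  then show ?thesis by (simp add: algebra_simps)
qed

text \<open>A logarithm on all of \<open>K\<close> has increment zero along a closed path, whereas a
  logarithm of \<open>(z - c) powi n\<close> has increment \<open>2 pi i n\<close> times the winding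
  number.\<close>

lemma logeq_powi_trivial:
  assumes "path \<gamma>" "pathfinish \<gamma> = pathstart \<gamma>" "path_image \<gamma> \<subseteq> K" "c \<notin> path_image \<gamma>"
    "winding_number \<gamma> c \<noteq> 0" "logeq K (\<lambda>z. (z - c) powi n) (\<lambda>_. 1)"
  shows "n = 0"
proof -
  obtain P where P: "continuous_on {0..1} P" "\<And>t. t \<in> {0..1} \<Longrightarrow> \<gamma> t - c = exp (P t)"
    "P 1 - P 0 = 2 * of_real pi * \<i> * winding_number \<gamma> c"
    using path_logarithm [OF assms(1,4)] by blast
  obtain l where l: "continuous_on K l" "\<And>z. z \<in> K \<Longrightarrow> (z - c) powi n = exp (l z)"
    using logeq_log [OF assms(6)] by blast
  have g: "continuous_on {0..1} \<gamma>" "\<And>t. t \<in> {0..1} \<Longrightarrow> \<gamma> t \<in> K"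
    using assms(1,3) by (auto simp: path_def path_image_def)
  have "of_int n * P 1 - of_int n * P 0 = l (\<gamma> 1) - l (\<gamma> 0)"
  proof (rule exp_eq_const_diff [of "\<lambda>t. of_int n * P t" "\<lambda>t. l (\<gamma> t)"])
    show "continuous_on {0..1} (\<lambda>t. l (\<gamma> t))"
      by (rule continuous_on_compose2 [OF l(1) g(1)]) (use g(2) in auto)
    show "exp (of_int n * P t) = exp (l (\<gamma> t))" if "t \<in> {0..1}" for t
      using l(2) [OF g(2) [OF that]] P(2) [OF that] by (simp flip: exp_power_int)
  qed (intro continuous_intros P)
  also have "\<dots> = 0"
    using assms(2) by (simp add: pathfinish_def pathstart_def)
  finally have "of_int n * (P 1 - P 0) = 0"
    by (simp add: algebra_simps)
  then show ?thesis
    using P(3) assms(5) by simp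
qed

lemma logeq_circle_powi_trivial:
  fixes a :: complex
  assumes "0 < r" "sphere a r \<subseteq> K" "logeq K (\<lambda>z. (z - a) powi n) (\<lambda>_. 1)"
  shows "n = 0"
proof (rule logeq_powi_trivial [OF _ _ _ _ _ assms(3)])
  show "path_image (circlepath a r) \<subseteq> K"
    using assms by simp
  show "winding_number (circlepath a r) a \<noteq> 0"
    using winding_number_circlepath [of a a r] assms by simp
qed (use assms in auto)

lemma logeq_generator_loop:
  assumes \<gamma>: "path \<gamma>" "pathfinish \<gamma> = pathstart \<gamma>" "\<And>s t. s \<in> {0..1} \<Longrightarrow> t \<in> {0..1} \<Longrightarrow> \<gamma> s = \<gamma> t \<Longrightarrow> s = t \<or> {s, t} = {0, 1}"
    and c: "c \<notin> path_image \<gamma>" "winding_number \<gamma> c \<in> {1, -1}"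
    and g: "continuous_on (path_image \<gamma>) g" "\<And>z. z \<in> path_image \<gamma> \<Longrightarrow> g z \<noteq> 0"
  obtains w where "logeq (path_image \<gamma>) g (\<lambda>z. (z - c) powi w)"
proof -
  have gc: "continuous_on {0..1} \<gamma>" and gi: "\<gamma> ` {0..1} = path_image \<gamma>"
    using \<gamma> by (auto simp: path_def path_image_def)
  obtain \<epsilon> :: int where \<epsilon>: "winding_number \<gamma> c = of_int \<epsilon>" "\<epsilon> * \<epsilon> = 1"
    using c(2) that by (metis insert_iff of_int_1 of_int_minus mult_1 mult_minus1 minus_minus empty_iff)
  have pg: "path (g \<circ> \<gamma>)" "pathfinish (g \<circ> \<gamma>) = pathstart (g \<circ> \<gamma>)" "0 \<notin> path_image (g \<circ> \<gamma>)"
    using path_continuous_image [OF \<gamma>(1) g(1)] \<gamma>(2) g(2)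
    by (auto simp: pathfinish_compose pathstart_compose path_image_compose)
  obtain w0 where w0: "winding_number (g \<circ> \<gamma>) 0 = of_int w0"
    using integer_winding_number [OF pg] by (auto elim: Ints_cases)
  obtain P where P: "continuous_on {0..1} P" "\<And>t. t \<in> {0..1} \<Longrightarrow> \<gamma> t - c = exp (P t)"
    "P 1 - P 0 = 2 * of_real pi * \<i> * winding_number \<gamma> c"
    using path_logarithm [OF \<gamma>(1) c(1)] by blast
  obtain Q where Q: "continuous_on {0..1} Q" "\<And>t. t \<in> {0..1} \<Longrightarrow> (g \<circ> \<gamma>) t - 0 = exp (Q t)"
    "Q 1 - Q 0 = 2 * of_real pi * \<i> * winding_number (g \<circ> \<gamma>) 0"
    using path_logarithm [OF pg(1,3)] by blast
  \<comment> \<open>The sign \<epsilon> is its own inverse, so with this exponent \<open>Q\<close>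
    and \<open>w P\<close> have equal increments. Their difference then takes the same value at 0
    and 1, the only parameters that \<gamma> identifies, and descends to the image.\<close>
  define w where "w = w0 * \<epsilon>"
  define m where "m t = Q t - of_int w * P t" for t
  have "m 1 - m 0 = (Q 1 - Q 0) - of_int w * (P 1 - P 0)"
    by (simp add: m_def algebra_simps)
  also have "\<dots> = 2 * of_real pi * \<i> * (of_int w0 - of_int w * of_int \<epsilon>)"
    unfolding P(3) Q(3) w0 \<epsilon>(1) by (simp add: algebra_simps)
  also have "of_int w0 - of_int w * (of_int \<epsilon> :: complex) = of_int (w0 * (1 - \<epsilon> * \<epsilon>))"
    by (simp add: w_def algebra_simps)
  finally have m01: "m 1 = m 0" using \<epsilon>(2) by simp
  obtain l where l: "continuous_on (\<gamma> ` {0..1}) l" "\<And>t. t \<in> {0..1} \<Longrightarrow> l (\<gamma> t) = m t"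
  proof (rule continuous_on_descend [of "{0..1::real}" \<gamma> m])
    show "continuous_on {0..1} m"
      unfolding m_def by (intro continuous_intros P Q)
    show "m s = m t" if "s \<in> {0..1}" "t \<in> {0..1}" "\<gamma> s = \<gamma> t" for s t
      using \<gamma>(3) [OF that] m01 by (auto simp: doubleton_eq_iff)
  qed (use gc in auto)
  have "g z = (z - c) powi w * exp (l z)" if z: "z \<in> path_image \<gamma>" for z
  proof -
    obtain t where t: "t \<in> {0..1}" "z = \<gamma> t" using z gi by blast
    have "(z - c) powi w * exp (l z) = exp (of_int w * P t + m t)"
      using P(2) [OF t(1)] l(2) [OF t(1)] t(2) by (simp add: exp_power_int exp_add)
    also have "\<dots> = g z" using Q(2) [OF t(1)] t(2) by (simp add: m_def)
    finally show ?thesis by simp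
  qed
  then show thesis
    using that logeqI [of "path_image \<gamma>" l g] l(1) gi by metis
qed

section \<open>Exponents along Jordan curves\<close>

definition jordan_curve :: "complex set \<Rightarrow> bool" where
  "jordan_curve K \<longleftrightarrow> (\<exists>\<gamma>. simple_path \<gamma> \<and> pathfinish \<gamma> = pathstart \<gamma> \<and> path_image \<gamma> = K)"

lemma jordan_curve_homeomorphic:
  assumes "K homeomorphic (sphere 0 1 :: complex set)"
  shows "jordan_curve K"
proof -
  obtain f g where fg: "homeomorphism (sphere 0 1 :: complex set) K f g"
    using assms homeomorphic_def homeomorphic_sym by blast
  let ?\<gamma> = "f \<circ> circlepath 0 1"
  have "simple_path ?\<gamma>"
    using fg by (intro simple_path_continuous_image)
      (auto simp: homeomorphism_def simple_path_circlepath intro: inj_on_inverseI)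
  moreover have "path_image ?\<gamma> = K"
    using fg by (simp add: path_image_compose homeomorphism_def)
  moreover have "pathfinish ?\<gamma> = pathstart ?\<gamma>"
    by (simp add: pathfinish_compose pathstart_compose)
  ultimately show ?thesis unfolding jordan_curve_def by blast
qed

lemma jordan_curve_image:
  assumes "jordan_curve K" "continuous_on K f" "inj_on f K"
  shows "jordan_curve (f ` K)"
proof -
  obtain \<gamma> where \<gamma>: "simple_path \<gamma>" "pathfinish \<gamma> = pathstart \<gamma>" "path_image \<gamma> = K"
    using assms(1) by (auto simp: jordan_curve_def)
  then have "simple_path (f \<circ> \<gamma>)" "pathfinish (f \<circ> \<gamma>) = pathstart (f \<circ> \<gamma>)" "path_image (f \<circ> \<gamma>) = f ` K"
    using assms(2,3) by (auto intro: simple_path_continuous_image simp: pathfinish_compose pathstart_compose path_image_compose)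
  then show ?thesis unfolding jordan_curve_def by blast
qed

lemma jordan_curve_facts:
  assumes "jordan_curve K"
  shows "compact K" "connected K" "K \<noteq> {}" "inside K \<noteq> {}" "open (inside K)" "connected (inside K)"
    "bounded (inside K)" "open (outside K)" "connected (outside K)" "inside K \<union> outside K = - K"
    "frontier (inside K) = K" "frontier (outside K) = K"
proof -
  obtain \<gamma> where \<gamma>: "simple_path \<gamma>" "pathfinish \<gamma> = pathstart \<gamma>" "path_image \<gamma> = K"
    using assms by (auto simp: jordan_curve_def)
  show "compact K" "connected K" "K \<noteq> {}"
    using \<gamma> by (auto simp: compact_simple_path_image connected_simple_path_image)
  show "inside K \<noteq> {}" "open (inside K)" "connected (inside K)"
    "bounded (inside K)" "open (outside K)" "connected (outside K)" "inside K \<union> outside K = - K"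
    "frontier (inside K) = K" "frontier (outside K) = K"
    using Jordan_inside_outside [OF \<gamma>(1,2)] \<gamma>(3) by auto
qed

text \<open>A simple closed path winds once around each inside point, in one direction or the other.
  With \<open>jordan_powi_trivial\<close> this makes the nonvanishing functions on \<open>K\<close>,
  up to \<open>logeq\<close>, an infinite cyclic group generated by \<open>z - c\<close>.\<close>

lemma jordan_generator:
  assumes "jordan_curve K" "c \<in> inside K" "continuous_on K g" "\<And>z. z \<in> K \<Longrightarrow> g z \<noteq> 0"
  obtains w where "logeq K g (\<lambda>z. (z - c) powi w)"
proof -
  obtain \<gamma> where \<gamma>: "simple_path \<gamma>" "pathfinish \<gamma> = pathstart \<gamma>" "path_image \<gamma> = K"
    using assms by (auto simp: jordan_curve_def)
  have w: "winding_number \<gamma> c \<in> {1, -1}"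
    using simple_closed_path_winding_number_inside [OF \<gamma>(1)] assms(2) \<gamma>(3) by (metis insert_iff)
  have "c \<notin> path_image \<gamma>"
    using assms(2) \<gamma>(3) by (simp add: inside_def)
  moreover have "s = t \<or> {s, t} = {0, 1}" if "s \<in> {0..1}" "t \<in> {0..1}" "\<gamma> s = \<gamma> t" for s t
    using \<gamma>(1) that unfolding simple_path_def loop_free_def by blast
  ultimately show thesis
    using logeq_generator_loop [OF simple_path_imp_path [OF \<gamma>(1)] \<gamma>(2) _ _ w, of g] assms(3,4) \<gamma>(3) that by metis
qed

lemma jordan_powi_trivial:
  assumes "jordan_curve K" "c \<in> inside K" "logeq K (\<lambda>z. (z - c) powi n) (\<lambda>_. 1)"
  shows "n = 0"
proof -
  obtain \<gamma> where \<gamma>: "simple_path \<gamma>" "pathfinish \<gamma> = pathstart \<gamma>" "path_image \<gamma> = K"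
    using assms by (auto simp: jordan_curve_def)
  have w: "winding_number \<gamma> c \<in> {1, -1}"
    using simple_closed_path_winding_number_inside [OF \<gamma>(1)] assms(2) \<gamma>(3) by (metis insert_iff)
  show ?thesis
    by (rule logeq_powi_trivial [OF simple_path_imp_path [OF \<gamma>(1)] \<gamma>(2) _ _ _ assms(3)])
      (use \<gamma>(3) assms(2) w in \<open>auto simp: inside_def\<close>)
qed

text \<open>By Rouche's inequality a small displacement of the zero does not change the class; along
  a connected set off \<open>L\<close> the class is therefore constant.\<close>

lemma logeq_connected_poles:
  fixes L :: "complex set"
  assumes "compact L" "connected U" "U \<inter> L = {}" "a \<in> U" "b \<in> U"
  shows "logeq L (\<lambda>z. z - a) (\<lambda>z. z - b)"
proof (rule connected_equivalence_relation [OF assms(2,4,5)])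
  show "logeq L (\<lambda>z. z - y) (\<lambda>z. z - x)" if "logeq L (\<lambda>z. z - x) (\<lambda>z. z - y)" for x y
    using that by (rule logeq_sym)
  show "logeq L (\<lambda>z. z - x) (\<lambda>z. z - w)" if "logeq L (\<lambda>z. z - x) (\<lambda>z. z - y)" "logeq L (\<lambda>z. z - y) (\<lambda>z. z - w)" for x y w
    using that by (rule logeq_trans)
  show "\<exists>T. openin (top_of_set U) T \<and> a \<in> T \<and> (\<forall>x\<in>T. logeq L (\<lambda>z. z - a) (\<lambda>z. z - x))" if "a \<in> U" for a
  proof -
    have "open (- L)" "a \<in> - L" using assms that compact_imp_closed by auto
    then obtain e where e: "e > 0" "ball a e \<subseteq> - L"
      by (meson openE)
    have "logeq L (\<lambda>z. z - a) (\<lambda>z. z - x)" if "x \<in> ball a e" for x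
    proof (rule logeq_sym, rule logeq_near)
      show "cmod (z - x - (z - a)) < cmod (z - a)" if "z \<in> L" for z
      proof -
        have "cmod (z - a) \<ge> e" using e(2) that by (force simp: dist_norm norm_minus_commute)
        moreover have "cmod (a - x) < e" using \<open>x \<in> ball a e\<close> by (simp add: dist_norm)
        ultimately show ?thesis by simp
      qed
    qed (intro continuous_intros)+
    then show ?thesis
      using e(1) that by (intro exI [of _ "U \<inter> ball a e"]) auto
  qed
qed

text \<open>The zero can be moved to a point \<open>b\<close> farther from the origin than all of
  \<open>L\<close>; there Rouche's inequality compares \<open>z - b\<close> with the constant
  \<open>- b\<close>.\<close>

lemma logeq_outside:
  fixes L :: "complex set"
  assumes "compact L" "connected (outside L)" "a \<in> outside L"
  shows "logeq L (\<lambda>z. z - a) (\<lambda>_. 1)"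
proof -
  obtain M where M: "\<And>z. z \<in> L \<Longrightarrow> cmod z < M" "M > 0"
    using compact_imp_bounded [OF assms(1)] by (metis bounded_pos_less)
  obtain b where b: "b \<in> outside L" "cmod b \<ge> M"
  proof -
    have "bounded L" using assms compact_imp_bounded by blast
    then have "\<not> bounded (outside L)"
      using outside_bounded_nonempty cobounded_outside unbounded_outside by blast
    then show thesis using that unfolding bounded_iff by (metis le_cases)
  qed
  have "logeq L (\<lambda>z. z - a) (\<lambda>z. z - b)"
    by (rule logeq_connected_poles [OF assms(1,2) _ assms(3) b(1)]) (auto simp: outside_def)
  also have "logeq L (\<lambda>z. z - b) (\<lambda>z. - b)"
    by (rule logeq_near) (use M b in \<open>force intro!: continuous_intros\<close>)+
  also have "logeq L (\<lambda>z. - b) (\<lambda>_. 1)"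
    using M b by (intro logeq_const) auto
  finally show ?thesis .
qed

text \<open>The map \<open>e\<close> is the universal cover of the punctured disc by a half-plane. A
  logarithm \<open>l\<close> of the pulled-back function changes by \<open>2 pi i n\<close> under
  the deck translation, for some integer \<open>n\<close>; then \<open>l - n w\<close> is periodic
  and descends.\<close>

lemma local_order_exists:
  fixes a :: complex
  assumes r: "0 < r" and g: "continuous_on (ball a r - {a}) g" "\<And>z. z \<in> ball a r - {a} \<Longrightarrow> g z \<noteq> 0"
  obtains n where "logeq (ball a r - {a}) g (\<lambda>z. (z - a) powi n)"
proof -
  let ?P = "ball a r - {a}"
  define H where "H = {w. Re w < ln r}"
  have H: "open H" "convex H"
    by (auto simp: H_def open_halfspace_Re_lt convex_halfspace_Re_lt)
  define e where "e w = a + exp w" for w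
  have e: "e ` H = ?P"
  proof
    have "exp (Re w) < r" if "Re w < ln r" for w
      using that r by (metis exp_less_mono exp_ln)
    then show "e ` H \<subseteq> ?P" by (auto simp: e_def H_def dist_norm)
    show "?P \<subseteq> e ` H"
    proof
      fix z assume z: "z \<in> ?P"
      then have "z = e (Ln (z - a))" by (simp add: e_def)
      moreover have "0 < cmod (z - a)" "cmod (z - a) < r"
        using z by (auto simp: dist_norm norm_minus_commute)
      then have "Ln (z - a) \<in> H"
        using r z by (simp add: H_def Re_Ln)
      ultimately show "z \<in> e ` H" by blast
    qed
  qed
  have ce: "continuous_on A e" for A
    unfolding e_def by (intro continuous_intros)
  obtain l where l: "continuous_on H l" "\<And>w. w \<in> H \<Longrightarrow> g (e w) = exp (l w)"
  proof (rule continuous_logarithm_on_contractible [of H "\<lambda>w. g (e w)"])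
    show "continuous_on H (\<lambda>w. g (e w))"
      by (rule continuous_on_compose2 [OF g(1) ce]) (simp add: e)
    show "g (e w) \<noteq> 0" if "w \<in> H" for w using g(2) e that by blast
  qed (use H convex_imp_contractible in auto)
  let ?p = "2 * of_real pi * \<i> :: complex"
  have per: "e (w + ?p) = e w" "w + ?p \<in> H \<longleftrightarrow> w \<in> H" for w
    by (simp_all add: e_def H_def exp_add)
  obtain n :: int where n: "\<And>w. w \<in> H \<Longrightarrow> l (w + ?p) = l w + of_int n * ?p"
  proof -
    have "exp (l (w + ?p) - l w) = 1" if "w \<in> H" for w
      using l(2) [OF that] l(2) [of "w + ?p"] per that by (simp add: exp_diff)
    moreover have "continuous_on H (\<lambda>w. l (w + ?p) - l w)"
      by (intro continuous_intros l(1) continuous_on_compose2 [OF l(1)]) (use per in auto)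
    ultimately obtain n :: int where "\<And>w. w \<in> H \<Longrightarrow> l (w + ?p) - l w = of_int n * ?p"
      using exp_eq_1_imp_constant [of H "\<lambda>w. l (w + ?p) - l w"] H convex_connected by blast
    then show thesis using that [of n] by (metis add.commute diff_add_cancel)
  qed
  define m where "m w = l w - of_int n * w" for w
  have mper: "m (w + of_int j * ?p) = m w" if "w \<in> H" for w j
  proof -
    have inH: "w + of_int j * ?p \<in> H" for j using that by (simp add: H_def)
    have step: "m (w' + ?p) = m w'" if "w' \<in> H" for w'
      using n [OF that] by (simp add: m_def algebra_simps)
    show ?thesis
    proof (induction j rule: int_induct [of _ 0])
      case (step1 i)
      have "m (w + of_int (i + 1) * ?p) = m (w + of_int i * ?p + ?p)" by (simp add: algebra_simps)
      then show ?case using step1 step inH by metis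
    next
      case (step2 i)
      have "m (w + of_int i * ?p) = m (w + of_int (i - 1) * ?p + ?p)" by (simp add: algebra_simps)
      then show ?case using step2 step inH by metis
    qed simp
  qed
  have meq: "m v = m w" if "v \<in> H" "w \<in> H" "e v = e w" for v w
  proof -
    have "exp v = exp w" using that by (simp add: e_def)
    then obtain j :: int where "v = w + of_int (2 * j) * pi * \<i>" using exp_eq by blast
    then have "v = w + of_int j * ?p" by simp
    then show ?thesis using mper that by metis
  qed
  define k where "k z = m (Ln (z - a))" for z
  have LnH: "Ln (z - a) \<in> H" "e (Ln (z - a)) = z" if "z \<in> ?P" for z
  proof -
    have "0 < cmod (z - a)" "cmod (z - a) < r"
      using that by (auto simp: dist_norm norm_minus_commute)
    then show "Ln (z - a) \<in> H" "e (Ln (z - a)) = z"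
      using r that by (simp_all add: H_def e_def Re_Ln)
  qed
  have ke: "k (e w) = m w" if "w \<in> H" for w
  proof -
    have "e w \<in> ?P" using that e by blast
    then show ?thesis unfolding k_def using LnH that by (intro meq) auto
  qed
  \<comment> \<open>The branch \<open>Ln\<close> in the definition of \<open>k\<close> is
    discontinuous; continuity comes from \<open>k (e w) = m w\<close> and the fact that
    \<open>e\<close> is an open map.\<close>
  have "continuous_on ?P k"
  proof -
    have "openin (top_of_set ?P) (?P \<inter> k -` V)" if "open V" for V
    proof -
      have "?P \<inter> k -` V = e ` (H \<inter> m -` V)"
      proof
        show "?P \<inter> k -` V \<subseteq> e ` (H \<inter> m -` V)"
        proof
          fix z assume z: "z \<in> ?P \<inter> k -` V"
          then obtain w where w: "w \<in> H" "z = e w" using e by blast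
          then show "z \<in> e ` (H \<inter> m -` V)" using z ke by auto
        qed
        show "e ` (H \<inter> m -` V) \<subseteq> ?P \<inter> k -` V"
        proof
          fix z assume "z \<in> e ` (H \<inter> m -` V)"
          then obtain w where w: "w \<in> H" "m w \<in> V" "z = e w" by blast
          moreover have "e w \<in> ?P" using w(1) e by blast
          ultimately show "z \<in> ?P \<inter> k -` V" using ke by simp
        qed
      qed
      moreover have "open (H \<inter> m -` V)"
        using H(1) that l(1) unfolding m_def
        by (intro continuous_open_preimage continuous_intros)
      then have "openin (top_of_set (- {0})) (exp ` (H \<inter> m -` V))"
        by (intro covering_space_open_map [OF covering_space_exp_punctured_plane]) auto
      then have "open (exp ` (H \<inter> m -` V))"
        by (rule openin_open_trans) (simp add: open_Compl)
      then have "open ((+) a ` exp ` (H \<inter> m -` V))"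
        by (rule open_translation)
      then have "open (e ` (H \<inter> m -` V))"
        by (simp add: e_def image_image)
      ultimately show ?thesis
        by (metis inf_le1 open_subset)
    qed
    then show ?thesis unfolding continuous_openin_preimage_eq by blast
  qed
  moreover have "g z = (z - a) powi n * exp (k z)" if z: "z \<in> ?P" for z
  proof -
    have w: "Ln (z - a) \<in> H" "e (Ln (z - a)) = z" using LnH z by auto
    have "g z = exp (l (Ln (z - a)))" using l(2) w by metis
    also have "l (Ln (z - a)) = of_int n * Ln (z - a) + k z" by (simp add: k_def m_def)
    also have "exp \<dots> = exp (Ln (z - a)) powi n * exp (k z)" by (simp add: exp_add exp_power_int)
    also have "exp (Ln (z - a)) = z - a" using z by simp
    finally show ?thesis .
  qed
  ultimately have "logeq ?P g (\<lambda>z. (z - a) powi n)"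
    by (rule logeqI)
  then show thesis by (rule that)
qed

text \<open>Multiplying by the exponential of a cut-off logarithm makes the function equal to \<open>1\<close>
  near a puncture, so that the puncture can be filled in.\<close>

lemma fill_puncture:
  fixes g :: "complex \<Rightarrow> complex"
  assumes A: "finite A" "a \<in> A" and g: "continuous_on (- A) g" "\<And>z. z \<notin> A \<Longrightarrow> g z \<noteq> 0"
    and loc: "0 < r" "logeq (ball a r - {a}) g (\<lambda>_. 1)"
  obtains g' where "continuous_on (- (A - {a})) g'" "\<And>z. z \<notin> A - {a} \<Longrightarrow> g' z \<noteq> 0" "logeq (- A) g g'"
proof -
  obtain s where s: "0 < s" "s \<le> r" "ball a s \<inter> A = {a}"
  proof -
    have "open (- (A - {a}))" "a \<in> - (A - {a})"
      using A by (auto simp: finite_imp_closed open_Compl simp del: Compl_Diff_eq)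
    then obtain s where "s > 0" "ball a s \<subseteq> - (A - {a})" by (meson openE)
    moreover have "ball a (min s r) \<subseteq> ball a s" "a \<in> ball a (min s r)"
      using \<open>s > 0\<close> loc(1) by auto
    ultimately have "ball a (min s r) \<inter> A = {a}" using A(2) by blast
    then show thesis using that [of "min s r"] \<open>s > 0\<close> loc(1) by auto
  qed
  obtain l where l: "continuous_on (ball a r - {a}) l" "\<And>z. z \<in> ball a r - {a} \<Longrightarrow> g z = exp (l z)"
    using logeq_log [OF loc(2)] by blast
  define cut where "cut z = max 0 (min 1 (2 - 3 * dist a z / s))" for z
  define m where "m z = (if dist a z < s then of_real (cut z) * l z else 0)" for z
  have chi0: "cut z = 0" if "dist a z > 2 * s / 3" for z
    using that s(1) by (simp add: cut_def field_simps)
  have chi1: "cut z = 1" if "dist a z < s / 3" for z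
    using that s(1) by (simp add: cut_def field_simps)
  have m: "continuous_on (- A) m"
  proof -
    have "cball a (2 * s / 3) \<subseteq> ball a s"
      using s(1) by (simp add: cball_subset_ball_iff)
    then have eq: "- A = (ball a s - A) \<union> (- cball a (2 * s / 3) - A)"
      by blast
    have "continuous_on ((ball a s - A) \<union> (- cball a (2 * s / 3) - A)) m"
    proof (rule continuous_on_open_Un)
      show "open (ball a s - A)" "open (- cball a (2 * s / 3) - A)"
        using A by (auto simp: finite_imp_closed open_Diff)
      have "continuous_on (ball a s - A) cut"
        unfolding cut_def using s(1) by (intro continuous_intros) simp
      moreover have "continuous_on (ball a s - A) l"
        by (rule continuous_on_subset [OF l(1)]) (use s(2) A(2) in auto)
      ultimately have "continuous_on (ball a s - A) (\<lambda>z. of_real (cut z) * l z)"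
        by (intro continuous_intros)
      then show "continuous_on (ball a s - A) m"
        by (rule continuous_on_eq) (simp add: m_def)
      show "continuous_on (- cball a (2 * s / 3) - A) m"
        using continuous_on_const [of "- cball a (2 * s / 3) - A" 0]
        by (rule continuous_on_eq) (simp add: m_def chi0)
    qed
    then show ?thesis using eq by simp
  qed
  define g' where "g' z = (if z = a then 1 else g z * exp (- m z))" for z
  have g'1: "g' z = 1" if "z \<in> ball a (s / 3)" for z
  proof (cases "z = a")
    case False
    have d: "dist a z < s / 3" "dist a z < s" "dist a z < r" using that s(1,2) by auto
    then have "m z = l z" by (simp add: m_def chi1)
    moreover have "g z = exp (l z)" using l(2) [of z] False d by simp
    ultimately show ?thesis using False by (simp add: g'_def flip: exp_add)
  qed (simp add: g'_def)
  have "continuous_on (- (A - {a})) g'"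
  proof -
    have "ball a (s / 3) \<subseteq> ball a s" "a \<in> ball a (s / 3)"
      using s(1) by (simp_all add: subset_ball)
    then have eq: "- (A - {a}) = - A \<union> ball a (s / 3)"
      using s(3) A(2) by blast
    have "continuous_on (- A \<union> ball a (s / 3)) g'"
    proof (rule continuous_on_open_Un)
      show "open (- A)" using A(1) by (simp add: finite_imp_closed open_Compl)
      have "continuous_on (- A) (\<lambda>z. g z * exp (- m z))"
        by (intro continuous_intros g m)
      then show "continuous_on (- A) g'"
        by (rule continuous_on_eq) (use A(2) in \<open>auto simp: g'_def\<close>)
      show "continuous_on (ball a (s / 3)) g'"
        using continuous_on_const [of "ball a (s / 3)" 1]
        by (rule continuous_on_eq) (use g'1 in metis)
    qed auto
    then show ?thesis using eq by simp
  qed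
  moreover have "g' z \<noteq> 0" if "z \<notin> A - {a}" for z
    using that g(2) by (auto simp: g'_def)
  moreover have "logeq (- A) g g'"
    by (rule logeqI [OF m]) (use A(2) in \<open>auto simp: g'_def exp_minus\<close>)
  ultimately show thesis using that by blast
qed

text \<open>Punctures are filled one at a time. Filling changes the function by a factor with a
  logarithm on the punctured plane, so the other punctures remain trivial; the plane without
  punctures is contractible.\<close>

lemma logeq_punctured_plane:
  fixes g :: "complex \<Rightarrow> complex"
  assumes "finite A" "continuous_on (- A) g" "\<And>z. z \<notin> A \<Longrightarrow> g z \<noteq> 0"
    "\<And>a. a \<in> A \<Longrightarrow> \<exists>r>0. logeq (ball a r - {a}) g (\<lambda>_. 1)"
  shows "logeq (- A) g (\<lambda>_. 1)"
  using assms
proof (induction A arbitrary: g rule: finite_induct)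
  case empty
  then show ?case
    using logeq_on_contractible [OF contractible_UNIV, of g] by simp
next
  case (insert a A)
  obtain r where r: "r > 0" "logeq (ball a r - {a}) g (\<lambda>_. 1)"
    using insert.prems(3) by blast
  obtain g' where g': "continuous_on (- (insert a A - {a})) g'" "\<And>z. z \<notin> insert a A - {a} \<Longrightarrow> g' z \<noteq> 0"
    "logeq (- insert a A) g g'"
    using fill_puncture [of "insert a A" a g r] insert.prems insert.hyps r by blast
  have A: "insert a A - {a} = A" using insert.hyps by auto
  have "logeq (- A) g' (\<lambda>_. 1)"
  proof (rule insert.IH)
    show "\<exists>r>0. logeq (ball b r - {b}) g' (\<lambda>_. 1)" if b: "b \<in> A" for b
    proof -
      obtain r where r: "r > 0" "logeq (ball b r - {b}) g (\<lambda>_. 1)"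
        using insert.prems(3) b by blast
      have "open (- (insert a A - {b}))" "b \<in> - (insert a A - {b})"
        using insert.hyps by (auto simp: finite_imp_closed open_Compl simp del: Compl_Diff_eq Compl_insert)
      then obtain s where s: "s > 0" "ball b s \<subseteq> - (insert a A - {b})" by (meson openE)
      let ?B = "ball b (min r s) - {b}"
      have "logeq ?B g' g"
        by (rule logeq_sym, rule logeq_subset [OF g'(3)]) (use s in auto)
      also have "logeq ?B g (\<lambda>_. 1)"
        by (rule logeq_subset [OF r(2)]) auto
      finally show ?thesis using r(1) s(1) by (intro exI [of _ "min r s"]) auto
    qed
  qed (use g' A in auto)
  then have "logeq (- insert a A) g' (\<lambda>_. 1)"
    by (rule logeq_subset) auto
  with g'(3) show ?case by (rule logeq_trans)
qed

section \<open>Local orders on a sphere with a chart\<close>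

text \<open>A sphere with \<open>N\<close> as the point at infinity of the coordinate
  \<open>z\<close>; orders are read in this one chart. The last assumption provides, for any other
  point, a chart in which that point is at infinity, where it imposes no condition on a
  function.\<close>

locale sphere_chart =
  fixes X :: "'a::{metric_space,second_countable_topology} set" and N :: 'a
    and z :: "'a \<Rightarrow> complex" and z' :: "complex \<Rightarrow> 'a"
  assumes compact_X: "compact X" and N_in: "N \<in> X"
    and chart: "homeomorphism (X - {N}) UNIV z z'"
    and other_charts: "\<And>b. b \<in> X \<Longrightarrow> (X - {b}) homeomorphic (UNIV :: complex set)"
begin

section \<open>Neighbourhoods in the chart and at infinity\<close>

lemma z'_in [simp]: "z' w \<in> X" "z' w \<noteq> N" and z_z' [simp]: "z (z' w) = w"
  using chart by (auto simp: homeomorphism_def)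

lemma N_neq_z' [simp]: "N \<noteq> z' w"
  using z'_in(2) [of w] by metis

lemma z'_z [simp]: "x \<in> X \<Longrightarrow> x \<noteq> N \<Longrightarrow> z' (z x) = x"
  using chart by (auto simp: homeomorphism_def)

lemma z_eq_iff: "x \<in> X \<Longrightarrow> x \<noteq> N \<Longrightarrow> y \<in> X \<Longrightarrow> y \<noteq> N \<Longrightarrow> z x = z y \<longleftrightarrow> x = y"
  by (metis z'_z)

lemma continuous_on_z: "S \<subseteq> X - {N} \<Longrightarrow> continuous_on S z"
  using chart continuous_on_subset by (auto simp: homeomorphism_def)

lemma continuous_on_z': "continuous_on V z'"
  using chart continuous_on_subset by (auto simp: homeomorphism_def)

lemma openin_minus_finite: "finite A \<Longrightarrow> openin (top_of_set X) W \<Longrightarrow> openin (top_of_set X) (W - A)"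
  by (metis Diff_eq finite_imp_closed open_Compl openin_Int_open)

lemma openin_z'_image:
  assumes "open V" shows "openin (top_of_set X) (z' ` V)"
proof -
  have "homeomorphism UNIV (X - {N}) z' z"
    using chart homeomorphism_symD by blast
  then have "openin (top_of_set (X - {N})) (z' ` V)"
    by (rule homeomorphism_imp_open_map) (use assms in simp)
  moreover have "openin (top_of_set X) (X - {N})"
    by (rule openin_minus_finite) auto
  ultimately show ?thesis using openin_trans by blast
qed

lemma openin_nbhd_N: "openin (top_of_set X) (X - z' ` cball c R)"
proof -
  have "compact (z' ` cball c R)"
    by (intro compact_continuous_image continuous_on_z') simp
  then show ?thesis
    by (metis Diff_eq compact_imp_closed open_Compl openin_open_Int)
qed

lemma nbhd_ball:
  assumes "openin (top_of_set X) W" "a \<in> W" "a \<noteq> N"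
  obtains r where "r > 0" "z' ` ball (z a) r \<subseteq> W"
proof -
  have a: "a \<in> X" using assms openin_imp_subset by blast
  have "open (z' -` W)"
  proof -
    have "openin (top_of_set UNIV) (UNIV \<inter> z' -` W)"
      by (rule continuous_openin_preimage [OF continuous_on_z' _ assms(1)]) auto
    then show ?thesis by simp
  qed
  moreover have "z a \<in> z' -` W" using a assms by simp
  ultimately obtain r where "r > 0" "ball (z a) r \<subseteq> z' -` W" by (meson openE)
  then show thesis using that [of r] by blast
qed

text \<open>Images of closed balls under \<open>z'\<close> are compact, so the points with large
  \<open>z\<close>, together with \<open>N\<close>, form neighbourhoods of \<open>N\<close>.\<close>

lemma continuous_on_at_N:
  assumes S: "S \<subseteq> X" and cont: "continuous_on (S - {N}) \<phi>"
    and lim: "\<And>B. open B \<Longrightarrow> \<phi> N \<in> B \<Longrightarrow> \<exists>R. \<forall>x\<in>S-{N}. cmod (z x) > R \<longrightarrow> \<phi> x \<in> B"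
  shows "continuous_on S \<phi>"
  unfolding continuous_on_topological
proof (intro ballI allI impI)
  fix x B assume x: "x \<in> S" and B: "open B" "\<phi> x \<in> B"
  show "\<exists>A. open A \<and> x \<in> A \<and> (\<forall>y\<in>S. y \<in> A \<longrightarrow> \<phi> y \<in> B)"
  proof (cases "x = N")
    case True
    then obtain R where R: "\<And>x. x \<in> S - {N} \<Longrightarrow> cmod (z x) > R \<Longrightarrow> \<phi> x \<in> B"
      using lim [OF B(1)] B(2) by blast
    obtain A where A: "open A" "X - z' ` cball 0 R = X \<inter> A"
      using openin_nbhd_N [of 0 R] by (auto simp: openin_open)
    have "N \<in> X - z' ` cball 0 R" using N_in z'_in(2) by (metis DiffI imageE)
    then have "N \<in> A" using A by blast
    moreover have "\<phi> y \<in> B" if y: "y \<in> S" "y \<in> A" for y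
    proof (cases "y = N")
      case False
      have "y \<notin> z' ` cball 0 R" using A y S by blast
      moreover have "y = z' (z y)" using False y S by auto
      ultimately have "z y \<notin> cball 0 R" by blast
      then show ?thesis using R [of y] y False by simp
    qed (use B True in simp)
    ultimately show ?thesis using A True by blast
  next
    case False
    then obtain A where A: "open A" "x \<in> A" "\<And>y. y \<in> S - {N} \<Longrightarrow> y \<in> A \<Longrightarrow> \<phi> y \<in> B"
      using cont x B unfolding continuous_on_topological by (metis DiffI singletonD)
    then show ?thesis
      using False by (intro exI [of _ "A - {N}"]) (auto simp: open_delete)
  qed
qed

text \<open>The topological counterpart of the order of a zero or pole. The point \<open>a\<close>
  is deleted so that zeros and poles are covered alike; \<open>N\<close> is excluded because
  \<open>z\<close> is no coordinate there. It is a relation because an order need not exist; it is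
  unique by \<open>has_ord_unique\<close>.\<close>

definition has_ord :: "('a \<Rightarrow> complex) \<Rightarrow> 'a \<Rightarrow> int \<Rightarrow> bool" where
  "has_ord g a n \<longleftrightarrow> a \<in> X - {N} \<and>
     (\<exists>W. openin (top_of_set X) W \<and> a \<in> W \<and> N \<notin> W \<and> logeq (W - {a}) g (\<lambda>x. (z x - z a) powi n))"

lemma has_ordI:
  assumes "openin (top_of_set X) W" "a \<in> W" "a \<noteq> N"
    and "logeq (W - {a} - {N}) g (\<lambda>x. (z x - z a) powi n)"
  shows "has_ord g a n"
proof -
  have "openin (top_of_set X) (W - {N})" by (rule openin_minus_finite [OF _ assms(1)]) simp
  moreover have "a \<in> X" using assms openin_imp_subset by blast
  moreover have "W - {N} - {a} = W - {a} - {N}" by blast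
  ultimately show ?thesis
    using assms unfolding has_ord_def by (intro conjI exI [of _ "W - {N}"]) auto
qed

lemma has_ord_mult:
  assumes "has_ord g a n" "has_ord h a m"
  shows "has_ord (\<lambda>x. g x * h x) a (n + m)"
proof -
  obtain V where V: "openin (top_of_set X) V" "a \<in> V" "N \<notin> V" "logeq (V - {a}) g (\<lambda>x. (z x - z a) powi n)"
    using assms(1) unfolding has_ord_def by blast
  obtain W where W: "openin (top_of_set X) W" "a \<in> W" "N \<notin> W" "logeq (W - {a}) h (\<lambda>x. (z x - z a) powi m)"
    using assms(2) unfolding has_ord_def by blast
  have a: "a \<in> X" "a \<noteq> N" using assms(1) by (auto simp: has_ord_def)
  let ?U = "V \<inter> W"
  have "logeq (?U - {a}) (\<lambda>x. g x * h x) (\<lambda>x. (z x - z a) powi n * (z x - z a) powi m)"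
    by (intro logeq_mult logeq_subset [OF V(4)] logeq_subset [OF W(4)]) auto
  also have "logeq (?U - {a}) (\<lambda>x. (z x - z a) powi n * (z x - z a) powi m) (\<lambda>x. (z x - z a) powi (n + m))"
  proof (rule logeq_eq)
    fix x assume x: "x \<in> ?U - {a}"
    then have "x \<in> X" "x \<noteq> N" using V openin_imp_subset by blast+
    then have "z x - z a \<noteq> 0" using x a z_eq_iff by auto
    then show "(z x - z a) powi n * (z x - z a) powi m = (z x - z a) powi (n + m)"
      by (simp add: power_int_add)
  qed
  finally show ?thesis
    using V W a unfolding has_ord_def by (intro conjI exI [of _ ?U]) (auto intro: openin_Int)
qed

lemma has_ord_powi:
  assumes "has_ord g a n"
  shows "has_ord (\<lambda>x. g x powi m) a (n * m)"
proof -
  obtain V where V: "openin (top_of_set X) V" "a \<in> V" "N \<notin> V" "logeq (V - {a}) g (\<lambda>x. (z x - z a) powi n)"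
    using assms(1) unfolding has_ord_def by blast
  have "logeq (V - {a}) (\<lambda>x. g x powi m) (\<lambda>x. ((z x - z a) powi n) powi m)"
    by (rule logeq_powi [OF V(4)])
  then show ?thesis
    using V assms unfolding has_ord_def by (intro conjI exI [of _ V]) (auto simp: power_int_mult)
qed

lemma has_ord_inverse: "has_ord g a n \<Longrightarrow> has_ord (\<lambda>x. inverse (g x)) a (- n)"
proof -
  assume "has_ord g a n"
  then have "has_ord (\<lambda>x. g x powi (- 1)) a (n * - 1)" by (rule has_ord_powi)
  then show ?thesis by (simp only: power_int_minus1_right mult_minus1_right)
qed

lemma has_ord_divide:
  "has_ord g a n \<Longrightarrow> has_ord h a m \<Longrightarrow> has_ord (\<lambda>x. g x / h x) a (n - m)"
  using has_ord_mult [of g a n "\<lambda>x. inverse (h x)" "- m"] has_ord_inverse [of h a m]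
  by (simp add: divide_inverse)

lemma has_ord_cong:
  assumes "has_ord g a n" "openin (top_of_set X) W" "a \<in> W" "logeq (W - {a} - {N}) h g"
  shows "has_ord h a n"
proof -
  obtain V where V: "openin (top_of_set X) V" "a \<in> V" "N \<notin> V" "logeq (V - {a}) g (\<lambda>x. (z x - z a) powi n)"
    using assms(1) unfolding has_ord_def by blast
  let ?U = "V \<inter> W"
  have "logeq (?U - {a}) h g"
    by (rule logeq_subset [OF assms(4)]) (use V in auto)
  also have "logeq (?U - {a}) g (\<lambda>x. (z x - z a) powi n)"
    by (rule logeq_subset [OF V(4)]) auto
  finally show ?thesis
    using V assms unfolding has_ord_def by (intro conjI exI [of _ ?U]) (auto intro: openin_Int)
qed

lemma punctured_image: "z' ` (ball (z a) r - {z a}) \<subseteq> z' ` ball (z a) r - {a}"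
proof -
  have "z' w \<noteq> a" if "w \<noteq> z a" for w using that z_z' by metis
  then show ?thesis by auto
qed

lemma has_ord_exists:
  assumes W: "openin (top_of_set X) W" "a \<in> W" "a \<noteq> N"
    and g: "continuous_on (W - {a}) g" "\<And>x. x \<in> W - {a} \<Longrightarrow> g x \<noteq> 0"
  obtains n where "has_ord g a n"
proof -
  have a: "a \<in> X" using W openin_imp_subset by blast
  obtain r where r: "r > 0" "z' ` ball (z a) r \<subseteq> W"
    using nbhd_ball [OF W] by blast
  let ?P = "ball (z a) r - {z a}"
  have sub: "z' ` ?P \<subseteq> W - {a}" using punctured_image [of a r] r(2) by blast
  obtain n where n: "logeq ?P (\<lambda>w. g (z' w)) (\<lambda>w. (w - z a) powi n)"
  proof (rule local_order_exists [OF r(1)])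
    show "continuous_on ?P (\<lambda>w. g (z' w))"
      by (rule continuous_on_compose2 [OF g(1) continuous_on_z' sub])
    show "g (z' w) \<noteq> 0" if "w \<in> ?P" for w
      using g(2) sub that by blast
  qed
  let ?W = "z' ` ball (z a) r"
  have in_ball: "z x \<in> ?P" "x \<in> X" "x \<noteq> N" if x: "x \<in> ?W - {a}" for x
  proof -
    obtain w where w: "w \<in> ball (z a) r" "x = z' w" using x by blast
    then have "w \<noteq> z a" using x a W(3) by auto
    then show "z x \<in> ?P" "x \<in> X" "x \<noteq> N" using w by auto
  qed
  have "logeq (?W - {a}) (\<lambda>x. g (z' (z x))) (\<lambda>x. (z x - z a) powi n)"
  proof (rule logeq_compose [OF n])
    show "continuous_on (?W - {a}) z"
      by (rule continuous_on_z) auto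
    show "z ` (?W - {a}) \<subseteq> ?P" by (rule image_subsetI) (rule in_ball(1))
  qed
  moreover have "logeq (?W - {a}) g (\<lambda>x. g (z' (z x)))"
    by (rule logeq_eq) (use z'_z [OF in_ball(2,3)] in metis)
  ultimately have "logeq (?W - {a}) g (\<lambda>x. (z x - z a) powi n)"
    by (rule logeq_trans [rotated])
  moreover have "openin (top_of_set X) ?W" by (rule openin_z'_image) simp
  moreover have "a \<in> ?W" using r(1) a W(3) by (metis z'_z centre_in_ball imageI)
  moreover have "N \<notin> ?W" using z'_in(2) by blast
  ultimately have "has_ord g a n"
    using a W(3) unfolding has_ord_def by blast
  then show thesis by (rule that)
qed

lemma has_ord_0:
  assumes W: "openin (top_of_set X) W" "a \<in> W" "a \<noteq> N"
    and g: "continuous_on W g" "g a \<noteq> 0"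
  shows "has_ord g a 0"
proof -
  let ?W = "W \<inter> g -` ball (g a) (cmod (g a))"
  have op: "openin (top_of_set X) ?W"
  proof -
    have "openin (top_of_set W) ?W"
      by (rule continuous_openin_preimage_gen [OF g(1)]) simp
    then show ?thesis using W(1) openin_trans by blast
  qed
  have "logeq ?W g (\<lambda>_. g a)"
    by (rule logeq_near)
      (auto simp: dist_norm norm_minus_commute intro!: continuous_intros continuous_on_subset [OF g(1)])
  also have "logeq ?W (\<lambda>_. g a) (\<lambda>_. 1)" by (rule logeq_const) (rule g)
  finally have "logeq (?W - {a} - {N}) g (\<lambda>_. 1)" by (rule logeq_subset) auto
  then show ?thesis
    using W g by (intro has_ordI [OF op]) auto
qed

lemma has_ord_unique:
  assumes "has_ord g a n" "has_ord g a m"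
  shows "n = m"
proof -
  \<comment> \<open>This product is 1 wherever \<open>g\<close> is nonzero, so
    \<open>(w - z a) powi (m - n)\<close> has a logarithm on a small circle around
    \<open>z a\<close>.\<close>
  have "has_ord (\<lambda>x. inverse (g x) * g x) a (- n + m)"
    by (intro has_ord_mult has_ord_inverse assms)
  then obtain W where W: "openin (top_of_set X) W" "a \<in> W" "N \<notin> W"
    "logeq (W - {a}) (\<lambda>x. inverse (g x) * g x) (\<lambda>x. (z x - z a) powi (m - n))"
    unfolding has_ord_def by auto
  have a: "a \<in> X" "a \<noteq> N" using assms by (auto simp: has_ord_def)
  obtain V where V: "openin (top_of_set X) V" "a \<in> V" "N \<notin> V" "logeq (V - {a}) g (\<lambda>x. (z x - z a) powi n)"
    using assms(1) unfolding has_ord_def by blast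
  have nz: "g x \<noteq> 0" if "x \<in> V - {a}" for x
  proof -
    have "x \<in> X" "x \<noteq> N" using V that openin_imp_subset by blast+
    then have "(z x - z a) powi n \<noteq> 0" using that a z_eq_iff by auto
    then show ?thesis using V(4) that by (auto elim!: logeqE)
  qed
  obtain r where r: "r > 0" "z' ` ball (z a) r \<subseteq> V \<inter> W"
    using nbhd_ball [of "V \<inter> W" a] V W a by (auto intro: openin_Int)
  let ?P = "ball (z a) r - {z a}"
  have sub: "z' ` ?P \<subseteq> V \<inter> W - {a}" using punctured_image [of a r] r(2) by blast
  have "logeq (V \<inter> W - {a}) (\<lambda>x. (z x - z a) powi (m - n)) (\<lambda>x. inverse (g x) * g x)"
    by (rule logeq_sym, rule logeq_subset [OF W(4)]) auto
  also have "logeq (V \<inter> W - {a}) (\<lambda>x. inverse (g x) * g x) (\<lambda>_. 1)"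
    by (rule logeq_eq) (use nz in auto)
  finally have "logeq ?P (\<lambda>w. (z (z' w) - z a) powi (m - n)) (\<lambda>w. 1)"
    by (rule logeq_compose [OF _ continuous_on_z' sub])
  then have "logeq ?P (\<lambda>w. (w - z a) powi (m - n)) (\<lambda>w. 1)" by simp
  moreover have "sphere (z a) (r / 2) \<subseteq> ?P" using r(1) by auto
  ultimately have "m - n = 0"
    using r(1) by (intro logeq_circle_powi_trivial [of "r / 2" "z a"]) auto
  then show ?thesis by simp
qed

text \<open>For distinct \<open>a\<close> and \<open>b\<close>, the simplest function on the sphere
  with one simple zero, at \<open>a\<close>, and one simple pole, at \<open>b\<close>; the value 1
  is its limit at infinity.\<close>

definition tt :: "'a \<Rightarrow> 'a \<Rightarrow> 'a \<Rightarrow> complex" where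
  "tt a b x = (if x = N then 1 else (z x - z a) / (z x - z b))"

lemma continuous_on_tt:
  assumes "a \<in> X - {N}" "b \<in> X - {N}"
  shows "continuous_on (X - {b}) (tt a b)"
proof (rule continuous_on_at_N)
  have nz: "z x - z b \<noteq> 0" if "x \<in> X - {b} - {N}" for x
    using that assms z_eq_iff by auto
  have "continuous_on (X - {b} - {N}) (\<lambda>x. (z x - z a) / (z x - z b))"
    using nz by (intro continuous_intros continuous_on_z) auto
  then show "continuous_on (X - {b} - {N}) (tt a b)"
    by (rule continuous_on_eq) (simp add: tt_def)
  fix B assume B: "open B" "tt a b N \<in> B"
  then obtain e where e: "e > 0" "ball 1 e \<subseteq> B" by (auto simp: tt_def elim: openE)
  show "\<exists>R. \<forall>x\<in>X - {b} - {N}. R < cmod (z x) \<longrightarrow> tt a b x \<in> B"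
  proof (intro exI ballI impI)
    fix x assume x: "x \<in> X - {b} - {N}" and R: "cmod (z b) + cmod (z b - z a) / e < cmod (z x)"
    have "cmod (z x) \<le> cmod (z x - z b) + cmod (z b)"
      by (metis diff_add_cancel norm_triangle_ineq)
    then have gt: "cmod (z b - z a) / e < cmod (z x - z b)" using R by linarith
    have "tt a b x - 1 = (z b - z a) / (z x - z b)"
      using x nz [OF x] by (simp add: tt_def divide_simps)
    then have "cmod (tt a b x - 1) = cmod (z b - z a) / cmod (z x - z b)"
      by (simp add: norm_divide)
    also have "\<dots> < e"
      using gt e(1) nz [OF x] by (simp add: divide_simps mult.commute)
    finally have "tt a b x \<in> ball 1 e" by (simp add: dist_norm norm_minus_commute)
    then show "tt a b x \<in> B" using e by blast
  qed
qed (use N_in in auto)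

lemma tt_nz: "a \<in> X - {N} \<Longrightarrow> b \<in> X - {N} \<Longrightarrow> x \<in> X - {a, b} \<Longrightarrow> tt a b x \<noteq> 0"
  using z_eq_iff by (auto simp: tt_def)

lemma tt_mult: "a \<in> X - {N} \<Longrightarrow> b \<in> X - {N} \<Longrightarrow> c \<in> X - {N} \<Longrightarrow> x \<in> X - {b} \<Longrightarrow> tt a b x * tt b c x = tt a c x"
  using z_eq_iff by (auto simp: tt_def)

lemma openin_minus_finite_X: "finite A \<Longrightarrow> openin (top_of_set X) (X - A)"
  by (rule openin_minus_finite) auto

section \<open>Orders of the basic functions and the classification on the punctured sphere\<close>

lemma has_ord_coord:
  assumes "a \<in> X - {N}" shows "has_ord (\<lambda>x. z x - z a) a 1"
  by (rule has_ordI [OF openin_minus_finite_X [of "{N}"]]) (use assms in auto)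

lemma has_ord_coord_0:
  assumes "a \<in> X - {N}" "b \<in> X - {N}" "a \<noteq> b" shows "has_ord (\<lambda>x. z x - z b) a 0"
proof (rule has_ord_0 [OF openin_minus_finite_X [of "{N}"]])
  show "continuous_on (X - {N}) (\<lambda>x. z x - z b)" by (intro continuous_intros continuous_on_z) simp
qed (use assms z_eq_iff in auto)

lemma has_ord_eq:
  assumes "has_ord g a n" "\<And>x. x \<in> X - {N} - {a} \<Longrightarrow> h x = g x"
  shows "has_ord h a n"
  by (rule has_ord_cong [OF assms(1) openin_minus_finite_X [of "{N}"]])
    (use assms in \<open>auto simp: has_ord_def intro!: logeq_eq\<close>)

lemma has_ord_tt:
  assumes "a \<in> X - {N}" "b \<in> X - {N}" "a \<noteq> b"
  shows "has_ord (tt a b) a 1" "has_ord (tt a b) b (- 1)"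
    "c \<in> X - {N} \<Longrightarrow> c \<noteq> a \<Longrightarrow> c \<noteq> b \<Longrightarrow> has_ord (tt a b) c 0"
proof -
  have eq: "has_ord (tt a b) d n" if "has_ord (\<lambda>x. (z x - z a) / (z x - z b)) d n" for d n
    by (rule has_ord_eq [OF that]) (simp add: tt_def)
  show "has_ord (tt a b) a 1"
    using has_ord_divide [OF has_ord_coord [OF assms(1)] has_ord_coord_0 [OF assms]] by (intro eq) simp
  show "has_ord (tt a b) b (- 1)"
    using has_ord_divide [OF has_ord_coord_0 [OF assms(2,1) assms(3) [symmetric]] has_ord_coord [OF assms(2)]]
    by (intro eq) simp
  show "has_ord (tt a b) c 0" if "c \<in> X - {N}" "c \<noteq> a" "c \<noteq> b"
    using has_ord_divide [OF has_ord_coord_0 [OF that(1) assms(1) that(2)] has_ord_coord_0 [OF that(1) assms(2) that(3)]]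
    by (intro eq) simp
qed

lemma has_ord_prod:
  assumes "finite I" "a \<in> X - {N}" "\<And>i. i \<in> I \<Longrightarrow> has_ord (g i) a (n i)"
  shows "has_ord (\<lambda>x. \<Prod>i\<in>I. g i x) a (\<Sum>i\<in>I. n i)"
  using assms(1,3)
proof (induction I rule: finite_induct)
  case empty
  show ?case
    using has_ord_0 [OF openin_minus_finite_X [of "{}"], of a "\<lambda>_. 1"] assms(2) by simp
next
  case (insert i I)
  then show ?case using has_ord_mult [of "g i" a "n i"] by simp
qed

text \<open>In a chart that sends \<open>b\<close> to infinity the remaining punctures lie in the
  plane, where triviality near each of them suffices. Hence no order is prescribed at
  \<open>b\<close>.\<close>

lemma logeq_sphere_minus:
  assumes A: "finite A" "A \<subseteq> X - {N}" "b \<in> A"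
    and g: "continuous_on (X - A) g" "\<And>x. x \<in> X - A \<Longrightarrow> g x \<noteq> 0"
    and ord: "\<And>a. a \<in> A - {b} \<Longrightarrow> has_ord g a 0"
  shows "logeq (X - A) g (\<lambda>_. 1)"
proof -
  obtain y y' where y: "homeomorphism (X - {b}) (UNIV::complex set) y y'"
    using other_charts [of b] A by (auto simp: homeomorphic_def)
  have y_in: "y' w \<in> X - {b}" "y (y' w) = w" and y'y: "x \<in> X - {b} \<Longrightarrow> y' (y x) = x" for w x
    using y by (auto simp: homeomorphism_def)
  have cy': "continuous_on V y'" for V
    using y continuous_on_subset by (auto simp: homeomorphism_def)
  define C where "C = y ` (A - {b})"
  have yC: "y' w \<in> X - A" if "w \<notin> C" for w
  proof -
    have "y' w \<notin> A - {b}" using that y_in unfolding C_def by (metis image_eqI)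
    then show ?thesis using y_in by blast
  qed
  have "logeq (- C) (\<lambda>w. g (y' w)) (\<lambda>_. 1)"
  proof (rule logeq_punctured_plane)
    show "finite C" using A by (simp add: C_def)
    show "continuous_on (- C) (\<lambda>w. g (y' w))"
      by (rule continuous_on_compose2 [OF g(1) cy']) (use yC in auto)
    show "g (y' w) \<noteq> 0" if "w \<notin> C" for w using g(2) yC that by blast
    show "\<exists>r>0. logeq (ball c r - {c}) (\<lambda>w. g (y' w)) (\<lambda>_. 1)" if c: "c \<in> C" for c
    proof -
      obtain a where a: "a \<in> A - {b}" "c = y a" using c by (auto simp: C_def)
      obtain W where W: "openin (top_of_set X) W" "a \<in> W" "logeq (W - {a}) g (\<lambda>x. 1)"
        using ord [OF a(1)] unfolding has_ord_def by auto
      have ya: "y' c = a" using a A y'y by auto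
      have "open (y' -` W)"
      proof -
        have "openin (top_of_set UNIV) (UNIV \<inter> y' -` W)"
          by (rule continuous_openin_preimage [OF cy' _ W(1)]) (use y_in in auto)
        then show ?thesis by simp
      qed
      then obtain r where r: "r > 0" "ball c r \<subseteq> y' -` W"
        using W(2) ya by (metis openE vimageI)
      have "y' ` (ball c r - {c}) \<subseteq> W - {a}"
      proof -
        have "y' w \<noteq> a" if "w \<noteq> c" for w using that y_in(2) ya by metis
        then show ?thesis using r(2) by blast
      qed
      then have "logeq (ball c r - {c}) (\<lambda>w. g (y' w)) (\<lambda>_. 1)"
        by (rule logeq_compose [OF W(3) cy'])
      then show ?thesis using r(1) by blast
    qed
  qed
  moreover have "continuous_on (X - A) y"
    using y A(3) by (auto simp: homeomorphism_def intro: continuous_on_subset)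
  moreover have "y ` (X - A) \<subseteq> - C"
  proof -
    have "y x \<notin> C" if x: "x \<in> X - A" for x
    proof
      assume "y x \<in> C"
      then obtain a where a: "a \<in> A - {b}" "y x = y a" by (auto simp: C_def)
      then have "x = a" using y'y [of x] y'y [of a] x A by auto
      then show False using a x by blast
    qed
    then show ?thesis by blast
  qed
  ultimately have "logeq (X - A) (\<lambda>x. g (y' (y x))) (\<lambda>_. 1)"
    by (rule logeq_compose)
  moreover have "g (y' (y x)) = g x" if "x \<in> X - A" for x
    using y'y [of x] that A(3) by (cases "x = b") auto
  ultimately show ?thesis
    using logeq_cong [of "X - A" "\<lambda>x. g (y' (y x))" g] by blast
qed

text \<open>Dividing by the product of the \<open>tt a b\<close> with the given exponents leaves
  order 0 at every puncture other than \<open>b\<close>. The order at \<open>b\<close> is thereby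
  forced: the orders of a function on the sphere add up to 0.\<close>

lemma sphere_classification:
  assumes A: "finite A" "A \<subseteq> X - {N}" "b \<in> A"
    and g: "continuous_on (X - A) g" "\<And>x. x \<in> X - A \<Longrightarrow> g x \<noteq> 0"
    and ord: "\<And>a. a \<in> A - {b} \<Longrightarrow> has_ord g a (n a)"
  shows "logeq (X - A) g (\<lambda>x. \<Prod>a\<in>A - {b}. tt a b x powi n a)"
    "has_ord g b (- (\<Sum>a\<in>A - {b}. n a))"
proof -
  define P where "P x = (\<Prod>a\<in>A - {b}. tt a b x powi n a)" for x
  have in_XN: "a \<in> X - {N}" if "a \<in> A" for a using A that by blast
  have Pc: "continuous_on (X - A) P"
    unfolding P_def
  proof (intro continuous_on_prod continuous_on_power_int ballI disjI2)
    fix a assume a: "a \<in> A - {b}"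
    show "continuous_on (X - A) (tt a b)"
      by (rule continuous_on_subset [OF continuous_on_tt [of a b]]) (use in_XN a A(3) in auto)
    show "tt a b x \<noteq> 0" if "x \<in> X - A" for x
      using tt_nz [of a b x] in_XN [of a] in_XN [of b] a A(3) that by blast
  qed
  have Pnz: "P x \<noteq> 0" if "x \<in> X - A" for x
  proof -
    have "tt a b x \<noteq> 0" if "a \<in> A - {b}" for a
      using tt_nz [of a b x] in_XN that A(3) \<open>x \<in> X - A\<close> by blast
    then show ?thesis using A(1) by (simp add: P_def)
  qed
  have ordP: "has_ord P c (\<Sum>a\<in>A - {b}. (if c = a then 1 else 0) * n a)" if c: "c \<in> A - {b}" for c
    unfolding P_def
  proof (rule has_ord_prod)
    show "has_ord (\<lambda>x. tt a b x powi n a) c ((if c = a then 1 else 0) * n a)" if a: "a \<in> A - {b}" for a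
    proof (rule has_ord_powi)
      show "has_ord (tt a b) c (if c = a then 1 else 0)"
        using has_ord_tt(1,3) [of a b] in_XN a c A(3) by auto
    qed
  qed (use A c in auto)
  have ordP': "has_ord P c (n c)" if c: "c \<in> A - {b}" for c
  proof -
    have "(\<Sum>a\<in>A - {b}. (if c = a then 1 else 0) * n a) = (\<Sum>a\<in>A - {b}. if c = a then n a else 0)"
      by (rule sum.cong) auto
    also have "\<dots> = n c" using A(1) c by (simp add: sum.delta)
    finally show ?thesis using ordP [OF c] by simp
  qed
  have ordPb: "has_ord P b (\<Sum>a\<in>A - {b}. (- 1) * n a)"
    unfolding P_def
    by (intro has_ord_prod has_ord_powi has_ord_tt(2)) (use A in auto)
  have "logeq (X - A) (\<lambda>x. g x / P x) (\<lambda>_. 1)"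
  proof (rule logeq_sphere_minus [OF A])
    show "continuous_on (X - A) (\<lambda>x. g x / P x)"
      using Pnz by (intro continuous_intros g Pc) auto
    show "g x / P x \<noteq> 0" if "x \<in> X - A" for x using g(2) Pnz that by simp
    show "has_ord (\<lambda>x. g x / P x) a 0" if "a \<in> A - {b}" for a
      using has_ord_divide [OF ord [OF that] ordP' [OF that]] by simp
  qed
  then have *: "logeq (X - A) g P"
    using logeq_divide_iff [of "X - A" P g] Pnz by blast
  then show "logeq (X - A) g (\<lambda>x. \<Prod>a\<in>A - {b}. tt a b x powi n a)"
    unfolding P_def .
  have "has_ord g b (\<Sum>a\<in>A - {b}. (- 1) * n a)"
  proof (rule has_ord_cong [OF ordPb openin_minus_finite_X [of "A - {b}"]])
    show "b \<in> X - (A - {b})" using A by blast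
    show "logeq (X - (A - {b}) - {b} - {N}) g P"
      by (rule logeq_subset [OF *]) (use A in auto)
  qed (use A in simp)
  then show "has_ord g b (- (\<Sum>a\<in>A - {b}. n a))" by (simp add: sum_negf)
qed

end

section \<open>Orientation\<close>

context sphere_chart
begin

text \<open>The integer \<open>e\<close> is the local degree, read off as an order and required to
  be the same wherever the chart sees both a point and its image. For the standard sphere it is
  matched with the Brouwer degree in \<open>deg_1_of_orient\<close> and
  \<open>orient_of_deg_1\<close>.\<close>

definition orient :: "('a \<Rightarrow> 'a) \<Rightarrow> int \<Rightarrow> bool" where
  "orient f e \<longleftrightarrow> e \<in> {1, -1} \<and>
     (\<forall>a\<in>X - {N}. f a \<in> X - {N} \<longrightarrow> has_ord (\<lambda>x. z (f x) - z (f a)) a e)"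

lemma openin_preimage:
  assumes "homeomorphism X X f f'" "openin (top_of_set X) W"
  shows "openin (top_of_set X) (X \<inter> f -` W)"
  by (rule continuous_openin_preimage [of X f X]) (use assms in \<open>auto simp: homeomorphism_def\<close>)

text \<open>The chain rule for orders: inside the \<open>m\<close>-th power,
  \<open>z o f - z (f a)\<close> may be replaced by \<open>(z - z a) powi e\<close>.\<close>

lemma has_ord_pullback:
  assumes f: "homeomorphism X X f f'" and a: "a \<in> X - {N}"
    and e: "has_ord (\<lambda>x. z (f x) - z (f a)) a e" and g: "has_ord g (f a) m"
  shows "has_ord (\<lambda>x. g (f x)) a (e * m)"
proof -
  obtain V where V: "openin (top_of_set X) V" "f a \<in> V" "N \<notin> V" "logeq (V - {f a}) g (\<lambda>x. (z x - z (f a)) powi m)"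
    using g unfolding has_ord_def by blast
  obtain W where W: "openin (top_of_set X) W" "a \<in> W" "N \<notin> W"
    "logeq (W - {a}) (\<lambda>x. z (f x) - z (f a)) (\<lambda>x. (z x - z a) powi e)"
    using e unfolding has_ord_def by blast
  let ?U = "W \<inter> (X \<inter> f -` V)"
  have cf: "continuous_on X f" and inj: "\<And>x y. x \<in> X \<Longrightarrow> y \<in> X \<Longrightarrow> f x = f y \<Longrightarrow> x = y"
    using f unfolding homeomorphism_def by metis+
  have "logeq (?U - {a}) (\<lambda>x. g (f x)) (\<lambda>x. (z (f x) - z (f a)) powi m)"
  proof (rule logeq_compose [OF V(4)])
    show "continuous_on (?U - {a}) f" by (rule continuous_on_subset [OF cf]) auto
    show "f ` (?U - {a}) \<subseteq> V - {f a}" using inj a by blast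
  qed
  also have "logeq (?U - {a}) (\<lambda>x. (z (f x) - z (f a)) powi m) (\<lambda>x. ((z x - z a) powi e) powi m)"
    by (rule logeq_powi, rule logeq_subset [OF W(4)]) auto
  also have "(\<lambda>x. ((z x - z a) powi e) powi m) = (\<lambda>x. (z x - z a) powi (e * m))"
    by (simp add: power_int_mult)
  finally have "logeq (?U - {a} - {N}) (\<lambda>x. g (f x)) (\<lambda>x. (z x - z a) powi (e * m))"
    by (rule logeq_subset) auto
  then show ?thesis
  proof (rule has_ordI [rotated 3])
    show "openin (top_of_set X) ?U" by (intro openin_Int W openin_preimage [OF f] V)
  qed (use V W a in auto)
qed

lemma local_degree_exists:
  assumes f: "homeomorphism X X f f'" and a: "a \<in> X - {N}" and fa: "f a \<in> X - {N}"
  obtains e where "has_ord (\<lambda>x. z (f x) - z (f a)) a e"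
proof (rule has_ord_exists)
  let ?W = "X \<inter> f -` (X - {N})"
  have cf: "continuous_on X f" and inj: "\<And>x y. x \<in> X \<Longrightarrow> y \<in> X \<Longrightarrow> f x = f y \<Longrightarrow> x = y"
    using f unfolding homeomorphism_def by metis+
  show "openin (top_of_set X) ?W"
    by (rule openin_preimage [OF f]) (rule openin_minus_finite_X, simp)
  show "a \<in> ?W" "a \<noteq> N" using a fa by auto
  show "continuous_on (?W - {a}) (\<lambda>x. z (f x) - z (f a))"
  proof -
    have "continuous_on (?W - {a}) (\<lambda>x. z (f x))"
      by (rule continuous_on_compose2 [OF continuous_on_z [of "X - {N}"] continuous_on_subset [OF cf]]) auto
    then show ?thesis by (intro continuous_intros)
  qed
  show "z (f x) - z (f a) \<noteq> 0" if "x \<in> ?W - {a}" for x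
  proof -
    have "f x \<noteq> f a" using inj that a by blast
    then show ?thesis using z_eq_iff [of "f x" "f a"] fa that by auto
  qed
qed

text \<open>The local degrees of \<open>f\<close> at \<open>a\<close> and of its inverse at
  \<open>f a\<close> multiply to that of the identity.\<close>

lemma local_degree_unit:
  assumes f: "homeomorphism X X f f'" and a: "a \<in> X - {N}" and fa: "f a \<in> X - {N}"
    and e: "has_ord (\<lambda>x. z (f x) - z (f a)) a e"
  shows "e \<in> {1, -1}"
proof -
  have f': "homeomorphism X X f' f" by (rule homeomorphism_symD [OF f])
  have f'fa: "f' (f a) = a" using f a by (simp add: homeomorphism_def)
  obtain e' where e': "has_ord (\<lambda>x. z (f' x) - z (f' (f a))) (f a) e'"
    using local_degree_exists [OF f' fa] f'fa a by auto
  have "has_ord (\<lambda>x. z (f' (f x)) - z (f' (f a))) a (e * e')"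
    by (rule has_ord_pullback [OF f a e e'])
  then have "has_ord (\<lambda>x. z x - z a) a (e * e')"
    by (rule has_ord_eq) (use f f'fa in \<open>simp add: homeomorphism_def\<close>)
  then have "e * e' = 1"
    using has_ord_unique has_ord_coord [OF a] by blast
  then show ?thesis using zmult_eq_1_iff by auto
qed

text \<open>The function \<open>tt (f a) (f b) o f\<close> has only two punctures. Its order is the
  local degree at \<open>a\<close> and minus the local degree at \<open>b\<close>; as orders sum to
  0, the two local degrees agree.\<close>

lemma orient_exists:
  assumes f: "homeomorphism X X f f'"
  obtains e where "orient f e"
proof -
  have cf: "continuous_on X f" and inj: "\<And>x y. x \<in> X \<Longrightarrow> y \<in> X \<Longrightarrow> f x = f y \<Longrightarrow> x = y"
    using f unfolding homeomorphism_def by metis+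
  have fX: "\<And>x. x \<in> X \<Longrightarrow> f x \<in> X"
    using f by (auto simp: homeomorphism_def)
  let ?D = "\<lambda>a e. has_ord (\<lambda>x. z (f x) - z (f a)) a e"
  have const: "e = d" if a: "a \<in> X - {N}" "f a \<in> X - {N}" "?D a e" and b: "b \<in> X - {N}" "f b \<in> X - {N}" "?D b d" for a b e d
  proof (cases "a = b")
    case True
    then show ?thesis using that has_ord_unique by blast
  next
    case False
    have neq: "f a \<noteq> f b" using inj a b False by blast
    let ?g = "\<lambda>x. tt (f a) (f b) (f x)"
    have oa: "has_ord ?g a (e * 1)"
      by (rule has_ord_pullback [OF f a(1,3)]) (rule has_ord_tt(1) [OF a(2) b(2) neq])
    have ob: "has_ord ?g b (d * (- 1))"
      by (rule has_ord_pullback [OF f b(1,3)]) (rule has_ord_tt(2) [OF a(2) b(2) neq])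
    have "has_ord ?g b (- (\<Sum>c\<in>{a, b} - {b}. e))"
    proof (rule sphere_classification(2) [of "{a, b}" b])
      show "continuous_on (X - {a, b}) ?g"
        by (rule continuous_on_compose2 [OF continuous_on_tt [OF a(2) b(2)] continuous_on_subset [OF cf]])
          (use fX inj b in auto)
      show "?g x \<noteq> 0" if "x \<in> X - {a, b}" for x
      proof (rule tt_nz [OF a(2) b(2)])
        show "f x \<in> X - {f a, f b}" using fX inj a b that by blast
      qed
      show "has_ord ?g c e" if "c \<in> {a, b} - {b}" for c
        using oa that by auto
    qed (use a b in auto)
    moreover have "(\<Sum>c\<in>{a, b} - {b}. e) = e"
    proof -
      have "{a, b} - {b} = {a}" using False by auto
      then show ?thesis by simp
    qed
    ultimately have "- e = d * (- 1)" using has_ord_unique ob by metis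
    then show ?thesis by simp
  qed
  show thesis
  proof (cases "\<exists>a\<in>X - {N}. f a \<in> X - {N}")
    case True
    then obtain a where a: "a \<in> X - {N}" "f a \<in> X - {N}" by blast
    obtain e where e: "?D a e" using local_degree_exists [OF f a] .
    have "?D b e" if b: "b \<in> X - {N}" "f b \<in> X - {N}" for b
    proof -
      obtain d where d: "?D b d" using local_degree_exists [OF f b] .
      then show ?thesis using const [OF a e b d] by simp
    qed
    then have "orient f e"
      using local_degree_unit [OF f a e] by (simp add: orient_def)
    then show thesis by (rule that)
  next
    \<comment> \<open>Here the condition on \<open>f\<close> is vacuous, and either sign would
      do.\<close>
    case False
    then have "orient f 1" unfolding orient_def by blast
    then show thesis by (rule that)
  qed
qed

lemma infinite_X: "infinite X"
proof
  assume "finite X"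
  moreover have "inj z'" by (metis injI z_z')
  then have "infinite (range z')" using finite_imageD infinite_UNIV_char_0 by blast
  moreover have "range z' \<subseteq> X" by auto
  ultimately show False using finite_subset by blast
qed

lemma generic_point:
  assumes "finite A" obtains a where "a \<in> X" "a \<notin> A"
  using infinite_X assms by (meson finite_subset subsetI)

lemma orient_pullback:
  assumes "homeomorphism X X f f'" "orient f e" "a \<in> X - {N}" "f a \<in> X - {N}" "has_ord g (f a) m"
  shows "has_ord (\<lambda>x. g (f x)) a (e * m)"
  using has_ord_pullback [OF assms(1,3) _ assms(5)] assms(2-4) by (simp add: orient_def)

lemma orient_compose:
  assumes f: "homeomorphism X X f f'" "orient f e" and g: "homeomorphism X X g g'" "orient g d"
  shows "orient (\<lambda>x. g (f x)) (e * d)"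
proof -
  have gf: "homeomorphism X X (\<lambda>x. g (f x)) (\<lambda>x. f' (g' x))"
    using homeomorphism_compose [OF f(1) g(1)] by (simp add: o_def)
  obtain c where c: "orient (\<lambda>x. g (f x)) c" using orient_exists [OF gf] .
  have fX: "f x \<in> X" if "x \<in> X" for x using homeomorphism_image1 [OF f(1)] that by blast
  have gX: "g x \<in> X" if "x \<in> X" for x using homeomorphism_image1 [OF g(1)] that by blast
  \<comment> \<open>A point that is not at infinity and is not sent there by \<open>f\<close> or by
    \<open>g o f\<close>, so that the chart sees all three local degrees.\<close>
  obtain a where a: "a \<in> X" "a \<notin> {N, f' N, f' (g' N)}"
    using generic_point [of "{N, f' N, f' (g' N)}"] by auto
  have 1: "a \<in> X - {N}" using a by auto
  have "f a \<noteq> N" using a homeomorphism_apply1 [OF f(1) a(1)] by auto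
  then have 2: "f a \<in> X - {N}" using fX a(1) by simp
  have "f' (g' (g (f a))) = a"
    using homeomorphism_apply1 [OF f(1) a(1)] homeomorphism_apply1 [OF g(1) fX [OF a(1)]] by simp
  then have "g (f a) \<noteq> N" using a(2) by auto
  then have 3: "g (f a) \<in> X - {N}" using gX fX a(1) by simp
  have "has_ord (\<lambda>x. z (g x) - z (g (f a))) (f a) d"
    using g(2) 2 3 by (simp add: orient_def)
  then have "has_ord (\<lambda>x. z (g (f x)) - z (g (f a))) a (e * d)"
    by (rule orient_pullback [OF f 1 2])
  moreover have "has_ord (\<lambda>x. z (g (f x)) - z (g (f a))) a c"
    using c 1 3 by (simp add: orient_def)
  ultimately show ?thesis using c has_ord_unique by blast
qed

text \<open>Homeomorphisms of the plane are proper, so they extend to the one-point compactification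
  by fixing \<open>N\<close>.\<close>

lemma extend_homeo:
  assumes "homeomorphism UNIV UNIV \<phi> \<psi>"
  obtains f f' where "homeomorphism X X f f'" "\<And>x. x \<in> X - {N} \<Longrightarrow> f x = z' (\<phi> (z x))" "f N = N"
proof -
  define E where "E \<phi> x = (if x = N then N else z' (\<phi> (z x)))" for \<phi> x
  have cont: "continuous_on X (E \<phi>)" if h: "homeomorphism UNIV UNIV \<phi> \<psi>" for \<phi> \<psi>
  proof (rule continuous_on_at_N)
    have c\<phi>: "continuous_on UNIV \<phi>" using h by (simp add: homeomorphism_def)
    have "continuous_on (X - {N}) (\<lambda>x. \<phi> (z x))"
      by (rule continuous_on_compose2 [OF c\<phi> continuous_on_z]) auto
    then have "continuous_on (X - {N}) (\<lambda>x. z' (\<phi> (z x)))"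
      by (rule continuous_on_compose2 [OF continuous_on_z' [of UNIV]]) auto
    then show "continuous_on (X - {N}) (E \<phi>)"
      by (rule continuous_on_eq) (simp add: E_def)
    fix B assume B: "open B" "E \<phi> N \<in> B"
    then have NB: "N \<in> B" by (simp add: E_def)
    have K: "compact (X - B)" using compact_X B by (simp add: compact_diff)
    have sub: "X - B \<subseteq> X - {N}" using NB by blast
    have "compact (\<psi> ` z ` (X - B))"
      using h by (intro compact_continuous_image K continuous_on_z sub)
        (auto simp: homeomorphism_def intro: continuous_on_subset)
    then obtain R where R: "\<And>w. w \<in> \<psi> ` z ` (X - B) \<Longrightarrow> cmod w \<le> R"
      using compact_imp_bounded bounded_iff by metis
    show "\<exists>R. \<forall>x\<in>X - {N}. R < cmod (z x) \<longrightarrow> E \<phi> x \<in> B"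
    proof (intro exI ballI impI, rule ccontr)
      fix x assume x: "x \<in> X - {N}" "R < cmod (z x)" "E \<phi> x \<notin> B"
      then have "z' (\<phi> (z x)) \<in> X - B" by (auto simp: E_def)
      moreover have "\<psi> (z (z' (\<phi> (z x)))) = z x" using h by (simp add: homeomorphism_def)
      ultimately have "z x \<in> \<psi> ` z ` (X - B)" by (metis imageI)
      then show False using R x by fastforce
    qed
  qed (use N_in in auto)
  have inv: "homeomorphism UNIV UNIV \<psi> \<phi>" using assms homeomorphism_symD by blast
  have EE: "E \<psi> (E \<phi> x) = x" if "x \<in> X" "homeomorphism UNIV UNIV \<phi> \<psi>" for x \<phi> \<psi>
    using that by (auto simp: E_def homeomorphism_def)
  have EX: "E \<phi> x \<in> X" if "x \<in> X" for \<phi> x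
    using that by (auto simp: E_def)
  have "homeomorphism X X (E \<phi>) (E \<psi>)"
  proof (rule homeomorphismI)
    show "continuous_on X (E \<phi>)" "continuous_on X (E \<psi>)" using cont assms inv by blast+
    show "E \<phi> ` X \<subseteq> X" "E \<psi> ` X \<subseteq> X" using EX by blast+
    show "\<And>x. x \<in> X \<Longrightarrow> E \<psi> (E \<phi> x) = x" "\<And>x. x \<in> X \<Longrightarrow> E \<phi> (E \<psi> x) = x"
      using EE assms inv by blast+
  qed
  then show thesis
    by (rule that) (simp_all add: E_def)
qed

end

section \<open>Homotopies to the identity\<close>

context sphere_chart
begin

lemma z'_eq_iff [simp]: "z' v = z' w \<longleftrightarrow> v = w"
  by (metis z_z')

text \<open>The quotient of \<open>z o f\<close> by \<open>z\<close> vanishes nowhere off 0 and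
  infinity, and its order at 0 is the local degree minus 1, hence 0. The point at infinity imposes
  no condition.\<close>

lemma orient_1_logeq:
  assumes f: "homeomorphism X X f f'" and "orient f 1" and fx: "f N = N" "f (z' 0) = z' 0"
  shows "logeq (X - {N, z' 0}) (\<lambda>x. z (f x)) z"
proof -
  have fN: "f x \<in> X - {N, z' 0}" if "x \<in> X - {N, z' 0}" for x
  proof -
    have "f x \<in> X" using homeomorphism_image1 [OF f] that by blast
    moreover have "f' (f x) = x" "f' (f N) = N" "f' (f (z' 0)) = z' 0"
      using homeomorphism_apply1 [OF f] that N_in by auto
    then have "f x \<noteq> N" "f x \<noteq> z' 0" using fx that by auto
    ultimately show ?thesis by simp
  qed
  have znz: "z x \<noteq> 0" if "x \<in> X - {N, z' 0}" for x
    using that z'_z [of x] by (metis Diff_iff insertCI)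
  have cf: "continuous_on X f" using f by (simp add: homeomorphism_def)
  have img: "z' ` (- {0}) \<subseteq> X - {N, z' 0}"
  proof (rule image_subsetI)
    fix w :: complex assume "w \<in> - {0}"
    then show "z' w \<in> X - {N, z' 0}" by simp
  qed
  have "logeq (- {0}) (\<lambda>w. z (f (z' w)) / z (z' w)) (\<lambda>_. 1)"
  proof (rule logeq_punctured_plane)
    have "continuous_on (X - {N, z' 0}) (\<lambda>x. z (f x))"
      by (rule continuous_on_compose2 [OF continuous_on_z [of "X - {N}"] continuous_on_subset [OF cf]])
        (use fN in auto)
    then have "continuous_on (X - {N, z' 0}) (\<lambda>x. z (f x) / z x)"
      using znz by (intro continuous_intros continuous_on_z) auto
    then show "continuous_on (- {0}) (\<lambda>w. z (f (z' w)) / z (z' w))"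
      by (rule continuous_on_compose2 [OF _ continuous_on_z' img])
    show "z (f (z' w)) / z (z' w) \<noteq> 0" if "w \<notin> {0}" for w
    proof -
      have "z' w \<in> X - {N, z' 0}" using img that by blast
      then show ?thesis using znz fN by simp
    qed
    show "\<exists>r>0. logeq (ball a r - {a}) (\<lambda>w. z (f (z' w)) / z (z' w)) (\<lambda>_. 1)" if "a \<in> {0}" for a
    proof -
      have "has_ord (\<lambda>x. z (f x) - z (f (z' 0))) (z' 0) 1"
      proof -
        have "z' 0 \<in> X - {N}" "f (z' 0) \<in> X - {N}" using fx(2) by auto
        then show ?thesis using assms(2) unfolding orient_def by blast
      qed
      then obtain W where W: "openin (top_of_set X) W" "z' 0 \<in> W" "N \<notin> W"
        "logeq (W - {z' 0}) (\<lambda>x. z (f x)) z"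
        unfolding has_ord_def by (auto simp: fx)
      obtain r where r: "r > 0" "z' ` ball 0 r \<subseteq> W"
        using nbhd_ball [OF W(1,2)] by auto
      have sub: "z' ` (ball 0 r - {0}) \<subseteq> W - {z' 0}"
        using img r(2) by blast
      have "logeq (ball 0 r - {0}) (\<lambda>w. z (f (z' w))) (\<lambda>w. z (z' w))"
        by (rule logeq_compose [OF W(4) continuous_on_z' sub])
      then have "logeq (ball 0 r - {0}) (\<lambda>w. z (f (z' w)) / z (z' w)) (\<lambda>_. 1)"
        by (subst logeq_divide_iff) auto
      then show ?thesis using r(1) that by blast
    qed
  qed simp
  then have "logeq (- {0}) (\<lambda>w. z (f (z' w))) (\<lambda>w. z (z' w))"
    by (subst (asm) logeq_divide_iff) auto
  then have "logeq (X - {N, z' 0}) (\<lambda>x. z (f (z' (z x)))) (\<lambda>x. z (z' (z x)))"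
  proof (rule logeq_compose)
    show "continuous_on (X - {N, z' 0}) z" by (rule continuous_on_z) auto
    show "z ` (X - {N, z' 0}) \<subseteq> - {0}" by (rule image_subsetI) (metis ComplI singletonD znz)
  qed
  then have "logeq (X - {N, z' 0}) (\<lambda>x. z (f (z' (z x)))) z" by simp
  moreover have "logeq (X - {N, z' 0}) (\<lambda>x. z (f x)) (\<lambda>x. z (f (z' (z x))))"
    by (rule logeq_eq) simp
  ultimately show ?thesis by (rule logeq_trans [rotated])
qed

text \<open>If \<open>f(z) = z e\<^sup>l\<close>, then \<open>z e\<^sup>s\<^sup>l\<close> for \<open>0 \<le> s \<le> 1\<close> is a homotopy from the identity to \<open>f\<close>;
  its modulus lies between those of \<open>z\<close> and \<open>f(z)\<close>, which gives continuity at \<open>0\<close> and at infinity.\<close>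

lemma homotopy_from_id:
  assumes f: "homeomorphism X X f f'" and fx: "f N = N" "f (z' 0) = z' 0"
    and eq: "logeq (X - {N, z' 0}) (\<lambda>x. z (f x)) z"
  shows "\<exists>H. continuous_on ({0..1} \<times> X) H \<and> H ` ({0..1} \<times> X) \<subseteq> X \<and>
    (\<forall>x\<in>X. H (0::real, x) = x) \<and> (\<forall>x\<in>X. H (1, x) = f x)"
proof -
  let ?O = "z' 0"
  obtain l where l: "continuous_on (X - {N, ?O}) l" "\<And>x. x \<in> X - {N, ?O} \<Longrightarrow> z (f x) = z x * exp (l x)"
    using eq by (rule logeqE) blast
  define h where "h s x = z x * exp (of_real s * l x)" for s :: real and x
  define H where "H = (\<lambda>(s, x). if x = N \<or> x = ?O then x else z' (h s x))"
  have fX: "f x \<in> X" if "x \<in> X" for x using homeomorphism_image1 [OF f] that by blast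
  have fN: "f x \<in> X - {N, ?O}" if "x \<in> X - {N, ?O}" for x
  proof -
    have "f' (f x) = x" "f' (f N) = N" "f' (f ?O) = ?O"
      using homeomorphism_apply1 [OF f] that N_in by auto
    then have "f x \<noteq> N" "f x \<noteq> ?O" using fx that by auto
    then show ?thesis using fX that by simp
  qed
  have cf: "continuous_on X f" using f by (simp add: homeomorphism_def)
  have nh: "min (cmod (z x)) (cmod (z (f x))) \<le> cmod (h s x)" "cmod (h s x) \<le> max (cmod (z x)) (cmod (z (f x)))"
    if s: "0 \<le> s" "s \<le> 1" and x: "x \<in> X - {N, ?O}" for s x
  proof -
    let ?r = "Re (l x)"
    have "cmod (z (f x)) = cmod (z x) * exp ?r" by (simp add: l(2) [OF x] norm_mult)
    moreover have "cmod (h s x) = cmod (z x) * exp (s * ?r)" by (simp add: h_def norm_mult)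
    moreover have "min 1 (exp ?r) \<le> exp (s * ?r) \<and> exp (s * ?r) \<le> max 1 (exp ?r)"
    proof (cases "0 \<le> ?r")
      case True
      then have "0 \<le> s * ?r" "s * ?r \<le> ?r" using s by (auto simp: mult_left_le_one_le)
      then show ?thesis by auto
    next
      case False
      then have "s * ?r \<le> 0" "?r \<le> s * ?r"
        using s by (auto simp: mult_nonneg_nonpos)
      then show ?thesis by auto
    qed
    moreover have "min (cmod (z x)) (cmod (z x) * exp ?r) = cmod (z x) * min 1 (exp ?r)"
      "max (cmod (z x)) (cmod (z x) * exp ?r) = cmod (z x) * max 1 (exp ?r)"
      by (simp_all add: min_mult_distrib_left max_mult_distrib_left)
    ultimately show "min (cmod (z x)) (cmod (z (f x))) \<le> cmod (h s x)" "cmod (h s x) \<le> max (cmod (z x)) (cmod (z (f x)))"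
      by (auto intro: mult_left_mono)
  qed
  have near: "\<exists>A. openin (top_of_set X) A \<and> p \<in> A \<and> (\<forall>s\<in>{0..1}. \<forall>x\<in>A. H (s, x) \<in> B)"
    if p: "p \<in> {N, ?O}" and B: "open B" "p \<in> B" for p B
  proof (cases "p = N")
    case True
    have K: "compact (X - B)" using compact_X B by (simp add: compact_diff)
    have "compact (z ` (X - B))"
      by (intro compact_continuous_image K continuous_on_z) (use B True in auto)
    then obtain R0 where R0: "\<And>w. w \<in> z ` (X - B) \<Longrightarrow> cmod w \<le> R0"
      using compact_imp_bounded bounded_iff by metis
    define R where "R = max R0 0"
    have R: "z' w \<in> B" if "R < cmod w" for w
    proof (rule ccontr)
      assume "z' w \<notin> B"
      then have "w \<in> z ` (X - B)" by (metis DiffI imageI z'_in(1) z_z')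
      then show False using R0 [of w] that by (simp add: R_def)
    qed
    let ?D = "X - z' ` cball 0 R"
    have zA: "cmod (z x) > R" if "x \<in> ?D" "x \<noteq> N" for x
    proof (rule ccontr)
      assume "\<not> cmod (z x) > R"
      then have "z' (z x) \<in> z' ` cball 0 R" by simp
      then show False using that by simp
    qed
    let ?A = "?D \<inter> (X \<inter> f -` ?D)"
    have "openin (top_of_set X) ?A"
      by (intro openin_Int openin_nbhd_N openin_preimage [OF f])
    moreover have "N \<in> ?A" using N_in fx by auto
    moreover have "H (s, x) \<in> B" if s: "s \<in> {0..1}" and x: "x \<in> ?A" for s x
    proof (cases "x = N")
      case False
      have "0 \<in> cball (0::complex) R" by (simp add: R_def)
      then have "?O \<in> z' ` cball 0 R" by (rule imageI)
      then have xO: "x \<in> X - {N, ?O}" using x False by auto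
      have "cmod (z x) > R" "cmod (z (f x)) > R"
        using zA [of x] zA [of "f x"] fN [OF xO] x False by auto
      then have "cmod (h s x) > R" using nh(1) [of s x] s xO by auto
      then show ?thesis using xO R by (simp add: H_def)
    qed (use True B in \<open>simp add: H_def\<close>)
    ultimately have "openin (top_of_set X) ?A \<and> N \<in> ?A \<and> (\<forall>s\<in>{0..1}. \<forall>x\<in>?A. H (s, x) \<in> B)"
      by (intro conjI ballI)
    then show ?thesis unfolding True by (rule exI)
  next
    case False
    then have pO: "p = ?O" using p by simp
    have "openin (top_of_set X) (X \<inter> B)" using B by (simp add: openin_open_Int)
    then obtain r where r: "r > 0" "z' ` ball (z ?O) r \<subseteq> X \<inter> B"
      by (rule nbhd_ball) (use B pO in auto)
    let ?D = "z' ` ball 0 r"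
    let ?A = "?D \<inter> (X \<inter> f -` ?D)"
    have "openin (top_of_set X) ?A"
      by (intro openin_Int openin_z'_image openin_preimage [OF f]) auto
    moreover have "?O \<in> ?A" using r fx by auto
    moreover have "H (s, x) \<in> B" if s: "s \<in> {0..1}" and x: "x \<in> ?A" for s x
    proof (cases "x = ?O")
      case False
      have xO: "x \<in> X - {N, ?O}" using x False by auto
      have "x \<in> ?D" using x by (rule IntD1)
      moreover have "f x \<in> ?D" using x by (simp only: Int_iff vimage_eq)
      moreover have "cmod (z y) < r" if y: "y \<in> ?D" for y
      proof -
        obtain w where "w \<in> ball 0 r" "y = z' w" using y by blast
        then show ?thesis by simp
      qed
      ultimately have "cmod (z x) < r" "cmod (z (f x)) < r" by blast+
      then have "cmod (h s x) < r" using nh(2) [of s x] s xO by auto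
      then have "z' (h s x) \<in> B" using r(2) by auto
      then show ?thesis using xO by (simp add: H_def)
    qed (use pO B in \<open>simp add: H_def\<close>)
    ultimately have "openin (top_of_set X) ?A \<and> ?O \<in> ?A \<and> (\<forall>s\<in>{0..1}. \<forall>x\<in>?A. H (s, x) \<in> B)"
      by (intro conjI ballI)
    then show ?thesis unfolding pO by (rule exI)
  qed
  have c0: "continuous_on ({0..1} \<times> (X - {N, ?O})) H"
  proof -
    have "continuous_on ({0..1} \<times> (X - {N, ?O})) (\<lambda>p. z (snd p) * exp (of_real (fst p) * l (snd p)))"
      by (intro continuous_intros continuous_on_compose2 [OF continuous_on_z [of "X - {N}"]]
          continuous_on_compose2 [OF l(1)]) auto
    then have "continuous_on ({0..1} \<times> (X - {N, ?O})) (\<lambda>p. z' (h (fst p) (snd p)))"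
      unfolding h_def by (rule continuous_on_compose2 [OF continuous_on_z' [of UNIV]]) auto
    then show ?thesis
      by (rule continuous_on_eq) (auto simp: H_def split: if_split_asm)
  qed
  have "continuous_on ({0..1} \<times> X) H"
    unfolding continuous_on_topological
  proof (intro ballI allI impI)
    fix q B assume q: "q \<in> {0..1::real} \<times> X" and B: "open B" "H q \<in> B"
    obtain s x where sx: "q = (s, x)" by (cases q)
    show "\<exists>A. open A \<and> q \<in> A \<and> (\<forall>y\<in>{0..1} \<times> X. y \<in> A \<longrightarrow> H y \<in> B)"
    proof (cases "x \<in> {N, ?O}")
      case True
      then have "x \<in> B" using B sx by (auto simp: H_def)
      then obtain A where A: "openin (top_of_set X) A" "x \<in> A" "\<forall>s\<in>{0..1}. \<forall>x\<in>A. H (s, x) \<in> B"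
        using near [OF True B(1)] by blast
      then obtain A0 where A0: "open A0" "A = X \<inter> A0" by (auto simp: openin_open)
      then show ?thesis
        using A sx by (intro exI [of _ "UNIV \<times> A0"]) (auto simp: open_Times)
    next
      case False
      have "q \<in> {0..1} \<times> (X - {N, ?O})" using q sx False by auto
      then obtain A where A: "open A" "q \<in> A" "\<And>y. y \<in> {0..1} \<times> (X - {N, ?O}) \<Longrightarrow> y \<in> A \<Longrightarrow> H y \<in> B"
        using c0 B unfolding continuous_on_topological by metis
      have "open (UNIV \<times> (- {N, ?O}))" by (intro open_Times open_Compl) auto
      then have "open (A \<inter> UNIV \<times> (- {N, ?O}))" using A(1) by (rule open_Int [rotated])
      then show ?thesis
        using A sx False by (intro exI [of _ "A \<inter> UNIV \<times> (- {N, ?O})"]) auto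
    qed
  qed
  moreover have "H ` ({0..1} \<times> X) \<subseteq> X" by (auto simp: H_def)
  moreover have "H (0, x) = x" if "x \<in> X" for x
    using that by (simp add: H_def h_def)
  moreover have "H (1, x) = f x" if "x \<in> X" for x
  proof (cases "x \<in> {N, ?O}")
    case True
    then show ?thesis using fx by (auto simp: H_def)
  next
    case False
    then have x: "x \<in> X - {N, ?O}" using that by simp
    have "H (1, x) = z' (z (f x))" using False by (simp add: H_def h_def l(2) [OF x])
    then show ?thesis using fN [OF x] by simp
  qed
  ultimately show ?thesis by (intro exI [of _ H] conjI ballI)
qed

lemma realize_injection_chart:
  assumes A: "finite A" "A \<subseteq> X - {N}" "\<sigma> ` A \<subseteq> X - {N}" "inj_on \<sigma> A"
  obtains f f' where "homeomorphism X X f f'" "\<And>a. a \<in> A \<Longrightarrow> f a = \<sigma> a"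
proof -
  obtain \<phi> \<psi> where \<phi>: "homeomorphism UNIV UNIV \<phi> \<psi>" "\<And>a. a \<in> A \<Longrightarrow> \<phi> (z a) = z (\<sigma> a)"
  proof (rule homeomorphism_moving_points_exists [of UNIV UNIV A z "\<lambda>a. z (\<sigma> a)"])
    show "pairwise (\<lambda>i j. z i \<noteq> z j \<and> z (\<sigma> i) \<noteq> z (\<sigma> j)) A"
    proof (rule pairwiseI)
      fix i j assume ij: "i \<in> A" "j \<in> A" "i \<noteq> j"
      then have "\<sigma> i \<noteq> \<sigma> j" using A(4) by (auto dest: inj_onD)
      moreover have "i \<in> X" "i \<noteq> N" "j \<in> X" "j \<noteq> N" "\<sigma> i \<in> X" "\<sigma> i \<noteq> N" "\<sigma> j \<in> X" "\<sigma> j \<noteq> N"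
        using A(2,3) ij by auto
      ultimately show "z i \<noteq> z j \<and> z (\<sigma> i) \<noteq> z (\<sigma> j)" using z_eq_iff ij(3) by metis
    qed
  qed (use A in auto)
  obtain f f' where f: "homeomorphism X X f f'" "\<And>x. x \<in> X - {N} \<Longrightarrow> f x = z' (\<phi> (z x))"
    using extend_homeo [OF \<phi>(1)] by metis
  have "f a = \<sigma> a" if "a \<in> A" for a
  proof -
    have "a \<in> X - {N}" "\<sigma> a \<in> X - {N}" using A that by auto
    then show ?thesis using f(2) \<phi>(2) [OF that] by simp
  qed
  with f(1) show thesis by (rule that)
qed

end

section \<open>Homeomorphisms of the standard sphere\<close>

abbreviation S2 :: "(nat \<Rightarrow> real) set" where "S2 \<equiv> topspace (nsphere 2)"

lemma S2_eq: "S2 = {x. (x 0)\<^sup>2 + (x 1)\<^sup>2 + (x 2)\<^sup>2 = 1 \<and> (\<forall>i>2. x i = 0)}"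
  by (simp add: nsphere topspace_product_topology eval_nat_numeral)

lemma nsphere_2: "nsphere 2 = top_of_set S2"
proof -
  have "nsphere 2 = subtopology euclidean {x. (\<Sum>i\<le>2. x i ^ 2) = (1::real) \<and> (\<forall>i>2. x i = 0)}"
    by (simp add: nsphere euclidean_product_topology)
  then show ?thesis by simp
qed

lemma homeomorphic_maps_S2: "homeomorphic_maps (nsphere 2) (nsphere 2) f g \<longleftrightarrow> homeomorphism S2 S2 f g"
proof -
  have "homeomorphic_maps (top_of_set T) (top_of_set T) f g \<longleftrightarrow> homeomorphism T T f g" for T :: "(nat \<Rightarrow> real) set"
  proof
    assume "homeomorphic_maps (top_of_set T) (top_of_set T) f g"
    then show "homeomorphism T T f g"
      by (intro homeomorphismI) (auto simp: homeomorphic_maps_def)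
  next
    assume h: "homeomorphism T T f g"
    then have "f \<in> T \<rightarrow> T" "g \<in> T \<rightarrow> T" by (auto simp: homeomorphism_def)
    then show "homeomorphic_maps (top_of_set T) (top_of_set T) f g"
      using h by (auto simp: homeomorphic_maps_def homeomorphism_def)
  qed
  then show ?thesis using nsphere_2 by metis
qed

lemma homeomorphic_map_S2: "homeomorphic_map (nsphere 2) (nsphere 2) f \<longleftrightarrow> (\<exists>g. homeomorphism S2 S2 f g)"
  by (simp add: homeomorphic_map_maps homeomorphic_maps_S2)

lemma S2_homeomorphic_sphere: "S2 homeomorphic (sphere 0 1 :: (real^3) set)"
proof -
  define \<phi> :: "(nat \<Rightarrow> real) \<Rightarrow> real^3" where "\<phi> x = vector [x 0, x 1, x 2]" for x
  define \<psi> :: "real^3 \<Rightarrow> nat \<Rightarrow> real" where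
    "\<psi> v = (\<lambda>i. if i = 0 then v$1 else if i = 1 then v$2 else if i = 2 then v$3 else 0)" for v
  have "homeomorphism S2 (sphere 0 1) \<phi> \<psi>"
  proof (rule homeomorphismI)
    have "continuous_on A (\<lambda>x. \<phi> x $ i)" for A i
    proof -
      have "continuous_on A (\<lambda>x::nat \<Rightarrow> real. x j)" for j
        by (rule continuous_on_product_then_coordinatewise) (rule continuous_on_id)
      then show ?thesis
        using exhaust_3 [of i] by (auto simp: \<phi>_def)
    qed
    then show "continuous_on S2 \<phi>"
      using continuous_on_vec_lambda [of S2 "\<lambda>i x. \<phi> x $ i"] by simp
    have "continuous_on A (\<lambda>v. \<psi> v i)" for A i
      by (cases "i = 0"; cases "i = 1"; cases "i = 2") (auto simp: \<psi>_def intro!: continuous_intros)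
    then show "continuous_on (sphere 0 1) \<psi>"
      by (rule continuous_on_coordinatewise_then_product)
    have nrm: "norm v = 1 \<longleftrightarrow> (v$1)\<^sup>2 + (v$2)\<^sup>2 + (v$3)\<^sup>2 = 1" for v :: "real^3"
      by (simp add: norm_vec_def L2_set_def sum_3)
    show "\<phi> ` S2 \<subseteq> sphere 0 1"
      unfolding S2_eq by (auto simp: nrm) (auto simp: \<phi>_def)
    show "\<psi> ` sphere 0 1 \<subseteq> S2"
      unfolding S2_eq by (auto simp: nrm \<psi>_def)
    show "\<psi> (\<phi> x) = x" if "x \<in> S2" for x
    proof
      fix i
      have "x i = 0" if "i > 2" using that \<open>x \<in> S2\<close> unfolding S2_eq by auto
      moreover have "i = 0 \<or> i = 1 \<or> i = 2 \<or> i > 2" by linarith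
      ultimately show "\<psi> (\<phi> x) i = x i" by (auto simp: \<psi>_def \<phi>_def)
    qed
    show "\<phi> (\<psi> v) = v" if "v \<in> sphere 0 1" for v
      by (simp add: \<psi>_def \<phi>_def vec_eq_iff forall_3)
  qed
  then show ?thesis by (auto simp: homeomorphic_def)
qed

lemma S2_minus_point:
  assumes "b \<in> S2" shows "(S2 - {b}) homeomorphic (UNIV :: complex set)"
proof -
  obtain f g where fg: "homeomorphism S2 (sphere 0 1 :: (real^3) set) f g"
    using S2_homeomorphic_sphere by (auto simp: homeomorphic_def)
  have inj: "inj_on f S2" using homeomorphism_apply1 [OF fg] by (rule inj_on_inverseI)
  have im: "f ` (S2 - {b}) = sphere 0 1 - {f b}"
    using fg assms inj by (simp add: homeomorphism_def inj_on_image_set_diff [OF inj])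
  have "homeomorphism (S2 - {b}) (sphere 0 1 - {f b}) f g"
    by (rule homeomorphism_of_subsets [OF fg _ _ im]) auto
  then have 1: "(S2 - {b}) homeomorphic (sphere (0::real^3) 1 - {f b})" by (auto simp: homeomorphic_def)
  let ?T = "{v::real^3. axis 3 1 \<bullet> v = 0}"
  have ax: "axis 3 1 \<noteq> (0::real^3)" by simp
  have "(sphere (0::real^3) 1 - {f b}) homeomorphic ?T"
    by (rule homeomorphic_punctured_sphere_hyperplane) (use fg assms ax in \<open>auto simp: homeomorphism_def\<close>)
  also have "?T homeomorphic (UNIV :: complex set)"
  proof (rule homeomorphic_affine_sets)
    show "affine ?T" by (rule affine_hyperplane)
    show "aff_dim ?T = aff_dim (UNIV :: complex set)"
      using ax by (simp add: aff_dim_hyperplane)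
  qed auto
  finally show ?thesis using 1 homeomorphic_trans by blast
qed

lemma compact_S2: "compact S2"
proof -
  obtain f g where fg: "homeomorphism S2 (sphere 0 1 :: (real^3) set) f g"
    using S2_homeomorphic_sphere by (auto simp: homeomorphic_def)
  then have "S2 = g ` sphere 0 1" "continuous_on (sphere 0 1) g" by (auto simp: homeomorphism_def)
  then show ?thesis using compact_continuous_image compact_sphere by metis
qed

lemma sphere_chart_S2:
  assumes "N \<in> S2"
  obtains z z' where "sphere_chart S2 N z z'"
proof -
  obtain z z' where "homeomorphism (S2 - {N}) (UNIV :: complex set) z z'"
    using S2_minus_point [OF assms] by (auto simp: homeomorphic_def)
  then have "sphere_chart S2 N z z'"
    using compact_S2 S2_minus_point assms by (unfold_locales) auto
  then show thesis by (rule that)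
qed

lemma infinite_S2: "infinite S2"
proof -
  obtain z z' where "sphere_chart S2 (\<lambda>n. if n = 0 then 1 else 0) z z'"
    using sphere_chart_S2 in_topspace_nsphere by blast
  then show ?thesis by (rule sphere_chart.infinite_X)
qed

lemma realize_injection:
  assumes A: "finite A" "A \<subseteq> S2" "\<sigma> ` A \<subseteq> S2" "inj_on \<sigma> A"
  shows "\<exists>f f'. homeomorphism S2 S2 f f' \<and> (\<forall>a\<in>A. f a = \<sigma> a)"
proof -
  have "finite (A \<union> \<sigma> ` A)" using A by simp
  then obtain N where N: "N \<in> S2" "N \<notin> A \<union> \<sigma> ` A"
    using infinite_S2 by (meson finite_subset subsetI)
  obtain z z' where "sphere_chart S2 N z z'" using sphere_chart_S2 [OF N(1)] .
  then interpret sphere_chart S2 N z z' .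
  have "A \<subseteq> S2 - {N}" "\<sigma> ` A \<subseteq> S2 - {N}" using A N by auto
  then obtain f f' where "homeomorphism S2 S2 f f'" "\<And>a. a \<in> A \<Longrightarrow> f a = \<sigma> a"
    using realize_injection_chart [OF A(1) _ _ A(4)] by metis
  then show ?thesis by (intro exI [of _ f] exI [of _ f'] conjI ballI)
qed

section \<open>Brouwer degree against local degree\<close>

abbreviation deg :: "((nat \<Rightarrow> real) \<Rightarrow> (nat \<Rightarrow> real)) \<Rightarrow> int" where "deg \<equiv> Brouwer_degree2 2"

lemma deg_compose:
  assumes "homeomorphism S2 S2 f f'" "homeomorphism S2 S2 g g'"
  shows "deg (\<lambda>x. g (f x)) = deg g * deg f"
proof -
  have "continuous_map (nsphere 2) (nsphere 2) f" "continuous_map (nsphere 2) (nsphere 2) g"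
    using assms homeomorphic_map_S2 homeomorphic_imp_continuous_map by blast+
  from Brouwer_degree2_compose [OF this] show ?thesis by (simp add: o_def)
qed

lemma deg_homeo: "homeomorphism S2 S2 f f' \<Longrightarrow> deg f \<in> {1, -1}"
  using Brouwer_degree2_homeomorphic_map [of 2 f] homeomorphic_map_S2 by fastforce

lemma homeomorphism_compose_S2:
  "homeomorphism S2 S2 f f' \<Longrightarrow> homeomorphism S2 S2 g g' \<Longrightarrow> homeomorphism S2 S2 (\<lambda>x. g (f x)) (\<lambda>x. f' (g' x))"
  using homeomorphism_compose [of S2 S2 f f' S2 g g'] by (simp add: o_def)

text \<open>Squares of homeomorphisms preserve orientation in either sense, and act doubly transitively
  on points; so it suffices to treat maps fixing \<open>0\<close> and infinity.\<close>

lemma deg_1_of_orient: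
  assumes "sphere_chart S2 N z z'" and f: "homeomorphism S2 S2 f f'" and "sphere_chart.orient S2 N z f 1"
  shows "deg f = 1"
proof -
  interpret sphere_chart S2 N z z' by fact
  let ?O = "z' 0"
  define p q where "p = f ?O" and "q = f N"
  have fX: "f x \<in> S2" if "x \<in> S2" for x using homeomorphism_image1 [OF f] that by blast
  have "f' p = ?O" "f' q = N" using homeomorphism_apply1 [OF f] N_in by (auto simp: p_def q_def)
  then have pq: "p \<noteq> q" by (metis z'_in(2))
  have pqX: "p \<in> S2" "q \<in> S2" using fX N_in by (auto simp: p_def q_def)
  obtain m where m: "m \<in> S2" "m \<notin> {p, q, ?O, N}"
    using generic_point [of "{p, q, ?O, N}"] by auto
  obtain m' where m': "m' \<in> S2" "m' \<notin> {p, q, ?O, N, m}"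
    using generic_point [of "{p, q, ?O, N, m}"] by auto
  \<comment> \<open>The points \<open>m\<close> and \<open>m'\<close> are way stations:
    \<open>h\<close> moves \<open>p\<close> to \<open>m\<close> and \<open>m\<close> to 0, and
    \<open>q\<close> to \<open>m'\<close> and \<open>m'\<close> to \<open>N\<close>. Its square thus
    brings the images of 0 and \<open>N\<close> under \<open>f\<close> back to 0 and
    \<open>N\<close>.\<close>
  define \<sigma> where "\<sigma> = (\<lambda>x. if x = m then ?O else if x = m' then N else if x = p then m else m')"
  have "\<exists>h h'. homeomorphism S2 S2 h h' \<and> (\<forall>a\<in>{p, m, q, m'}. h a = \<sigma> a)"
  proof (rule realize_injection)
    show "\<sigma> ` {p, m, q, m'} \<subseteq> S2" using m m' N_in by (auto simp: \<sigma>_def)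
    show "inj_on \<sigma> {p, m, q, m'}"
      using m m' pq unfolding inj_on_def \<sigma>_def by auto
  qed (use m m' pqX in auto)
  then obtain h h' where h: "homeomorphism S2 S2 h h'" "\<forall>a\<in>{p, m, q, m'}. h a = \<sigma> a"
    by (elim exE conjE)
  define M where "M x = h (h x)" for x
  have Meq: "M = (\<lambda>x. h (h x))" by (simp add: M_def fun_eq_iff)
  have hh: "homeomorphism S2 S2 M (\<lambda>x. h' (h' x))"
    unfolding M_def by (rule homeomorphism_compose_S2 [OF h(1) h(1)])
  have Mp: "M p = ?O" "M q = N"
    using h(2) m m' pq by (auto simp: M_def \<sigma>_def)
  obtain d where d: "orient h d" using orient_exists [OF h(1)] .
  then have "d * d = 1" by (auto simp: orient_def)
  then have oM: "orient M 1"
    using orient_compose [OF h(1) d h(1) d] by (simp add: Meq)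
  have dM: "deg M = 1"
    using deg_compose [OF h(1) h(1)] deg_homeo [OF h(1)] by (auto simp: Meq)
  let ?G = "\<lambda>x. M (f x)"
  have G: "homeomorphism S2 S2 ?G (\<lambda>x. f' (h' (h' x)))"
    by (rule homeomorphism_compose_S2 [OF f hh])
  have oG: "orient ?G 1"
    using orient_compose [OF f assms(3) hh oM] by simp
  have fx: "?G N = N" "?G ?O = ?O" using Mp by (simp_all add: p_def q_def)
  obtain H where H: "continuous_on ({0..1} \<times> S2) H \<and> H ` ({0..1} \<times> S2) \<subseteq> S2 \<and>
    (\<forall>x\<in>S2. H (0::real, x) = x) \<and> (\<forall>x\<in>S2. H (1, x) = ?G x)"
    using homotopy_from_id [where f = ?G, OF G fx orient_1_logeq [where f = ?G, OF G oG fx]] by (rule exE)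
  have "homotopic_with (\<lambda>_. True) (top_of_set S2) (top_of_set S2) id ?G"
  proof (subst homotopic_with)
    have "continuous_map (prod_topology (top_of_set {0..1::real}) (top_of_set S2)) (top_of_set S2) H"
      using H by auto
    then have *: "continuous_map (prod_topology (top_of_set {0..1::real}) (top_of_set S2)) (top_of_set S2) H \<and>
      (\<forall>x\<in>topspace (top_of_set S2). H (0, x) = id x) \<and> (\<forall>x\<in>topspace (top_of_set S2). H (1, x) = ?G x) \<and>
      (\<forall>t\<in>{0..1::real}. True)"
      using H by simp
    show "\<exists>h. continuous_map (prod_topology (top_of_set {0..1::real}) (top_of_set S2)) (top_of_set S2) h \<and>
      (\<forall>x\<in>topspace (top_of_set S2). h (0, x) = id x) \<and> (\<forall>x\<in>topspace (top_of_set S2). h (1, x) = ?G x) \<and>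
      (\<forall>t\<in>{0..1::real}. True)"
      by (rule exI [where x = H], rule *)
  qed auto
  then have "homotopic_with (\<lambda>_. True) (nsphere 2) (nsphere 2) id ?G"
    by (simp only: nsphere_2 [symmetric])
  then have "deg ?G = 1"
    using Brouwer_degree2_homotopic by (metis Brouwer_degree2_id)
  then show ?thesis
    using deg_compose [OF f hh] dM by simp
qed

definition refl0 :: "(nat \<Rightarrow> real) \<Rightarrow> nat \<Rightarrow> real" where
  "refl0 x = (\<lambda>i. if i = 0 then - x i else x i)"

lemma refl0: "homeomorphism S2 S2 refl0 refl0" "deg refl0 = -1"
proof -
  have "refl0 = (\<lambda>x i. if i = 0 then - x i else x i)" by (simp add: refl0_def fun_eq_iff)
  then show "deg refl0 = -1" using Brouwer_degree2_reflection [of 2] by simp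
  have "continuous_map (nsphere 2) (nsphere 2) refl0"
    unfolding refl0_def by (rule continuous_map_nsphere_reflection)
  moreover have "refl0 (refl0 x) = x" for x by (simp add: refl0_def fun_eq_iff)
  ultimately have "homeomorphic_maps (nsphere 2) (nsphere 2) refl0 refl0"
    by (simp add: homeomorphic_maps_def)
  then show "homeomorphism S2 S2 refl0 refl0" by (simp add: homeomorphic_maps_S2)
qed

text \<open>Both signs are multiplicative, and local degree 1 is known to imply degree 1. So the
  reflection, of degree -1, has local degree -1; if \<open>f\<close> had local degree -1 too, its
  composite with the reflection would have local degree 1 but degree -1.\<close>

lemma orient_of_deg_1:
  assumes "sphere_chart S2 N z z'" and f: "homeomorphism S2 S2 f f'" and "deg f = 1"
  shows "sphere_chart.orient S2 N z f 1"
proof -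
  interpret sphere_chart S2 N z z' by fact
  obtain e where e: "orient f e" using orient_exists [OF f] .
  obtain d where d: "orient refl0 d" using orient_exists [OF refl0(1)] .
  have ed: "e \<in> {1, -1}" "d \<in> {1, -1}" using e d by (auto simp: orient_def)
  have "d \<noteq> 1" using deg_1_of_orient [OF assms(1) refl0(1)] d refl0(2) by auto
  moreover have "e * d \<noteq> 1"
  proof
    assume "e * d = 1"
    then have "orient (\<lambda>x. refl0 (f x)) 1"
      using orient_compose [OF f e refl0(1) d] by simp
    then have "deg (\<lambda>x. refl0 (f x)) = 1"
      by (rule deg_1_of_orient [OF assms(1) homeomorphism_compose_S2 [OF f refl0(1)]])
    then show False using deg_compose [OF f refl0(1)] refl0(2) assms(3) by simp
  qed
  ultimately show ?thesis using e ed by auto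
qed

lemma marked_homeos_iff:
  "f \<in> marked_homeos B \<longleftrightarrow> (\<exists>f'. homeomorphism S2 S2 f f') \<and> deg f = 1 \<and> f ` B = B"
  by (auto simp: marked_homeos_def homeomorphic_map_S2)

lemma infinite_equator: "infinite {x \<in> S2. x 0 = 0}"
proof -
  define c :: "real \<Rightarrow> nat \<Rightarrow> real" where "c t = (\<lambda>i. if i = 1 then t else if i = 2 then sqrt (1 - t\<^sup>2) else 0)" for t
  have "c ` {0..1} \<subseteq> {x \<in> S2. x 0 = 0}"
    unfolding S2_eq by (auto simp: c_def power_le_one)
  moreover have "inj_on c {0..1}"
    by (rule inj_onI) (metis c_def)
  then have "infinite (c ` {0..1})"
    by (simp add: finite_image_iff infinite_Icc)
  ultimately show ?thesis using finite_subset by blast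
qed

text \<open>After moving \<open>B\<close> into a great circle, the reflection in that circle corrects the degree.\<close>

lemma realize_permutation:
  assumes B: "finite B" "B \<subseteq> S2" and \<sigma>: "bij_betw \<sigma> B B"
  obtains f where "f \<in> marked_homeos B" "\<And>b. b \<in> B \<Longrightarrow> f b = \<sigma> b"
proof -
  have \<sigma>B: "\<sigma> ` B = B" "inj_on \<sigma> B" using \<sigma> by (auto simp: bij_betw_def)
  have "\<sigma> ` B \<subseteq> S2" using \<sigma>B(1) B(2) by simp
  then obtain f f' where f: "homeomorphism S2 S2 f f'" "\<forall>b\<in>B. f b = \<sigma> b"
    using realize_injection [OF B _ \<sigma>B(2)] by metis
  obtain C where C: "C \<subseteq> {x \<in> S2. x 0 = 0}" "finite C" "card C = card B"
    using infinite_arbitrarily_large [OF infinite_equator, of "card B"] by blast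
  obtain \<tau> where \<tau>: "bij_betw \<tau> B C" using finite_same_card_bij [OF B(1) C(2)] C(3) by auto
  have "\<tau> ` B \<subseteq> S2" "inj_on \<tau> B" using \<tau> C(1) by (auto simp: bij_betw_def)
  then obtain h h' where h: "homeomorphism S2 S2 h h'" "\<forall>b\<in>B. h b = \<tau> b"
    using realize_injection [OF B] by metis
  have h': "homeomorphism S2 S2 h' h" by (rule homeomorphism_symD [OF h(1)])
  have dh: "deg h' * deg h = 1"
  proof -
    have "deg (\<lambda>x. h' (h x)) = 1"
    proof -
      have "homotopic_with (\<lambda>_. True) (nsphere 2) (nsphere 2) id (\<lambda>x. h' (h x))"
      proof (rule homotopic_with_equal)
        show "continuous_map (nsphere 2) (nsphere 2) id" by simp
        show "id x = h' (h x)" if "x \<in> topspace (nsphere 2)" for x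
          using homeomorphism_apply1 [OF h(1) that] by simp
      qed auto
      then show ?thesis using Brouwer_degree2_homotopic by (metis Brouwer_degree2_id)
    qed
    then show ?thesis using deg_compose [OF h(1) h'] by simp
  qed
  define r where "r x = h' (refl0 (h x))" for x
  have r: "homeomorphism S2 S2 r (\<lambda>x. h' (refl0 (h x)))"
    unfolding r_def
    using homeomorphism_compose_S2 [OF homeomorphism_compose_S2 [OF h(1) refl0(1)] h'] by simp
  have dr: "deg r = -1"
  proof -
    have "deg r = deg h' * (deg refl0 * deg h)"
      unfolding r_def
      using deg_compose [OF homeomorphism_compose_S2 [OF h(1) refl0(1)] h'] deg_compose [OF h(1) refl0(1)] by simp
    then show ?thesis using dh refl0(2) by (simp add: mult.commute)
  qed
  have rB: "r b = b" if b: "b \<in> B" for b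
  proof -
    have "h b \<in> C" using h(2) \<tau> b by (auto simp: bij_betw_def)
    then have "(h b) 0 = 0" using C(1) by blast
    then have "refl0 (h b) = h b" by (simp add: refl0_def fun_eq_iff)
    then show ?thesis using homeomorphism_apply1 [OF h(1)] b B(2) by (auto simp: r_def)
  qed
  show thesis
  proof (cases "deg f = 1")
    case True
    have "f ` B = B" using f(2) \<sigma>B(1) by (metis image_cong)
    then show thesis using that [of f] f True marked_homeos_iff by blast
  next
    case False
    then have "deg f = -1" using deg_homeo [OF f(1)] by auto
    then have d: "deg (\<lambda>x. r (f x)) = 1" using deg_compose [OF f(1) r] dr by simp
    have v: "r (f b) = \<sigma> b" if "b \<in> B" for b
      using rB [of "\<sigma> b"] f(2) that \<sigma>B(1) that by auto
    then have "(\<lambda>x. r (f x)) ` B = B" using \<sigma>B(1) by (metis image_cong)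
    then show thesis
      using that [of "\<lambda>x. r (f x)"] v d homeomorphism_compose_S2 [OF f(1) r] marked_homeos_iff by blast
  qed
qed

section \<open>Jordan curves permuted by a rotation\<close>

definition om :: "nat \<Rightarrow> complex" where "om k = cis (2 * pi / real k)"

lemma norm_om [simp]: "cmod (om k ^ d) = 1" "cmod (om k) = 1"
  by (simp_all add: om_def norm_power)

lemma om_nz [simp]: "om k \<noteq> 0"
  using norm_om(2) [of k] by (metis norm_zero zero_neq_one)

lemma om_power_eq_1_iff: "k > 0 \<Longrightarrow> om k ^ d = 1 \<longleftrightarrow> k dvd d"
proof -
  assume k: "k > 0"
  have "om k ^ d = cis (2 * pi * (real d / real k))"
    by (simp add: om_def Complex.DeMoivre mult_ac)
  moreover have "cis (2 * pi * (real d / real k)) = 1 \<longleftrightarrow> real d / real k \<in> \<int>"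
  proof -
    have "cis (2 * pi * x) = 1 \<longleftrightarrow> x \<in> \<int>" for x
    proof
      assume "cis (2 * pi * x) = 1"
      then have "cos (2 * pi * x) = 1" by (simp add: complex_eq_iff)
      then obtain n :: int where "2 * pi * x = of_int n * 2 * pi"
        using cos_one_2pi_int by auto
      then have "x = of_int n" by simp
      then show "x \<in> \<int>" by simp
    next
      assume "x \<in> \<int>"
      then show "cis (2 * pi * x) = 1" by (rule cis_multiple_2pi)
    qed
    then show ?thesis .
  qed
  moreover have "real d / real k \<in> \<int> \<longleftrightarrow> k dvd d"
  proof
    assume "real d / real k \<in> \<int>"
    then obtain n :: int where "real d / real k = of_int n" by (auto elim: Ints_cases)
    then have "real d = of_int n * real k" using k by (simp add: field_simps)
    then have "int d = n * int k" by (metis of_int_eq_iff of_int_mult of_int_of_nat_eq)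
    then have "int k dvd int d" by simp
    then show "k dvd d" by simp
  next
    assume "k dvd d"
    then obtain c where "d = k * c" by blast
    then show "real d / real k \<in> \<int>" using k by simp
  qed
  ultimately show ?thesis by simp
qed

lemma om_power_self [simp]: "om k ^ k = 1"
  by (cases "k = 0") (simp_all add: om_power_eq_1_iff)

lemma om_power_mod: "om k ^ (d mod k) = om k ^ d"
proof -
  have "om k ^ d = om k ^ (k * (d div k) + d mod k)" by simp
  also have "\<dots> = (om k ^ k) ^ (d div k) * om k ^ (d mod k)"
    by (simp only: power_add power_mult)
  finally show ?thesis by simp
qed

text \<open>Without a fixed point the continuous function \<open>f x - x\<close> keeps one sign, so
  the iterates of 0 move strictly in one direction and never return.\<close>

lemma fixed_point_of_periodic:
  fixes f :: "real \<Rightarrow> real"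
  assumes f: "continuous_on UNIV f" and k: "k > 0" "\<And>x. (f ^^ k) x = x"
  obtains x where "f x = x"
proof (rule ccontr)
  assume neq: "\<not> thesis"
  have ne: "f x \<noteq> x" for x using neq that by blast
  have con: "connected (range (\<lambda>x. f x - x))"
    by (intro connected_continuous_image continuous_intros f) auto
  have same: "(f x > x) = (f y > y)" for x y
  proof (rule ccontr)
    assume "(f x > x) \<noteq> (f y > y)"
    then obtain a b where "f a > a" "f b < b"
      using ne [of x] ne [of y] by (metis linorder_neqE_linordered_idom)
    then have "f b - b \<le> 0" "0 \<le> f a - a" by auto
    then have "0 \<in> range (\<lambda>x. f x - x)"
      using connectedD_interval [OF con, of "f b - b" "f a - a" 0] by blast
    then show False using ne by auto
  qed
  show False
  proof (cases "f 0 > 0")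
    case True
    then have gt: "f x > x" for x using same by blast
    have "(f ^^ Suc j) 0 > 0" for j
      by (induction j) (use gt in \<open>auto intro: less_trans\<close>)
    then show False using k by (metis gr0_implies_Suc less_irrefl)
  next
    case False
    then have lt: "f x < x" for x using same ne by (metis linorder_neqE_linordered_idom)
    have "(f ^^ Suc j) 0 < 0" for j
      by (induction j) (use lt in \<open>auto intro: less_trans\<close>)
    then show False using k by (metis gr0_implies_Suc less_irrefl)
  qed
qed

lemma jordan_minus_point:
  assumes "jordan_curve K" "x \<in> K"
  shows "(K - {x}) homeomorphic (UNIV :: real set)"
proof -
  obtain \<gamma> where \<gamma>: "simple_path \<gamma>" "pathfinish \<gamma> = pathstart \<gamma>" "path_image \<gamma> = K"
    using assms by (auto simp: jordan_curve_def)
  have "K homeomorphic (sphere 0 1 :: complex set)"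
    using homeomorphic_simple_path_image_circle [OF \<gamma>(1,2), of 1 0] \<gamma>(3) by simp
  then obtain f g where fg: "homeomorphism K (sphere 0 1 :: complex set) f g"
    by (auto simp: homeomorphic_def)
  have inj: "inj_on f K" using homeomorphism_apply1 [OF fg] by (rule inj_on_inverseI)
  have "f ` (K - {x}) = f ` K - f ` {x}"
    by (rule inj_on_image_set_diff [OF inj]) (use assms in auto)
  then have im: "f ` (K - {x}) = sphere 0 1 - {f x}"
    using homeomorphism_image1 [OF fg] by simp
  have "homeomorphism (K - {x}) (sphere 0 1 - {f x}) f g"
    by (rule homeomorphism_of_subsets [OF fg _ _ im]) auto
  then have "(K - {x}) homeomorphic (sphere (0::complex) 1 - {f x})" by (auto simp: homeomorphic_def)
  also have "\<dots> homeomorphic {v::complex. 1 \<bullet> v = 0}"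
    by (rule homeomorphic_punctured_sphere_hyperplane)
      (use homeomorphism_image1 [OF fg] assms in auto)
  also have "{v::complex. 1 \<bullet> v = 0} homeomorphic (UNIV :: real set)"
  proof (rule homeomorphic_affine_sets)
    show "affine {v::complex. 1 \<bullet> v = 0}" by (rule affine_hyperplane)
    show "aff_dim {v::complex. 1 \<bullet> v = 0} = aff_dim (UNIV :: real set)"
      using aff_dim_hyperplane [of "1::complex" 0] by simp
  qed auto
  finally show ?thesis .
qed

lemma jordan_minus_point_connected:
  assumes "jordan_curve K" shows "connected (K - {x})"
proof (cases "x \<in> K")
  case True
  then show ?thesis
    using jordan_minus_point [OF assms] homeomorphic_connectedness connected_UNIV by blast
next
  case False
  then show ?thesis using jordan_curve_facts(2) [OF assms] by simp
qed

text \<open>A Jordan curve minus a point is a line. The rotation acts on it with finite period,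
  hence has a fixed point: a nonzero \<open>w\<close> with \<open>u w = w\<close>, against
  \<open>u \<noteq> 1\<close>.\<close>

lemma no_rotation_through_0:
  assumes K: "jordan_curve K" "0 \<in> K" and u: "(\<lambda>w. u * w) ` K = K" "u ^ k = 1" "k > 0" "u \<noteq> 1"
  shows False
proof -
  obtain f g where fg: "homeomorphism (K - {0}) (UNIV :: real set) f g"
    using jordan_minus_point [OF K] by (auto simp: homeomorphic_def)
  have u0: "u \<noteq> 0" using u(2,3) by (metis power_0_left less_irrefl zero_neq_one)
  have gK: "g s \<in> K - {0}" for s using homeomorphism_image2 [OF fg] by blast
  have uK: "u * w \<in> K - {0}" if "w \<in> K - {0}" for w
    using u(1) u0 that by auto
  define h where "h s = f (u * g s)" for s
  have "continuous_on UNIV h"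
  proof -
    have "continuous_on UNIV (\<lambda>s. u * g s)"
      using fg by (intro continuous_intros) (simp add: homeomorphism_def)
    moreover have "continuous_on (K - {0}) f" using fg by (simp add: homeomorphism_def)
    ultimately show ?thesis
      unfolding h_def using uK [OF gK] by (intro continuous_on_compose2 [of "K - {0}" f UNIV]) auto
  qed
  moreover have "(h ^^ j) s = f (u ^ j * g s)" for j s
  proof (induction j)
    case 0
    show ?case using homeomorphism_apply2 [OF fg] by simp
  next
    case (Suc j)
    have "u ^ j * g s \<in> K - {0}" for j
      by (induction j) (use gK uK in \<open>auto simp: mult.assoc\<close>)
    then have "g (f (u ^ j * g s)) = u ^ j * g s" using homeomorphism_apply1 [OF fg] by blast
    then show ?case using Suc by (simp add: h_def mult.assoc)
  qed
  then have "(h ^^ k) s = s" for s using homeomorphism_apply2 [OF fg] u(2) by simp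
  ultimately obtain s where "h s = s" using fixed_point_of_periodic [OF _ u(3)] by blast
  then have "g (f (u * g s)) = g s" by (simp add: h_def)
  then have "u * g s = g s" using homeomorphism_apply1 [OF fg] uK [OF gK] by simp
  then show False using gK u(4) by simp
qed

text \<open>Convexity gives only the closed ball; as the inside is open, the ball can be taken open.
  This strictness keeps points of maximal modulus out of the inside.\<close>

lemma inside_subset_ball:
  assumes K: "jordan_curve K" and M: "\<And>w. w \<in> K \<Longrightarrow> cmod w \<le> M"
  shows "inside K \<subseteq> ball 0 M"
proof -
  have "- cball 0 M \<subseteq> outside K"
    by (rule outside_subset_convex) (use M in auto)
  then have "inside K \<subseteq> cball 0 M"
    using inside_Int_outside [of K] by blast
  then have "interior (inside K) \<subseteq> interior (cball 0 M)" by (rule interior_mono)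
  then show ?thesis
    using jordan_curve_facts(5) [OF K] by (simp add: interior_open)
qed

lemma connected_subset_outside:
  assumes K: "jordan_curve K" and "connected U" "U \<inter> K = {}" "U \<inter> outside K \<noteq> {}"
  shows "U \<subseteq> outside K"
proof -
  have "U \<subseteq> inside K \<union> outside K" using jordan_curve_facts(10) [OF K] assms(3) by blast
  moreover have "open (inside K)" "open (outside K)" using jordan_curve_facts(5,8) [OF K] by auto
  moreover have "inside K \<inter> outside K \<inter> U = {}" using inside_Int_outside by blast
  ultimately have "inside K \<inter> U = {} \<or> outside K \<inter> U = {}"
    using assms(2) by (intro connectedD) auto
  then have "inside K \<inter> U = {}" using assms(4) by blast
  then show ?thesis using jordan_curve_facts(10) [OF K] assms(3) by blast
qed

lemma connected_subset_inside:
  assumes K: "jordan_curve K" and "connected U" "U \<inter> K = {}" "U \<inter> inside K \<noteq> {}"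
  shows "U \<subseteq> inside K"
proof -
  have "U \<inter> outside K = {}"
    using connected_subset_outside [OF assms(1-3)] assms(4) inside_Int_outside by blast
  then show ?thesis using jordan_curve_facts(10) [OF K] assms(3) by blast
qed

text \<open>The curves \<open>A\<close> and \<open>u A\<close> have the same greatest distance from the origin, so that
  neither can lie inside the other.\<close>

lemma rotated_curve_outside:
  assumes A: "jordan_curve A" "jordan_curve ((\<lambda>w. u * w) ` A)" and u: "cmod u = 1"
    and disj: "A \<inter> (\<lambda>w. u * w) ` A \<subseteq> {0}"
  shows "(\<lambda>w. u * w) ` A - {0} \<subseteq> outside A"
    "\<exists>v\<in>A - {0}. \<forall>w\<in>A. cmod w \<le> cmod v"
proof -
  let ?B = "(\<lambda>w. u * w) ` A"
  have "compact (cmod ` A)" "cmod ` A \<noteq> {}"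
    using jordan_curve_facts(1,3) [OF A(1)] by (auto intro!: compact_continuous_image continuous_intros)
  then obtain v where v: "v \<in> A" "\<And>w. w \<in> A \<Longrightarrow> cmod w \<le> cmod v"
    using compact_attains_sup [of "cmod ` A"] by auto
  have ins: "inside A \<subseteq> ball 0 (cmod v)" by (rule inside_subset_ball [OF A(1) v(2)])
  have "v \<noteq> 0" using ins jordan_curve_facts(4) [OF A(1)] by auto
  then show "\<exists>v\<in>A - {0}. \<forall>w\<in>A. cmod w \<le> cmod v" using v by blast
  have uv: "u * v \<in> ?B - {0}" using v \<open>v \<noteq> 0\<close> u by auto
  moreover have "u * v \<notin> inside A" using ins u by (auto simp: norm_mult)
  moreover have "(?B - {0}) \<inter> A = {}" using disj by blast
  ultimately have "u * v \<in> outside A" using jordan_curve_facts(10) [OF A(1)] by blast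
  then show "?B - {0} \<subseteq> outside A"
    using uv \<open>(?B - {0}) \<inter> A = {}\<close>
    by (intro connected_subset_outside [OF A(1) jordan_minus_point_connected [OF A(2)]]) auto
qed

section \<open>Insides of rotated curves\<close>

lemma jordan_rotate: "u \<noteq> 0 \<Longrightarrow> jordan_curve A \<Longrightarrow> jordan_curve ((\<lambda>w. u * w) ` A)"
  by (rule jordan_curve_image) (auto intro!: continuous_intros inj_onI)

text \<open>Expresses insideness through logarithms, a form that passes through multiplication by
  \<open>u\<close> without any discussion of components.\<close>

lemma inside_iff_essential:
  assumes "jordan_curve K"
  shows "c \<in> inside K \<longleftrightarrow> c \<notin> K \<and> \<not> logeq K (\<lambda>w. w - c) (\<lambda>_. 1)"
proof
  assume c: "c \<in> inside K"
  have "\<not> logeq K (\<lambda>w. w - c) (\<lambda>_. 1)"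
    using jordan_powi_trivial [OF assms c, of 1] by auto
  then show "c \<notin> K \<and> \<not> logeq K (\<lambda>w. w - c) (\<lambda>_. 1)"
    using c by (auto simp: inside_def)
next
  assume c: "c \<notin> K \<and> \<not> logeq K (\<lambda>w. w - c) (\<lambda>_. 1)"
  then have "c \<notin> outside K"
    using logeq_outside [OF jordan_curve_facts(1,9) [OF assms]] by blast
  then show "c \<in> inside K" using c jordan_curve_facts(10) [OF assms] by blast
qed

lemma inside_rotate:
  assumes u: "u \<noteq> 0" and K: "jordan_curve K" and c: "c \<in> inside K"
  shows "u * c \<in> inside ((\<lambda>w. u * w) ` K)"
proof -
  let ?D = "(\<lambda>w. u * w) ` K"
  have D: "jordan_curve ?D" by (rule jordan_rotate [OF u K])
  have "logeq K (\<lambda>w. w - c) (\<lambda>_. 1)" if "logeq ?D (\<lambda>w. w - u * c) (\<lambda>_. 1)"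
  proof -
    have "logeq K (\<lambda>w. u * w - u * c) (\<lambda>_. 1)"
      by (rule logeq_compose [OF that]) (auto intro!: continuous_intros)
    then have "logeq K (\<lambda>w. inverse u * (u * w - u * c)) (\<lambda>_. 1 * 1)"
      by (intro logeq_mult logeq_const) (use u in auto)
    then show ?thesis using u by (simp add: algebra_simps)
  qed
  moreover have "u * c \<notin> ?D" using c u by (auto simp: inside_def)
  ultimately show ?thesis using inside_iff_essential [OF D] inside_iff_essential [OF K] c by blast
qed

text \<open>If the insides met, the inside of \<open>A\<close>, being connected and disjoint from
  the rotated curve, would lie in the inside of that curve. Taking closures, \<open>A\<close> would
  lie in that inside or on the curve; but \<open>A\<close> has points outside the rotated
  curve.\<close>

lemma rotated_inside_disjoint:
  assumes A: "jordan_curve A" and u: "cmod u = 1" and disj: "A \<inter> (\<lambda>w. u * w) ` A \<subseteq> {0}"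
  shows "inside A \<inter> (\<lambda>w. u * w) ` A = {}" "inside A \<inter> inside ((\<lambda>w. u * w) ` A) = {}"
proof -
  let ?B = "(\<lambda>w. u * w) ` A"
  have u0: "u \<noteq> 0" using u by auto
  have B: "jordan_curve ?B" by (rule jordan_rotate [OF u0 A])
  note out = rotated_curve_outside(1) [OF A B u disj]
  have "inside A \<inter> A = {}" by (auto simp: inside_def)
  moreover have "0 \<in> A" if "0 \<in> ?B" using u0 that by auto
  moreover have "x \<in> outside A" if "x \<in> ?B" "x \<noteq> 0" for x using out that by (metis DiffI singletonD subsetD)
  ultimately show iB: "inside A \<inter> ?B = {}"
    using inside_Int_outside [of A] by (metis disjoint_iff)
  have A_eq: "(\<lambda>w. inverse u * w) ` ?B = A"
    using u0 by (simp add: image_image flip: mult.assoc)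
  have "A - {0} \<subseteq> outside ?B"
  proof -
    have "(\<lambda>w. inverse u * w) ` ?B - {0} \<subseteq> outside ?B"
    proof (rule rotated_curve_outside(1))
      show "cmod (inverse u) = 1" using u by (simp add: norm_inverse)
    qed (use A B A_eq disj in auto)
    then show ?thesis using A_eq by simp
  qed
  moreover obtain v where v: "v \<in> A - {0}"
    using rotated_curve_outside(2) [OF A B u disj] by blast
  ultimately have vo: "v \<in> outside ?B" by blast
  show "inside A \<inter> inside ?B = {}"
  proof (rule ccontr)
    assume ne: "inside A \<inter> inside ?B \<noteq> {}"
    have "inside A \<subseteq> inside ?B"
      by (rule connected_subset_inside [OF B jordan_curve_facts(6) [OF A] iB ne])
    then have "closure (inside A) \<subseteq> closure (inside ?B)" by (rule closure_mono)
    moreover have "A \<subseteq> closure (inside A)"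
      using jordan_curve_facts(11) [OF A] by (auto simp: frontier_def)
    moreover have "closure (inside ?B) \<subseteq> inside ?B \<union> ?B"
      using jordan_curve_facts(11) [OF B] closure_Un_frontier [of "inside ?B"] by blast
    ultimately have "v \<in> inside ?B \<union> ?B" using v by blast
    then show False using vo inside_Int_outside [of ?B] by (auto simp: outside_def)
  qed
qed

text \<open>The shape of the slices at all heights in \<open>[2m - 1, 2m]\<close>, roses included.\<close>

definition rosette :: "nat \<Rightarrow> complex set \<Rightarrow> complex set \<Rightarrow> bool" where
  "rosette k K R \<longleftrightarrow> jordan_curve K \<and> R = (\<Union>d<k. (\<lambda>w. om k ^ d * w) ` K) \<and>
     (\<forall>d. 0 < d \<longrightarrow> d < k \<longrightarrow> K \<inter> (\<lambda>w. om k ^ d * w) ` K \<subseteq> {0})"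

text \<open>Serves to isolate one factor in a product of \<open>w - om k ^ d * c\<close> over
  \<open>d\<close>: along \<open>K\<close> all factors with \<open>d > 0\<close> have
  logarithms.\<close>

lemma rosette_outside:
  assumes R: "rosette k K R" and c: "c \<in> inside K" and d: "0 < d" "d < k"
  shows "om k ^ d * c \<in> outside K"
proof -
  let ?u = "om k ^ d"
  let ?B = "(\<lambda>w. ?u * w) ` K"
  have K: "jordan_curve K" and disj: "K \<inter> ?B \<subseteq> {0}"
    using R d by (auto simp: rosette_def)
  have iu: "om k ^ (k - d) * om k ^ d = 1" using d by (simp flip: power_add)
  let ?v = "om k ^ (k - d)"
  let ?D = "(\<lambda>w. ?v * w) ` K"
  have disj': "K \<inter> ?D \<subseteq> {0}" using R d by (auto simp: rosette_def)
  have "?u * c \<notin> K"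
  proof
    assume "?u * c \<in> K"
    then have "?v * (?u * c) \<in> ?D" by blast
    then have "c \<in> ?D" using iu by (simp flip: mult.assoc)
    then show False using rotated_inside_disjoint(1) [OF K _ disj'] c by auto
  qed
  moreover have "?u * c \<notin> inside K"
  proof
    assume i: "?u * c \<in> inside K"
    have "?v * (?u * c) \<in> inside ?D"
      by (rule inside_rotate [OF _ K i]) simp
    then have "c \<in> inside ?D" using iu by (simp flip: mult.assoc)
    then show False using rotated_inside_disjoint(2) [OF K _ disj'] c by auto
  qed
  ultimately show ?thesis using jordan_curve_facts(10) [OF K] by blast
qed

text \<open>A logarithm of the identity would increase by a constant
  \<open>s = 2 pi i (n + 1 / k)\<close> under the rotation. After \<open>k\<close> rotations the
  point returns, so \<open>k s = 0\<close>, that is \<open>n k = -1\<close>, which is impossible for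
  \<open>k \<ge> 2\<close>.\<close>

lemma rotation_essential:
  assumes K: "connected K" "K \<noteq> {}" "(\<lambda>w. om k * w) ` K = K" and k: "k \<ge> 2"
  shows "\<not> logeq K (\<lambda>w. w) (\<lambda>_. 1)"
proof
  assume "logeq K (\<lambda>w. w) (\<lambda>_. 1)"
  then obtain l where l: "continuous_on K l" "\<And>w. w \<in> K \<Longrightarrow> w = exp (l w)"
    by (rule logeq_log) blast
  have rot: "om k * w \<in> K" if "w \<in> K" for w using K(3) that by blast
  let ?p = "2 * of_real pi * \<i> :: complex"
  have om: "om k = exp (?p / of_nat k)" by (simp add: om_def cis_conv_exp mult_ac)
  obtain n :: int where n: "\<And>w. w \<in> K \<Longrightarrow> l (om k * w) - l w - ?p / of_nat k = of_int n * ?p"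
  proof (rule exp_eq_1_imp_constant [OF K(1), of "\<lambda>w. l (om k * w) - l w - ?p / of_nat k"])
    show "continuous_on K (\<lambda>w. l (om k * w) - l w - ?p / of_nat k)"
      by (intro continuous_intros l(1) continuous_on_compose2 [OF l(1)]) (use rot in auto)
    show "exp (l (om k * w) - l w - ?p / of_nat k) = 1" if w: "w \<in> K" for w
    proof -
      have e: "exp (l (om k * w)) = om k * w" "exp (l w) = w" using l(2) rot w by metis+
      have "w \<noteq> 0" using e(2) exp_not_eq_zero by metis
      then show ?thesis by (simp add: exp_diff e flip: om)
    qed
  qed blast
  obtain w where w: "w \<in> K" using K(2) by blast
  define s where "s = of_int n * ?p + ?p / of_nat k"
  have step: "l (om k * w) = l w + s" if "w \<in> K" for w
    using n [OF that] by (simp add: s_def algebra_simps)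
  have "om k ^ j * w \<in> K \<and> l (om k ^ j * w) = l w + of_nat j * s" for j
  proof (induction j)
    case (Suc j)
    then have "l (om k * (om k ^ j * w)) = l (om k ^ j * w) + s" "om k * (om k ^ j * w) \<in> K"
      using step rot by blast+
    then show ?case using Suc by (simp add: algebra_simps)
  qed (use w in simp)
  from this [of k] have "of_nat k * s = 0" by simp
  moreover have "of_nat k * s = of_int (int k * n + 1) * ?p"
  proof -
    have kz: "of_nat k \<noteq> (0::complex)" using k by simp
    have "of_nat k * s = of_nat k * of_int n * ?p + of_nat k * (?p / of_nat k)"
      by (simp only: s_def distrib_left mult.assoc)
    also have "of_nat k * (?p / of_nat k) = ?p" using kz by simp
    finally show ?thesis by (simp add: distrib_right)
  qed
  ultimately have "(of_int (int k * n + 1) :: complex) * ?p = 0" by simp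
  then have "(of_int (int k * n + 1) :: complex) = 0" by simp
  then have "int k * n + 1 = 0" by (simp only: of_int_eq_0_iff)
  then have "int k * (- n) = 1" by simp
  then show False using k by (metis int_one_le_iff_zero_less nat_dvd_1_iff_1 dvdI int_dvd_int_iff of_nat_1 numeral_le_one_iff semiring_norm(69))
qed

lemma rotation_inside_0:
  assumes K: "jordan_curve K" "(\<lambda>w. om k * w) ` K = K" and k: "k \<ge> 2"
  shows "0 \<in> inside K"
proof -
  have "0 \<notin> K"
  proof
    assume "0 \<in> K"
    then show False
      using no_rotation_through_0 [OF K(1) _ K(2) om_power_self] om_power_eq_1_iff [of k 1] k by auto
  qed
  moreover have "\<not> logeq K (\<lambda>w. w) (\<lambda>_. 1)"
    by (rule rotation_essential [OF jordan_curve_facts(2,3) [OF K(1)] K(2) k])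
  ultimately show ?thesis by (simp add: inside_iff_essential [OF K(1)])
qed

lemma rotation_inside_iff:
  assumes K: "jordan_curve K" "(\<lambda>w. om k * w) ` K = K" and k: "k \<ge> 2"
  shows "om k ^ d * c \<in> inside K \<longleftrightarrow> c \<in> inside K"
proof -
  have step: "om k * c \<in> inside K" if "c \<in> inside K" for c
    using inside_rotate [OF om_nz K(1) that, of k] K(2) by simp
  have up: "om k ^ d * c \<in> inside K" if "c \<in> inside K" for c d
    by (induction d) (use that step in \<open>auto simp: mult.assoc\<close>)
  have "c \<in> inside K" if "om k ^ d * c \<in> inside K"
  proof -
    have "om k ^ ((k - 1) * d) * (om k ^ d * c) \<in> inside K" by (rule up [OF that])
    moreover have "om k ^ ((k - 1) * d) * om k ^ d = 1"
    proof -
      have "(k - 1) * d + d = k * d" using k by (cases k) auto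
      then have "om k ^ ((k - 1) * d) * om k ^ d = (om k ^ k) ^ d"
        by (simp only: power_add [symmetric] power_mult [symmetric])
      then show ?thesis by simp
    qed
    ultimately show ?thesis by (simp flip: mult.assoc)
  qed
  then show ?thesis using up by blast
qed

text \<open>Invariance of a rose does not say how its petals are permuted. Away from 0 each petal is
  a connected piece, so rotations permute the petals; by \<open>no_rotation_through_0\<close> no
  nontrivial rotation preserves \<open>P 0\<close>, so its \<open>k\<close> rotates are distinct and
  exhaust the \<open>k\<close> petals.\<close>

lemma rose_rosette:
  assumes P: "\<And>d. d < k \<Longrightarrow> jordan_curve (P d)" "\<And>d. d < k \<Longrightarrow> 0 \<in> P d"
    "\<And>d e. d < k \<Longrightarrow> e < k \<Longrightarrow> d \<noteq> e \<Longrightarrow> P d \<inter> P e = {0}"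
    and R: "R = (\<Union>d<k. P d)" "(\<lambda>w. om k * w) ` R = R" and k: "k \<ge> 2"
  shows "rosette k (P 0) R"
proof -
  let ?r = "\<lambda>i A. (\<lambda>w. om k ^ i * w) ` A"
  have rotR: "?r i R = R" for i
  proof (induction i)
    case (Suc i)
    have "?r (Suc i) R = (\<lambda>w. om k * w) ` ?r i R" by (simp add: image_image mult.assoc)
    then show ?case using Suc R(2) by simp
  qed simp
  have cl: "closed (P d)" if "d < k" for d
    using jordan_curve_facts(1) [OF P(1) [OF that]] compact_imp_closed by blast
  have ne: "P d - {0} \<noteq> {}" if "d < k" for d
  proof
    assume "P d - {0} = {}"
    then have "inside (P d) = {}"
      using inside_subset_ball [OF P(1) [OF that], of 0] by auto
    then show False using jordan_curve_facts(4) [OF P(1) [OF that]] by blast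
  qed
  \<comment> \<open>One petal and the union of the others are closed and meet only at 0, so a
    connected subset of the rose that avoids 0 stays in one petal.\<close>
  have sub: "\<exists>e<k. A - {0} \<subseteq> P e" if A: "connected (A - {0})" "A - {0} \<noteq> {}" "A \<subseteq> R" for A
  proof -
    obtain w where w: "w \<in> A - {0}" using A(2) by blast
    then obtain e where e: "e < k" "w \<in> P e" using A(3) R(1) by blast
    let ?Q = "\<Union>d\<in>{..<k} - {e}. P d"
    have "closed ?Q" by (intro closed_UN) (use cl in auto)
    moreover have "P e \<inter> ?Q \<inter> (A - {0}) = {}"
    proof -
      have "x = 0" if "x \<in> P e" "x \<in> P d" "d \<in> {..<k} - {e}" for x d
        using P(3) [of e d] e(1) that by auto
      then show ?thesis by blast
    qed
    moreover have "A - {0} \<subseteq> P e \<union> ?Q" using A(3) R(1) e(1) by auto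
    ultimately have "P e \<inter> (A - {0}) = {} \<or> ?Q \<inter> (A - {0}) = {}"
      by (intro connected_closedD [OF A(1) _ _ cl [OF e(1)]])
    then have "?Q \<inter> (A - {0}) = {}" using w e by blast
    then have "A - {0} \<subseteq> P e" using \<open>A - {0} \<subseteq> P e \<union> ?Q\<close> by blast
    then show ?thesis using e(1) by blast
  qed
  have P0: "jordan_curve (P 0)" "0 \<in> P 0" using P k by auto
  have rJ: "jordan_curve (?r i (P d))" if "d < k" for i d
    by (rule jordan_rotate [OF _ P(1) [OF that]]) simp
  have nr: "?r i (P d) - {0} \<noteq> {}" if "d < k" for i d
    using ne [OF that] by auto
  have inR: "?r i (P d) \<subseteq> R" if "d < k" for i d
  proof -
    have "?r i (P d) \<subseteq> ?r i R" using R(1) that by (intro image_mono) auto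
    then show ?thesis using rotR by simp
  qed
  have petal: "\<exists>e<k. ?r i (P 0) = P e" if i: "i \<le> k" for i
  proof -
    have k0: "0 < k" using k by simp
    obtain e where e: "e < k" "?r i (P 0) - {0} \<subseteq> P e"
      using sub [OF jordan_minus_point_connected [OF rJ [OF k0]] nr [OF k0] inR [OF k0]] by blast
    \<comment> \<open>Rotating back by the remaining \<open>k - i\<close> steps shows that the
      rotate of \<open>P 0\<close> fills the petal it lands in.\<close>
    obtain e' where e': "e' < k" "?r (k - i) (P e) - {0} \<subseteq> P e'"
      using sub [OF jordan_minus_point_connected [OF rJ [OF e(1)]] nr [OF e(1)] inR [OF e(1)]] by blast
    have inv: "om k ^ (k - i) * (om k ^ i * w) = w" "om k ^ i * (om k ^ (k - i) * w) = w" for w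
      using i by (simp_all flip: mult.assoc power_add)
    obtain w where w: "w \<in> P 0 - {0}" using ne [OF k0] by blast
    then have "om k ^ i * w \<in> P e" using e(2) by auto
    then have "om k ^ (k - i) * (om k ^ i * w) \<in> ?r (k - i) (P e)" by (rule imageI)
    then have "w \<in> P e'" using e'(2) w inv(1) by auto
    then have "e' = 0" using P(3) [OF e'(1) k0] w by blast
    have "P e \<subseteq> ?r i (P 0)"
    proof
      fix v assume v: "v \<in> P e"
      show "v \<in> ?r i (P 0)"
      proof (cases "v = 0")
        case True
        then show ?thesis using P0(2) by force
      next
        case False
        then have "om k ^ (k - i) * v \<in> P 0" using e'(2) v \<open>e' = 0\<close> by auto
        then have "om k ^ i * (om k ^ (k - i) * v) \<in> ?r i (P 0)" by (rule imageI)
        then show ?thesis using inv(2) by simp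
      qed
    qed
    moreover have "?r i (P 0) \<subseteq> P e"
    proof
      fix v assume "v \<in> ?r i (P 0)"
      then show "v \<in> P e" using e(2) P(2) [OF e(1)] by (cases "v = 0") auto
    qed
    ultimately have "?r i (P 0) = P e" by (rule equalityI [rotated])
    then show ?thesis using e(1) by (intro exI [of _ e] conjI)
  qed
  define \<pi> where "\<pi> i = (SOME e. e < k \<and> ?r i (P 0) = P e)" for i
  have \<pi>: "\<pi> i < k \<and> ?r i (P 0) = P (\<pi> i)" if "i \<le> k" for i
    unfolding \<pi>_def by (rule someI_ex) (rule petal [OF that])
  have free: "?r i (P 0) \<noteq> P 0" if "0 < i" "i < k" for i
  proof
    assume "?r i (P 0) = P 0"
    moreover have "(om k ^ i) ^ k = 1" by (metis om_power_self power_mult mult.commute power_one)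
    moreover have "om k ^ i \<noteq> 1" using that by (simp add: om_power_eq_1_iff nat_dvd_not_less)
    ultimately show False using no_rotation_through_0 [OF P0] k by (meson less_le_trans pos2)
  qed
  have inj: "inj_on \<pi> {..<k}"
  proof (rule linorder_inj_onI)
    fix i j assume ij: "i < j" "i \<in> {..<k}" "j \<in> {..<k}"
    show "\<pi> i \<noteq> \<pi> j"
    proof
      assume "\<pi> i = \<pi> j"
      then have "?r i (P 0) = ?r j (P 0)" using \<pi> [of i] \<pi> [of j] ij by simp
      then have "?r (k - i) (?r i (P 0)) = ?r (k - i) (?r j (P 0))" by simp
      moreover have "?r (k - i) (?r i (P 0)) = P 0"
        using ij by (simp add: image_image flip: mult.assoc power_add)
      moreover have "om k ^ (k - i) * om k ^ j = om k ^ (j - i)"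
      proof -
        have "om k ^ (k - i) * om k ^ j = om k ^ (k + (j - i))" using ij by (simp flip: power_add)
        then show ?thesis by (simp add: power_add)
      qed
      then have "?r (k - i) (?r j (P 0)) = ?r (j - i) (P 0)"
        by (simp add: image_image flip: mult.assoc)
      ultimately have "?r (j - i) (P 0) = P 0" by simp
      moreover have "0 < j - i" "j - i < k" using ij by (simp_all add: less_imp_diff_less)
      ultimately show False using free by blast
    qed
  qed auto
  have surj: "\<pi> ` {..<k} = {..<k}"
    by (rule card_subset_eq) (use \<pi> inj card_image [OF inj] in auto)
  have "R = (\<Union>d<k. ?r d (P 0))"
  proof -
    have "(\<Union>d<k. ?r d (P 0)) = (\<Union>d<k. P (\<pi> d))" using \<pi> by (intro SUP_cong) auto
    also have "\<dots> = (\<Union>e\<in>\<pi> ` {..<k}. P e)" by auto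
    finally show ?thesis using surj R(1) by simp
  qed
  moreover have "P 0 \<inter> ?r d (P 0) \<subseteq> {0}" if d: "0 < d" "d < k" for d
  proof -
    have "?r d (P 0) = P (\<pi> d)" "\<pi> d < k" using \<pi> [of d] d by auto
    moreover have "\<pi> d \<noteq> 0" using free [OF d] calculation by auto
    ultimately show ?thesis using P(3) [of 0 "\<pi> d"] k by simp
  qed
  ultimately show ?thesis using P0 by (simp add: rosette_def)
qed

section \<open>Descending to the quotient sphere\<close>

no_notation fps_nth (infixl "$" 75)

definition qc :: "real^3 \<Rightarrow> complex" where "qc v = Complex (v$1) (v$2)"

definition at_height :: "real \<Rightarrow> complex \<Rightarrow> real^3" where "at_height a w = vector [Re w, Im w, a]"

lemma qc_at_height [simp]: "qc (at_height a w) = w" "at_height a w $ 3 = a"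
  by (simp_all add: qc_def at_height_def)

lemma qc_vector: "qc (vector [0, 0, a]) = 0" "(vector [0, 0, a] :: real^3) $ 3 = a" "vector [0, 0, a] = at_height a 0"
  by (simp_all add: qc_def at_height_def complex_eq_iff)

lemma qc_eqI: "qc v = qc w \<Longrightarrow> v$3 = w$3 \<Longrightarrow> v = w"
  by (simp add: qc_def vec_eq_iff forall_3)

lemma at_height_qc: "v$3 = a \<Longrightarrow> at_height a (qc v) = v"
  by (rule qc_eqI) simp_all

lemma continuous_on_qc [continuous_intros]: "continuous_on A qc"
proof -
  have "continuous_on A (\<lambda>v::real^3. of_real (v$1) + \<i> * of_real (v$2))"
    by (intro continuous_intros)
  then show ?thesis
    by (rule continuous_on_eq) (simp add: qc_def complex_eq_iff)
qed

lemma continuous_on_at_height: "continuous_on A (at_height a)"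
proof -
  have "continuous_on A (\<lambda>w. at_height a w $ i)" for i
  proof -
    have "continuous_on A (\<lambda>w. (vector [Re w, Im w, a] :: real^3) $ j)" if "j = 1 \<or> j = 2 \<or> j = 3" for j
      using that by (elim disjE; simp) (auto intro!: continuous_intros)
    then show ?thesis using exhaust_3 [of i] unfolding at_height_def by blast
  qed
  then show ?thesis
    using continuous_on_vec_lambda [of A "\<lambda>i w. at_height a w $ i"] by simp
qed

lemma zeta_coords [simp]: "qc (zeta k v) = om k * qc v" "zeta k v $ 3 = v $ 3"
  by (simp_all add: qc_def zeta_def rotz_def om_def complex_eq_iff algebra_simps)

lemma zeta_pow_coords [simp]: "qc ((zeta k ^^ i) v) = om k ^ i * qc v" "(zeta k ^^ i) v $ 3 = v $ 3"
  by (induction i) (simp_all add: mult.assoc)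

lemma jordan_qc:
  assumes "simple_closed_curve C" "\<And>v. v \<in> C \<Longrightarrow> v$3 = a"
  shows "jordan_curve (qc ` C)"
proof (rule jordan_curve_homeomorphic)
  have hom: "C homeomorphic (sphere 0 1 :: (real^2) set)"
    using assms(1) by (simp add: simple_closed_curve_def)
  then have "compact C" using homeomorphic_compactness compact_sphere by blast
  moreover have "inj_on qc C" using qc_eqI assms(2) by (metis inj_onI)
  ultimately have "C homeomorphic qc ` C"
    using homeomorphism_compact [of C qc "qc ` C"] continuous_on_qc unfolding homeomorphic_def by metis
  then have "qc ` C homeomorphic (sphere 0 1 :: (real^2) set)"
    using hom homeomorphic_sym homeomorphic_trans by blast
  also have "(sphere 0 1 :: (real^2) set) homeomorphic (sphere 0 1 :: complex set)"
    by (rule homeomorphic_spheres') auto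
  finally show "qc ` C homeomorphic (sphere 0 1 :: complex set)" .
qed

locale bse_cover =
  fixes g k n :: nat and S :: "(real^3) set" and p :: "real^3 \<Rightarrow> (nat \<Rightarrow> real)"
  assumes k2: "k \<ge> 2" and n1: "n \<ge> 1"
    and surf: "balanced_superelliptic_surface g k n S"
    and cover: "balanced_superelliptic_cover k S p"
begin

lemma surf_parts:
  "\<forall>a::real. a < 0 \<or> a > 2 * real n + 1 \<longrightarrow> zslice S a = {}"
  "\<forall>a\<in>{0, 2 * real n + 1}. zslice S a = {vector [0, 0, a]}"
  "\<forall>m\<le>n. \<forall>a. 2 * real m < a \<and> a < 2 * real m + 1 \<longrightarrow> simple_closed_curve (zslice S a)"
  "\<forall>j\<in>{1..2 * n}. is_rose k (vector [0, 0, real j]) (zslice S (real j))"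
  "\<forall>m\<in>{1..n}. \<forall>a. 2 * real m - 1 < a \<and> a < 2 * real m \<longrightarrow>
        (\<exists>C. permuted_curves k C \<and> zslice S a = (\<Union>d<k. C d))"
  by (insert surf [unfolded balanced_superelliptic_surface_def]) (elim conjE, assumption)+

lemma compact_S: "compact S"
  using surf by (simp add: balanced_superelliptic_surface_def closed_orientable_surface_def)

lemma zeta_S: "zeta k ` S = S"
  using surf by (simp add: balanced_superelliptic_surface_def)

lemma zeta_in_S: "v \<in> S \<Longrightarrow> zeta k v \<in> S"
  using zeta_S by blast

lemma zeta_pow_in_S: "v \<in> S \<Longrightarrow> (zeta k ^^ i) v \<in> S"
  by (induction i) (auto intro: zeta_in_S)

lemma p_S: "p ` S = S2"
  by (rule balanced_superelliptic_cover_surj [OF cover])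

lemma continuous_on_p: "continuous_on S p"
proof -
  have "quotient_map (top_of_set S) (nsphere 2) p"
    using cover by (simp add: balanced_superelliptic_cover_def)
  then have "continuous_map (top_of_set S) (nsphere 2) p"
    by (rule quotient_imp_continuous_map)
  then have "continuous_map (top_of_set S) (top_of_set S2) p"
    by (subst nsphere_2 [symmetric])
  then show ?thesis by simp
qed

lemma p_eq_iff:
  assumes "x \<in> S" "y \<in> S"
  shows "p x = p y \<longleftrightarrow> x$3 = y$3 \<and> (\<exists>i<k. qc y = om k ^ i * qc x)"
proof
  assume "p x = p y"
  then obtain i where i: "y = (zeta k ^^ i) x"
    using cover assms by (auto simp: balanced_superelliptic_cover_def)
  then have "qc y = om k ^ (i mod k) * qc x" by (simp add: om_power_mod)
  moreover have "i mod k < k" using k2 by simp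
  ultimately show "x$3 = y$3 \<and> (\<exists>i<k. qc y = om k ^ i * qc x)" using i by auto
next
  assume "x$3 = y$3 \<and> (\<exists>i<k. qc y = om k ^ i * qc x)"
  then obtain i where "x$3 = y$3" "qc y = om k ^ i * qc x" by blast
  then have "y = (zeta k ^^ i) x" by (intro qc_eqI) simp_all
  then show "p x = p y" using cover assms unfolding balanced_superelliptic_cover_def by blast
qed

text \<open>An arbitrary choice of preimages, with no continuity of its own; only invariant
  functions become continuous when composed with it.\<close>

definition sec :: "(nat \<Rightarrow> real) \<Rightarrow> real^3" where "sec y = (SOME x. x \<in> S \<and> p x = y)"

lemma sec: "y \<in> S2 \<Longrightarrow> sec y \<in> S" "y \<in> S2 \<Longrightarrow> p (sec y) = y"
proof -
  assume "y \<in> S2"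
  then have "y \<in> p ` S" using p_S by simp
  then have "\<exists>x. x \<in> S \<and> p x = y" by blast
  then have "sec y \<in> S \<and> p (sec y) = y" unfolding sec_def by (rule someI_ex)
  then show "sec y \<in> S" "p (sec y) = y" by auto
qed

lemma p_in: "x \<in> S \<Longrightarrow> p x \<in> S2"
  using p_S by blast

lemma descend:
  fixes m :: "real^3 \<Rightarrow> 'c::topological_space"
  assumes "continuous_on S m" "\<And>x. x \<in> S \<Longrightarrow> m (zeta k x) = m x"
  shows "continuous_on S2 (\<lambda>y. m (sec y))" "\<And>x. x \<in> S \<Longrightarrow> m (sec (p x)) = m x"
proof -
  have eq: "m x = m y" if xy: "x \<in> S" "y \<in> S" "p x = p y" for x y
  proof -
    obtain i where i: "y = (zeta k ^^ i) x"
      using cover xy by (auto simp: balanced_superelliptic_cover_def)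
    have "m ((zeta k ^^ i) x) = m x" for i
      by (induction i) (use assms(2) zeta_pow_in_S xy(1) in auto)
    then show ?thesis using i by simp
  qed
  show sec_p: "m (sec (p x)) = m x" if "x \<in> S" for x
    using eq sec p_in that by metis
  obtain l where l: "continuous_on (p ` S) l" "\<And>x. x \<in> S \<Longrightarrow> l (p x) = m x"
    by (rule continuous_on_descend [OF compact_S continuous_on_p assms(1)]) (use eq in blast)+
  have "continuous_on S2 l" using l(1) p_S by simp
  then show "continuous_on S2 (\<lambda>y. m (sec y))"
    by (rule continuous_on_eq) (metis l(2) sec)
qed

section \<open>Functions on the sphere induced by invariant functions on the surface\<close>

definition hh :: "(nat \<Rightarrow> real) \<Rightarrow> complex" where "hh y = qc (sec y) ^ k"
definition hgt :: "(nat \<Rightarrow> real) \<Rightarrow> real" where "hgt y = sec y $ 3"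
text \<open>Up to nonzero constants, the product of the translates of \<open>q - c\<close> under the
  deck group; \<open>c = 0\<close> gives \<open>hh\<close>. For nonzero \<open>c\<close> the zeros
  split into the \<open>k\<close> rotates of \<open>c\<close>, so that a curve around one of them
  need not see the others.\<close>

definition hc :: "complex \<Rightarrow> (nat \<Rightarrow> real) \<Rightarrow> complex" where "hc c y = (\<Prod>d<k. qc (sec y) - om k ^ d * c)"

lemma hh: "continuous_on S2 hh" "x \<in> S \<Longrightarrow> hh (p x) = qc x ^ k"
  unfolding hh_def
  by (rule descend; auto intro!: continuous_intros simp: power_mult_distrib)+

lemma hgt: "continuous_on S2 hgt" "x \<in> S \<Longrightarrow> hgt (p x) = x $ 3"
  unfolding hgt_def
  by (rule descend; auto intro!: continuous_intros)+

lemma prod_shift: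
  fixes F :: "nat \<Rightarrow> complex"
  assumes "F k = F 0"
  shows "(\<Prod>d<k. F (Suc d)) = (\<Prod>d<k. F d)"
proof -
  have "F 0 * (\<Prod>d<k. F (Suc d)) = (\<Prod>d<k. F d) * F k"
    using prod.lessThan_Suc_shift [of F k] by (simp add: mult.commute)
  moreover have "(\<Prod>d<k. F (Suc d)) = 0" "(\<Prod>d<k. F d) = 0" if "F 0 = 0"
  proof -
    have "F (Suc (k - 1)) = 0" "k - 1 < k" using that assms k2 by auto
    then show "(\<Prod>d<k. F (Suc d)) = 0" by (metis finite_lessThan lessThan_iff prod_zero)
    have "0 < k" using k2 by simp
    then show "(\<Prod>d<k. F d) = 0" using that by (metis finite_lessThan lessThan_iff prod_zero)
  qed
  ultimately show ?thesis using assms by (metis mult.commute mult_cancel_left)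
qed

lemma hc: "continuous_on S2 (hc c)" "x \<in> S \<Longrightarrow> hc c (p x) = (\<Prod>d<k. qc x - om k ^ d * c)"
proof -
  have inv: "(\<Prod>d<k. qc (zeta k x) - om k ^ d * c) = (\<Prod>d<k. qc x - om k ^ d * c)" for x
  proof -
    have "(\<Prod>d<k. qc (zeta k x) - om k ^ d * c) = (\<Prod>d<k. qc (zeta k x) - om k ^ Suc d * c)"
      by (rule prod_shift [symmetric]) simp
    also have "\<dots> = (\<Prod>d<k. om k * (qc x - om k ^ d * c))"
      by (simp add: algebra_simps)
    also have "\<dots> = (\<Prod>d<k. qc x - om k ^ d * c)"
      by (simp add: prod.distrib)
    finally show ?thesis .
  qed
  show "continuous_on S2 (hc c)" "x \<in> S \<Longrightarrow> hc c (p x) = (\<Prod>d<k. qc x - om k ^ d * c)"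
    unfolding hc_def
    by (rule descend [where m = "\<lambda>x. \<Prod>d<k. qc x - om k ^ d * c"]; (rule inv)?; auto intro!: continuous_intros)+
qed

section \<open>Slices of the surface (\<open>RR\<close>), slices of the sphere (\<open>LL\<close>),
  and the cover between them (\<open>th\<close>)\<close>

definition RR :: "real \<Rightarrow> complex set" where "RR a = qc ` zslice S a"
definition LL :: "real \<Rightarrow> (nat \<Rightarrow> real) set" where "LL a = {y \<in> S2. hgt y = a}"
definition th :: "real \<Rightarrow> complex \<Rightarrow> (nat \<Rightarrow> real)" where "th a w = p (at_height a w)"

lemma RR_iff: "w \<in> RR a \<longleftrightarrow> at_height a w \<in> S"
proof
  assume "w \<in> RR a"
  then obtain v where "v \<in> S" "v$3 = a" "w = qc v" by (auto simp: RR_def zslice_def)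
  then show "at_height a w \<in> S" using at_height_qc [of v a] by simp
next
  assume "at_height a w \<in> S"
  then have "at_height a w \<in> zslice S a" by (simp add: zslice_def)
  then have "qc (at_height a w) \<in> RR a" unfolding RR_def by (rule imageI)
  then show "w \<in> RR a" by simp
qed

lemma th_facts:
  assumes "w \<in> RR a"
  shows "th a w \<in> S2" "hgt (th a w) = a" "hh (th a w) = w ^ k" "hc c (th a w) = (\<Prod>d<k. w - om k ^ d * c)"
  using assms unfolding th_def RR_iff by (auto simp: p_in hgt hh hc)

lemma th_eq_iff:
  assumes "v \<in> RR a" "w \<in> RR a"
  shows "th a v = th a w \<longleftrightarrow> (\<exists>i<k. w = om k ^ i * v)"
  using assms unfolding th_def RR_iff by (simp add: p_eq_iff)

lemma continuous_on_th: "continuous_on (RR a) (th a)"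
  unfolding th_def
  by (rule continuous_on_compose2 [OF continuous_on_p continuous_on_at_height]) (auto simp: RR_iff)

lemma LL_eq: "LL a = th a ` RR a"
proof
  show "LL a \<subseteq> th a ` RR a"
  proof
    fix y assume y: "y \<in> LL a"
    then have s: "sec y \<in> S" "p (sec y) = y" "sec y $ 3 = a"
      using sec by (auto simp: LL_def hgt_def)
    then have "at_height a (qc (sec y)) = sec y" by (simp add: at_height_qc)
    then have "qc (sec y) \<in> RR a" "th a (qc (sec y)) = y"
      using s by (simp_all add: RR_iff th_def)
    then show "y \<in> th a ` RR a" by (metis imageI)
  qed
  show "th a ` RR a \<subseteq> LL a" using th_facts by (auto simp: LL_def)
qed

lemma rot_RR: "(\<lambda>w. om k * w) ` RR a = RR a"
proof -
  have in1: "om k * w \<in> RR a" if "w \<in> RR a" for w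
  proof -
    have "zeta k (at_height a w) \<in> S" using that by (simp add: RR_iff zeta_in_S)
    moreover have "zeta k (at_height a w) = at_height a (om k * w)" by (rule qc_eqI) simp_all
    ultimately show ?thesis by (simp add: RR_iff)
  qed
  have pow: "om k ^ j * w \<in> RR a" if "w \<in> RR a" for w j
    by (induction j) (use that in1 in \<open>auto simp: mult.assoc\<close>)
  have "w \<in> (\<lambda>w. om k * w) ` RR a" if "w \<in> RR a" for w
  proof
    show "om k ^ (k - 1) * w \<in> RR a" by (rule pow [OF that])
    have "om k * om k ^ (k - 1) = 1" using k2 by (metis om_power_self power_minus_mult less_le_trans pos2 mult.commute)
    then show "w = om k * (om k ^ (k - 1) * w)" by (simp flip: mult.assoc)
  qed
  then show ?thesis using in1 by blast
qed

section \<open>Shape of the slices at each height\<close>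

lemma RR_empty: "a < 0 \<or> a > 2 * real n + 1 \<Longrightarrow> RR a = {}"
proof -
  assume "a < 0 \<or> a > 2 * real n + 1"
  then have "zslice S a = {}" using surf_parts(1) by blast
  then show "RR a = {}" by (simp add: RR_def)
qed

lemma RR_ends: "RR 0 = {0}" "RR (2 * real n + 1) = {0}"
  using surf_parts(2) by (simp_all add: RR_def qc_vector)

lemma RR_circle:
  assumes "m \<le> n" "2 * real m < a" "a < 2 * real m + 1"
  shows "jordan_curve (RR a)"
proof -
  have "simple_closed_curve (zslice S a)"
    using surf_parts(3) assms by blast
  then show ?thesis unfolding RR_def by (rule jordan_qc) (simp add: zslice_def)
qed

lemma qc_inj_slice: "inj_on qc (zslice S a)"
  by (rule inj_onI) (auto simp: zslice_def intro: qc_eqI)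

lemma RR_rose:
  assumes j: "j \<in> {1..2 * n}"
  shows "\<exists>K. rosette k K (RR (real j))" "0 \<in> RR (real j)"
proof -
  have "is_rose k (vector [0, 0, real j]) (zslice S (real j))"
    using surf_parts(4) j by blast
  then obtain P where P0: "(\<forall>d<k. simple_closed_curve (P d) \<and> vector [0, 0, real j] \<in> P d) \<and>
    (\<forall>d<k. \<forall>e<k. d \<noteq> e \<longrightarrow> P d \<inter> P e = {vector [0, 0, real j]}) \<and> zslice S (real j) = (\<Union>d<k. P d)"
    unfolding is_rose_def by (elim exE)
  have P: "\<And>d. d < k \<Longrightarrow> simple_closed_curve (P d)" "\<And>d. d < k \<Longrightarrow> vector [0, 0, real j] \<in> P d"
    "\<And>d e. d < k \<Longrightarrow> e < k \<Longrightarrow> d \<noteq> e \<Longrightarrow> P d \<inter> P e = {vector [0, 0, real j]}"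
    "zslice S (real j) = (\<Union>d<k. P d)"
    using P0 by simp_all
  have sub: "P d \<subseteq> zslice S (real j)" if "d < k" for d using P(4) that by blast
  have R: "RR (real j) = (\<Union>d<k. qc ` P d)" unfolding RR_def P(4) by blast
  have z: "0 \<in> qc ` P d" if "d < k" for d
    using imageI [OF P(2) [OF that], of qc] by (simp add: qc_vector)
  have "rosette k (qc ` P 0) (RR (real j))"
  proof (rule rose_rosette [where P = "\<lambda>d. qc ` P d"])
    show "jordan_curve (qc ` P d)" if "d < k" for d
      by (rule jordan_qc [OF P(1) [OF that], where a = "real j"]) (use sub [OF that] in \<open>auto simp: zslice_def\<close>)
    show "qc ` P d \<inter> qc ` P e = {0}" if "d < k" "e < k" "d \<noteq> e" for d e
    proof -
      have "qc ` P d \<inter> qc ` P e = qc ` (P d \<inter> P e)"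
        using inj_on_image_Int [OF qc_inj_slice sub [OF that(1)] sub [OF that(2)]] by simp
      then show ?thesis using P(3) [OF that] by (simp add: qc_vector)
    qed
    show "RR (real j) = (\<Union>d<k. qc ` P d)" by (rule R)
    show "(\<lambda>w. om k * w) ` RR (real j) = RR (real j)" by (rule rot_RR)
  qed (use z k2 in auto)
  then show "\<exists>K. rosette k K (RR (real j))" by blast
  show "0 \<in> RR (real j)" using R z [of 0] k2 by auto
qed

lemma RR_curves:
  assumes m: "m \<in> {1..n}" "2 * real m - 1 < a" "a < 2 * real m"
  shows "\<exists>K. rosette k K (RR a)" "0 \<notin> RR a"
proof -
  obtain C where C: "permuted_curves k C" "zslice S a = (\<Union>d<k. C d)"
    using surf_parts(5) m by blast
  have sc: "\<And>d. d < k \<Longrightarrow> simple_closed_curve (C d)"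
    and disj: "\<And>d e. d < k \<Longrightarrow> e < k \<Longrightarrow> d \<noteq> e \<Longrightarrow> C d \<inter> C e = {}"
    and perm: "\<And>d. d < k \<Longrightarrow> zeta k ` C d = C (Suc d mod k)"
    using C(1) by (auto simp: permuted_curves_def)
  have sub: "C d \<subseteq> zslice S a" if "d < k" for d using C(2) that by blast
  have k0: "0 < k" using k2 by simp
  have rot: "qc ` C d = (\<lambda>w. om k ^ d * w) ` qc ` C 0" if "d < k" for d
    using that
  proof (induction d)
    case (Suc d)
    then have "C (Suc d) = zeta k ` C d" using perm [of d] by simp
    then have "qc ` C (Suc d) = (\<lambda>w. om k * w) ` qc ` C d" by (simp add: image_image)
    then show ?case using Suc by (simp add: image_image mult.assoc)
  qed simp
  have int: "qc ` C d \<inter> qc ` C e = {}" if "d < k" "e < k" "d \<noteq> e" for d e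
    using inj_on_image_Int [OF qc_inj_slice sub [OF that(1)] sub [OF that(2)]] disj [OF that] by simp
  have "rosette k (qc ` C 0) (RR a)"
    unfolding rosette_def
  proof (intro conjI allI impI)
    show "jordan_curve (qc ` C 0)"
      by (rule jordan_qc [OF sc [OF k0], where a = a]) (use sub [OF k0] in \<open>auto simp: zslice_def\<close>)
    have "RR a = (\<Union>d<k. qc ` C d)" unfolding RR_def C(2) by (rule image_UN)
    also have "\<dots> = (\<Union>d<k. (\<lambda>w. om k ^ d * w) ` qc ` C 0)"
      by (intro SUP_cong refl rot) simp
    finally show "RR a = (\<Union>d<k. (\<lambda>w. om k ^ d * w) ` qc ` C 0)" .
    show "qc ` C 0 \<inter> (\<lambda>w. om k ^ d * w) ` qc ` C 0 \<subseteq> {0}" if d: "0 < d" "d < k" for d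
    proof -
      have "qc ` C 0 \<inter> qc ` C d = {}" using int [OF k0 d(2)] d(1) by blast
      then show ?thesis using rot [OF d(2)] by simp
    qed
  qed
  then show "\<exists>K. rosette k K (RR a)" by blast
  \<comment> \<open>A point on the axis is fixed by the rotation, so it would lie on two consecutive
    curves, which are disjoint.\<close>
  show "0 \<notin> RR a"
  proof
    assume "0 \<in> RR a"
    then obtain v where v: "v \<in> zslice S a" "qc v = 0" by (auto simp: RR_def)
    then obtain d where d: "d < k" "v \<in> C d" using C(2) by blast
    have "zeta k v = v" using v(2) by (intro qc_eqI) simp_all
    then have "v \<in> C (Suc d mod k)" using perm [OF d(1)] d(2) by (metis imageI)
    moreover have "Suc d mod k \<noteq> d"
    proof
      assume "Suc d mod k = d"
      then show False using d(1) k2 by (cases "Suc d = k") auto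
    qed
    moreover have "Suc d mod k < k" using k0 by simp
    ultimately show False using disj [OF d(1), of "Suc d mod k"] d(2) by (metis disjoint_iff)
  qed
qed

lemma RR_rosette:
  assumes m: "m \<in> {1..n}" "2 * real m - 1 \<le> a" "a \<le> 2 * real m"
  shows "\<exists>K. rosette k K (RR a)"
proof -
  consider "a = real (2 * m - 1)" | "a = real (2 * m)" | "2 * real m - 1 < a" "a < 2 * real m"
  proof -
    have "real (2 * m - 1) = 2 * real m - 1" using m(1) by (simp add: of_nat_diff)
    then have "a = real (2 * m - 1) \<or> a = real (2 * m) \<or> (2 * real m - 1 < a \<and> a < 2 * real m)"
      using m(2,3) by simp linarith
    then show thesis using that by blast
  qed
  then show ?thesis
  proof cases
    case 1
    have "2 * m - 1 \<in> {1..2 * n}" using m(1) by auto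
    from RR_rose(1) [OF this] show ?thesis using 1 by simp
  next
    case 2
    have "2 * m \<in> {1..2 * n}" using m(1) by auto
    from RR_rose(1) [OF this] show ?thesis using 2 by simp
  next
    case 3
    then show ?thesis using RR_curves(1) m(1) by blast
  qed
qed

text \<open>\<open>K\<close> is a fundamental domain for the rotation of the slice, since its
  rotates meet it at most in the fixed point 0. It therefore parametrises the slice downstairs
  exactly once.\<close>

lemma rosette_connected:
  assumes "rosette k K (RR a)"
  shows "th a ` K = LL a" "K \<subseteq> RR a" "inj_on (th a) K"
proof -
  have R: "RR a = (\<Union>d<k. (\<lambda>w. om k ^ d * w) ` K)"
    and disj: "\<And>d. 0 < d \<Longrightarrow> d < k \<Longrightarrow> K \<inter> (\<lambda>w. om k ^ d * w) ` K \<subseteq> {0}"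
    using assms by (auto simp: rosette_def)
  have "(\<lambda>w. om k ^ 0 * w) ` K \<subseteq> RR a" unfolding R using k2 by (intro UN_upper) auto
  then show K: "K \<subseteq> RR a" by simp
  show "th a ` K = LL a"
  proof
    show "th a ` K \<subseteq> LL a" using K LL_eq by blast
    show "LL a \<subseteq> th a ` K"
    proof
      fix y assume "y \<in> LL a"
      then obtain w where w: "w \<in> RR a" "y = th a w" using LL_eq by blast
      then obtain d v where d: "d < k" "v \<in> K" "w = om k ^ d * v" using R by blast
      have "v \<in> RR a" using d K by blast
      then have "th a v = th a w" using th_eq_iff [of v a w] w d by blast
      then have "y = th a v" using w(2) by simp
      then show "y \<in> th a ` K" using d(2) by (rule image_eqI)
    qed
  qed
  show "inj_on (th a) K"
  proof (rule inj_onI)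
    fix v w assume vw: "v \<in> K" "w \<in> K" "th a v = th a w"
    then obtain i where i: "i < k" "w = om k ^ i * v" using th_eq_iff [of v a w] K by blast
    show "v = w"
    proof (cases "i = 0")
      case False
      then have "w \<in> K \<inter> (\<lambda>w. om k ^ i * w) ` K" using vw i by blast
      then have "w = 0" using disj [of i] False i by blast
      then show ?thesis using i by simp
    qed (use i in simp)
  qed
qed

lemma levels:
  assumes "0 \<le> a" "a \<le> 2 * real n + 1"
  obtains "a = 0" | "a = 2 * real n + 1" | m where "m \<le> n" "2 * real m < a" "a < 2 * real m + 1"
    | m where "m \<in> {1..n}" "2 * real m - 1 \<le> a" "a \<le> 2 * real m"
proof -
  define j where "j = nat \<lfloor>a\<rfloor>"
  have j: "real j \<le> a" "a < real j + 1" using assms(1) by (simp_all add: j_def)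
  show thesis
  proof (cases "even j")
    case True
    then obtain m where m: "j = 2 * m" by blast
    then have "real (2 * m) \<le> 2 * real n + 1" using j assms by linarith
    then have "m \<le> n" by linarith
    show thesis
    proof (cases "a = real j")
      case True
      then show thesis using that(1) that(4) [of m] m \<open>m \<le> n\<close> by (cases "m = 0") auto
    next
      case False
      then show thesis using that(3) [of m] m j \<open>m \<le> n\<close> by auto
    qed
  next
    case False
    then obtain m where m: "j = 2 * m + 1" by (auto elim: oddE)
    then have "real (2 * m + 1) \<le> 2 * real n + 1" using j assms by linarith
    then have "m \<le> n" by linarith
    show thesis
    proof (cases "m = n")
      case True
      then have "a = 2 * real n + 1" using j m assms(2) by simp
      then show thesis by (rule that(2))
    next
      case False
      then show thesis using that(4) [of "Suc m"] m j \<open>m \<le> n\<close> by auto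
    qed
  qed
qed

section \<open>Height as a function with connected levels\<close>

lemma LL_connected:
  assumes "0 \<le> a" "a \<le> 2 * real n + 1"
  shows "connected (LL a)" "LL a \<noteq> {}"
proof -
  have main: "connected (LL a) \<and> LL a \<noteq> {}" if "th a ` K = LL a" "K \<subseteq> RR a" "connected K" "K \<noteq> {}" for K
  proof -
    have "connected (th a ` K)"
      by (rule connected_continuous_image [OF continuous_on_subset [OF continuous_on_th that(2)] that(3)])
    then show ?thesis using that by auto
  qed
  have "connected (LL a) \<and> LL a \<noteq> {}"
    using assms
  proof (cases rule: levels)
    case 1
    then show ?thesis using main [of "RR a"] LL_eq [of a] RR_ends by simp
  next
    case 2
    then show ?thesis using main [of "RR a"] LL_eq [of a] RR_ends by simp
  next
    case (3 m)
    note J = jordan_curve_facts [OF RR_circle [OF 3]]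
    show ?thesis by (rule main [of "RR a"]) (use LL_eq J in auto)
  next
    case (4 m)
    then obtain K where K: "rosette k K (RR a)" using RR_rosette by blast
    then have "jordan_curve K" by (simp add: rosette_def)
    then show ?thesis using main [of K] rosette_connected [OF K] jordan_curve_facts(2,3) by blast
  qed
  then show "connected (LL a)" "LL a \<noteq> {}" by auto
qed

lemma hgt_image: "hgt ` S2 = {0..2 * real n + 1}"
proof
  show "hgt ` S2 \<subseteq> {0..2 * real n + 1}"
  proof
    fix a assume "a \<in> hgt ` S2"
    then have "LL a \<noteq> {}" by (auto simp: LL_def)
    then show "a \<in> {0..2 * real n + 1}" using LL_eq [of a] RR_empty [of a] by fastforce
  qed
  show "{0..2 * real n + 1} \<subseteq> hgt ` S2"
  proof
    fix a assume "a \<in> {0..2 * real n + 1}"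
    then have "LL a \<noteq> {}" using LL_connected(2) by simp
    then show "a \<in> hgt ` S2" by (auto simp: LL_def)
  qed
qed

text \<open>By compactness the height is a closed map, and its fibres are connected; such a map
  pulls connected sets back to connected sets.\<close>

lemma connected_hgt_preimage:
  assumes "connected T" "T \<subseteq> {0..2 * real n + 1}"
  shows "connected (S2 \<inter> hgt -` T)"
proof (rule connected_closed_monotone_preimage [OF hgt(1) hgt_image _ _ assms])
  show "closedin (top_of_set {0..2 * real n + 1}) (hgt ` C)" if "closedin (top_of_set S2) C" for C
  proof -
    have "compact C" using closedin_compact [OF compact_S2 that] .
    then have "compact (hgt ` C)"
      using compact_continuous_image continuous_on_subset [OF hgt(1)] closedin_imp_subset [OF that] by blast
    moreover have "hgt ` C \<subseteq> {0..2 * real n + 1}"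
      using hgt_image closedin_imp_subset [OF that] by blast
    ultimately show ?thesis by (intro closed_subset compact_imp_closed)
  qed
  show "connected (S2 \<inter> hgt -` {a})" if "a \<in> {0..2 * real n + 1}" for a
  proof -
    have "S2 \<inter> hgt -` {a} = LL a" by (auto simp: LL_def)
    then show ?thesis using LL_connected that by simp
  qed
qed

section \<open>The branch points on the axis\<close>

definition bb :: "nat \<Rightarrow> (nat \<Rightarrow> real)" where "bb j = th (real j) 0"

lemma zero_in_RR_iff: "0 \<in> RR a \<longleftrightarrow> (\<exists>j\<le>2 * n + 1. a = real j)"
proof
  assume z: "0 \<in> RR a"
  then have "0 \<le> a" "a \<le> 2 * real n + 1" using RR_empty [of a] by force+
  then show "\<exists>j\<le>2 * n + 1. a = real j"
  proof (cases rule: levels)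
    case 1
    then show ?thesis by (intro exI [of _ 0]) simp
  next
    case 2
    then show ?thesis by (intro exI [of _ "2 * n + 1"]) simp
  next
    case (3 m)
    have "0 \<in> inside (RR a)" by (rule rotation_inside_0 [OF RR_circle [OF 3] rot_RR k2])
    then show ?thesis using z by (simp add: inside_def)
  next
    case (4 m)
    then have "\<not> (2 * real m - 1 < a \<and> a < 2 * real m)" using RR_curves(2) z by blast
    then have "a = real (2 * m - 1) \<or> a = real (2 * m)" using 4 by (auto simp: of_nat_diff)
    moreover have "2 * m - 1 \<le> 2 * n + 1" "2 * m \<le> 2 * n + 1" using 4(1) by auto
    ultimately show ?thesis by blast
  qed
next
  assume "\<exists>j\<le>2 * n + 1. a = real j"
  then obtain j where j: "j \<le> 2 * n + 1" "a = real j" by blast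
  consider "j = 0" | "j = 2 * n + 1" | "j \<in> {1..2 * n}" using j by force
  then show "0 \<in> RR a"
  proof cases
    case 1
    then show ?thesis using RR_ends j by simp
  next
    case 2
    then have "a = 2 * real n + 1" using j by simp
    then show ?thesis using RR_ends by simp
  next
    case 3
    then show ?thesis using RR_rose(2) j by blast
  qed
qed

lemma bb: assumes "j \<le> 2 * n + 1" shows "bb j \<in> S2" "hgt (bb j) = real j"
proof -
  have "0 \<in> RR (real j)" using zero_in_RR_iff assms by blast
  then show "bb j \<in> S2" "hgt (bb j) = real j" by (simp_all add: bb_def th_facts)
qed

lemma bb_inj: "inj_on bb {..2 * n + 1}"
  by (rule inj_onI) (metis atMost_iff bb(2) of_nat_eq_iff)

lemma branch_set_eq: "branch_set k S p = bb ` {..2 * n + 1}"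
proof -
  have fixed: "zeta k x = x \<longleftrightarrow> qc x = 0" for x
  proof
    assume "zeta k x = x"
    then have "om k * qc x = qc x" using zeta_coords(1) [of k x] by simp
    moreover have "om k \<noteq> 1" using om_power_eq_1_iff [of k 1] k2 by auto
    ultimately show "qc x = 0" by simp
  next
    assume "qc x = 0" then show "zeta k x = x" by (intro qc_eqI) simp_all
  qed
  show ?thesis
  proof
    show "branch_set k S p \<subseteq> bb ` {..2 * n + 1}"
    proof
      fix y assume "y \<in> branch_set k S p"
      then obtain x where x: "x \<in> S" "qc x = 0" "y = p x" by (auto simp: branch_set_def fixed)
      have xe: "x = at_height (x$3) 0" using x(2) by (intro qc_eqI) simp_all
      then have "0 \<in> RR (x$3)" using x(1) by (simp add: RR_iff)
      then obtain j where "j \<le> 2 * n + 1" "x$3 = real j" using zero_in_RR_iff by blast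
      then show "y \<in> bb ` {..2 * n + 1}" using x xe by (auto simp: bb_def th_def)
    qed
    show "bb ` {..2 * n + 1} \<subseteq> branch_set k S p"
    proof
      fix y assume "y \<in> bb ` {..2 * n + 1}"
      then obtain j where j: "j \<le> 2 * n + 1" "y = bb j" by blast
      then have "at_height (real j) 0 \<in> S" using zero_in_RR_iff RR_iff by blast
      then show "y \<in> branch_set k S p"
        using j unfolding branch_set_def bb_def th_def by (intro image_eqI [of _ p]) (auto simp: fixed)
    qed
  qed
qed

lemma hh_eq_0_iff:
  assumes "y \<in> S2" shows "hh y = 0 \<longleftrightarrow> y \<in> branch_set k S p"
proof -
  have w: "qc (sec y) \<in> RR (hgt y)" "y = th (hgt y) (qc (sec y))"
    using sec [OF assms] by (simp_all add: RR_iff th_def hgt_def at_height_qc)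
  have "hh y = 0 \<longleftrightarrow> qc (sec y) = 0" using k2 by (simp add: hh_def)
  also have "\<dots> \<longleftrightarrow> y \<in> bb ` {..2 * n + 1}"
  proof
    assume "qc (sec y) = 0"
    then obtain j where "j \<le> 2 * n + 1" "hgt y = real j" "y = th (hgt y) 0" using w zero_in_RR_iff by metis
    then show "y \<in> bb ` {..2 * n + 1}" by (auto simp: bb_def)
  next
    assume "y \<in> bb ` {..2 * n + 1}"
    then obtain j where j: "j \<le> 2 * n + 1" "y = th (real j) 0" by (auto simp: bb_def)
    then have "0 \<in> RR (real j)" using zero_in_RR_iff by blast
    then have "hh y = 0" using th_facts(3) j k2 by simp
    then show "qc (sec y) = 0" using k2 by (simp add: hh_def)
  qed
  finally show ?thesis using branch_set_eq by simp
qed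

end

section \<open>Winding along the slices\<close>

context sphere_chart
begin

text \<open>In the chart that sends \<open>b\<close> to infinity, \<open>U\<close> is a connected
  open subset of the plane, which one point does not disconnect. This is needed to remove
  \<open>N\<close> from the part of the sphere below a slice.\<close>

lemma connected_delete:
  assumes "openin (top_of_set X) U" "connected U" "b \<in> X" "b \<notin> U"
  shows "connected (U - {x})"
proof (cases "x \<in> U")
  case True
  obtain y y' where y: "homeomorphism (X - {b}) (UNIV::complex set) y y'"
    using other_charts [OF assms(3)] by (auto simp: homeomorphic_def)
  have sub: "U \<subseteq> X - {b}" using assms openin_imp_subset by blast
  have cy: "continuous_on U y" using y sub by (auto simp: homeomorphism_def intro: continuous_on_subset)
  have inv: "y' (y v) = v" if "v \<in> U" for v using y sub that by (auto simp: homeomorphism_def)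
  have "openin (top_of_set (X - {b})) U"
    by (rule openin_subset_trans [OF assms(1) sub]) auto
  then have "openin (top_of_set UNIV) (y ` U)"
    by (rule homeomorphism_imp_open_map [OF y])
  then have "open (y ` U)" by simp
  moreover have "connected (y ` U)" by (rule connected_continuous_image [OF cy assms(2)])
  ultimately have "connected (y ` U - {y x})" by (rule connected_open_delete) simp
  moreover have "y ` U - {y x} = y ` (U - {x})"
  proof -
    have "y v \<noteq> y x" if "v \<in> U" "v \<noteq> x" for v using inv [OF that(1)] inv [OF True] that(2) by metis
    then show ?thesis by auto
  qed
  moreover have "continuous_on (y ` (U - {x})) y'"
    using y by (auto simp: homeomorphism_def intro: continuous_on_subset)
  ultimately have "connected (y' ` y ` (U - {x}))" using connected_continuous_image by metis
  moreover have "y' ` y ` (U - {x}) = U - {x}" using inv by force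
  ultimately show ?thesis by simp
qed (use assms in simp)

text \<open>The zero of \<open>tt a b\<close> can be moved inside \<open>U\<close> to its pole,
  where the two cancel.\<close>

lemma tt_logeq_1:
  assumes L: "compact L" "L \<subseteq> X - {N}" and U: "connected U" "U \<subseteq> X - {N}" "U \<inter> L = {}" and ab: "a \<in> U" "b \<in> U"
  shows "logeq L (tt a b) (\<lambda>_. 1)"
proof -
  have "logeq (z ` L) (\<lambda>w. w - z a) (\<lambda>w. w - z b)"
  proof (rule logeq_connected_poles)
    show "compact (z ` L)" by (intro compact_continuous_image continuous_on_z L)
    show "connected (z ` U)" by (intro connected_continuous_image continuous_on_z U)
    show "z ` U \<inter> z ` L = {}"
    proof -
      have "z u \<noteq> z v" if "u \<in> U" "v \<in> L" for u v
      proof -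
        have "u \<in> X" "u \<noteq> N" "v \<in> X" "v \<noteq> N" "u \<noteq> v" using that L(2) U(2,3) by auto
        then show ?thesis using z_eq_iff by simp
      qed
      then show ?thesis by auto
    qed
  qed (use ab in auto)
  then have "logeq L (\<lambda>x. z x - z a) (\<lambda>x. z x - z b)"
    by (rule logeq_compose) (use continuous_on_z L in auto)
  then have "logeq L (\<lambda>x. (z x - z a) / (z x - z b)) (\<lambda>_. 1)"
  proof (subst logeq_divide_iff)
    fix x assume "x \<in> L"
    then have "x \<in> X" "x \<noteq> N" "b \<in> X" "b \<noteq> N" "x \<noteq> b" using L(2) U(2,3) ab by auto
    then show "z x - z b \<noteq> 0" using z_eq_iff by simp
  qed
  moreover have "logeq L (tt a b) (\<lambda>x. (z x - z a) / (z x - z b))"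
    by (rule logeq_eq) (use L in \<open>auto simp: tt_def\<close>)
  ultimately show ?thesis by (rule logeq_trans [rotated])
qed

end

text \<open>Inside and outside of \<open>J\<close> are connected, so each lies in one of
  \<open>U\<close> and \<open>V\<close>; the outside is unbounded and cannot lie in
  \<open>U\<close>.\<close>

lemma inside_eqI:
  assumes J: "jordan_curve J" and "open U" "open V" "U \<inter> V = {}" and UV: "U \<union> V = - J"
    and bd: "bounded U" and ne: "U \<noteq> {}"
  shows "inside J = U"
proof -
  have one_side: "D \<subseteq> U" if D: "connected D" "D \<inter> J = {}" "D \<inter> U \<noteq> {}" for D
  proof -
    have sub: "D \<subseteq> U \<union> V" using D(2) UV by blast
    have "U \<inter> V \<inter> D = {}" using assms(4) by blast
    then have "U \<inter> D = {} \<or> V \<inter> D = {}"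
      using connectedD [OF D(1) assms(2,3) _ sub] by blast
    then show ?thesis using D(3) sub by blast
  qed
  have io: "inside J \<inter> J = {}" "outside J \<inter> J = {}" by (auto simp: inside_def outside_def)
  have "outside J \<inter> U = {}"
  proof (rule ccontr)
    assume "outside J \<inter> U \<noteq> {}"
    then have "outside J \<subseteq> U" by (rule one_side [OF jordan_curve_facts(9) [OF J] io(2)])
    then have "bounded (outside J)" using bd bounded_subset by blast
    moreover have "bounded J" using jordan_curve_facts(1) [OF J] compact_imp_bounded by blast
    ultimately show False using unbounded_outside by blast
  qed
  then have Ui: "U \<subseteq> inside J" using UV jordan_curve_facts(10) [OF J] by blast
  then have "inside J \<inter> U \<noteq> {}" using ne by blast
  then have "inside J \<subseteq> U" by (rule one_side [OF jordan_curve_facts(6) [OF J] io(1)])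
  then show ?thesis using Ui by (rule equalityI)
qed

lemma powi_sum:
  fixes x :: complex
  assumes "x \<noteq> 0" "finite I"
  shows "(\<Prod>i\<in>I. x powi f i) = x powi (\<Sum>i\<in>I. f i)"
  using assms(2) by (induction I rule: finite_induct) (use assms(1) in \<open>simp_all add: power_int_add\<close>)

lemma logeq_powi_cancel:
  assumes K: "jordan_curve K" "c \<in> inside K" and "logeq K (\<lambda>w. (w - c) powi i) (\<lambda>w. (w - c) powi j)"
  shows "i = j"
proof -
  have nz: "w - c \<noteq> 0" if "w \<in> K" for w using that K(2) by (auto simp: inside_def)
  have "logeq K (\<lambda>w. (w - c) powi i / (w - c) powi j) (\<lambda>_. 1)"
    by (subst logeq_divide_iff) (use nz assms(3) in auto)
  moreover have "logeq K (\<lambda>w. (w - c) powi (i - j)) (\<lambda>w. (w - c) powi i / (w - c) powi j)"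
    by (rule logeq_eq) (use nz in \<open>simp add: power_int_diff\<close>)
  ultimately have "logeq K (\<lambda>w. (w - c) powi (i - j)) (\<lambda>_. 1)" by (rule logeq_trans [rotated])
  then have "i - j = 0" by (rule jordan_powi_trivial [OF K])
  then show ?thesis by simp
qed

text \<open>At height 1/2, \<open>N\<close> avoids the branch points, whose heights are integers,
  and lies strictly below every slice on which exponents are measured. The part of the sphere above
  such a slice is then bounded in the chart.\<close>

locale bse_chart = bse_cover g k n S p + sphere_chart S2 N z z'
  for g k n S p N z z' +
  assumes N_hgt: "hgt N = 1/2"
begin

abbreviation "b0 \<equiv> bb 0"
abbreviation "be \<equiv> bb (2 * n + 1)"
text \<open>The common yardstick for all slices between the two ends: each such slice separates its
  zero at the bottom from its pole at the top.\<close>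

abbreviation "t \<equiv> tt b0 be"

lemma bb_N: "j \<le> 2 * n + 1 \<Longrightarrow> bb j \<in> S2 - {N}"
proof -
  assume j: "j \<le> 2 * n + 1"
  have "real j \<noteq> 1/2"
  proof
    assume "real j = 1/2"
    then have "real (2 * j) = real 1" by simp
    then have "2 * j = 1" by (simp only: of_nat_eq_iff)
    then show False by presburger
  qed
  then have "bb j \<noteq> N" using bb(2) [OF j] N_hgt by auto
  then show ?thesis using bb(1) [OF j] by simp
qed

lemma b0_N: "b0 \<in> S2 - {N}" and be_N: "be \<in> S2 - {N}"
  using bb_N [of 0] bb_N [of "2 * n + 1"] by auto

lemma LL_sub: "LL a \<subseteq> S2" "a \<noteq> 1/2 \<Longrightarrow> LL a \<subseteq> S2 - {N}"
  using N_hgt by (auto simp: LL_def)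

lemma closedin_LL: "closedin (top_of_set S2) (LL a)"
proof -
  have "LL a = S2 \<inter> hgt -` {a}" by (auto simp: LL_def)
  then show ?thesis using continuous_closedin_preimage [OF hgt(1), of "{a}"] by simp
qed

lemma compact_LL: "compact (LL a)"
  by (rule closedin_compact [OF compact_S2 closedin_LL])

lemma ends_notin_LL: "0 < a \<Longrightarrow> a < 2 * real n + 1 \<Longrightarrow> b0 \<notin> LL a \<and> be \<notin> LL a"
  using bb(2) [of 0] bb(2) [of "2 * n + 1"] by (auto simp: LL_def)

lemma t_LL: assumes "0 < a" "a < 2 * real n + 1"
  shows "continuous_on (LL a) t" "\<And>y. y \<in> LL a \<Longrightarrow> t y \<noteq> 0"
proof -
  have "LL a \<subseteq> S2 - {b0, be}" using LL_sub(1) ends_notin_LL [OF assms] by blast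
  then show "continuous_on (LL a) t" "\<And>y. y \<in> LL a \<Longrightarrow> t y \<noteq> 0"
    using continuous_on_subset [OF continuous_on_tt [OF b0_N be_N]] tt_nz [OF b0_N be_N] by blast+
qed

lemma pole_above:
  assumes a: "1/2 < a" and i: "i \<le> 2 * n + 1" "a < real i"
  shows "logeq (LL a) (tt (bb i) be) (\<lambda>_. 1)"
proof (rule tt_logeq_1 [where U = "S2 \<inter> hgt -` {a<..2 * real n + 1}"])
  show "connected (S2 \<inter> hgt -` {a<..2 * real n + 1})"
    by (rule connected_hgt_preimage) (use a in auto)
  show "S2 \<inter> hgt -` {a<..2 * real n + 1} \<subseteq> S2 - {N}" using a N_hgt by auto
  show "bb i \<in> S2 \<inter> hgt -` {a<..2 * real n + 1}" "be \<in> S2 \<inter> hgt -` {a<..2 * real n + 1}"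
    using bb [OF i(1)] bb [of "2 * n + 1"] i by auto
qed (use compact_LL LL_sub a in \<open>auto simp: LL_def\<close>)

text \<open>\<open>tt (bb i) be\<close> is \<open>tt (bb i) b0\<close> times \<open>t\<close>, and
  both the zero and the pole of the first factor lie below the slice.\<close>

lemma pole_below:
  assumes a: "1/2 < a" "a < 2 * real n + 1" and i: "i \<le> 2 * n + 1" "real i < a"
  shows "logeq (LL a) (tt (bb i) be) t"
proof -
  let ?U = "S2 \<inter> hgt -` {0..<a}"
  have "openin (top_of_set S2) (S2 \<inter> hgt -` {..<a})"
    by (rule continuous_openin_preimage_gen [OF hgt(1)]) simp
  moreover have "S2 \<inter> hgt -` {..<a} = ?U" using hgt_image by auto
  ultimately have op: "openin (top_of_set S2) ?U" by simp
  have "connected ?U" by (rule connected_hgt_preimage) (use a in auto)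
  \<comment> \<open>The part below the slice contains \<open>N\<close>, which has to be removed
    before the chart applies.\<close>
  then have conn: "connected (?U - {N})"
    by (rule connected_delete [OF op, of be]) (use bb [of "2 * n + 1"] a in auto)
  have "logeq (LL a) (tt (bb i) b0) (\<lambda>_. 1)"
  proof (rule tt_logeq_1 [OF compact_LL _ conn])
    show "bb i \<in> ?U - {N}" "b0 \<in> ?U - {N}"
      using bb [OF i(1)] bb [of 0] bb_N [OF i(1)] b0_N i a by auto
  qed (use LL_sub a in \<open>auto simp: LL_def\<close>)
  then have "logeq (LL a) (\<lambda>y. tt (bb i) b0 y * t y) (\<lambda>y. 1 * t y)"
    by (intro logeq_mult) auto
  moreover have "logeq (LL a) (tt (bb i) be) (\<lambda>y. tt (bb i) b0 y * t y)"
  proof (rule logeq_eq)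
    fix y assume "y \<in> LL a"
    then have "y \<in> S2 - {b0}" using LL_sub(1) ends_notin_LL [of a] a by auto
    then show "tt (bb i) be y = tt (bb i) b0 y * t y"
      using tt_mult [OF bb_N [OF i(1)] b0_N be_N] by simp
  qed
  ultimately show ?thesis by (simp only: mult_1) (rule logeq_trans)
qed

section \<open>Orders of \<open>hh\<close> at the branch points and its exponents along
  slices\<close>

definition ordf :: "(nat \<Rightarrow> real) \<Rightarrow> int" where "ordf b = (SOME m. has_ord hh b m)"
abbreviation "nn i \<equiv> ordf (bb i)"

abbreviation "BB \<equiv> bb ` {..2 * n + 1}"

lemma finite_BB: "finite BB" by simp

lemma hh_BB: "continuous_on (S2 - BB) hh" "y \<in> S2 - BB \<Longrightarrow> hh y \<noteq> 0"
proof -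
  show "continuous_on (S2 - BB) hh" by (rule continuous_on_subset [OF hh(1)]) auto
  show "hh y \<noteq> 0" if "y \<in> S2 - BB" using that hh_eq_0_iff [of y] branch_set_eq by auto
qed

lemma has_ord_nn:
  assumes "i \<le> 2 * n + 1" shows "has_ord hh (bb i) (nn i)"
proof -
  have "\<exists>m. has_ord hh (bb i) m"
  proof (rule has_ord_exists)
    show "openin (top_of_set S2) (S2 - (BB - {bb i}))"
      by (rule openin_minus_finite_X) simp
    show "bb i \<in> S2 - (BB - {bb i})" "bb i \<noteq> N" using bb_N [OF assms] by auto
    have eq: "S2 - (BB - {bb i}) - {bb i} = S2 - BB" using assms by auto
    show "continuous_on (S2 - (BB - {bb i}) - {bb i}) hh" unfolding eq by (rule hh_BB)
    show "hh x \<noteq> 0" if "x \<in> S2 - (BB - {bb i}) - {bb i}" for x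
      using that hh_BB(2) unfolding eq by blast
  qed blast
  then show ?thesis unfolding ordf_def by (rule someI_ex)
qed

lemma BB_minus: "BB - {be} = bb ` {..2 * n}"
proof -
  have "BB = insert be (bb ` {..2 * n})"
    by (metis Suc_eq_plus1 atMost_Suc image_insert)
  moreover have "be \<notin> bb ` {..2 * n}"
  proof
    assume "be \<in> bb ` {..2 * n}"
    then obtain i where i: "i \<le> 2 * n" "be = bb i" by blast
    then have "real (2 * n + 1) = real i" using bb(2) [of i] bb(2) [of "2 * n + 1"] by simp
    then show False using i(1) by simp
  qed
  ultimately show ?thesis by blast
qed

lemma hh_classification:
  "logeq (S2 - BB) hh (\<lambda>y. \<Prod>i\<le>2 * n. tt (bb i) be y powi nn i)"
  "nn (2 * n + 1) = - (\<Sum>i\<le>2 * n. nn i)"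
proof -
  have inj: "inj_on bb {..2 * n}" using bb_inj by (rule inj_on_subset) auto
  have BN: "BB \<subseteq> S2 - {N}" using bb_N by blast
  have beB: "be \<in> BB" by blast
  have o: "has_ord hh a (ordf a)" if "a \<in> BB - {be}" for a
    using that has_ord_nn by auto
  note c = sphere_classification [OF finite_BB BN beB hh_BB o]
  have "(\<Prod>a\<in>BB - {be}. tt a be y powi ordf a) = (\<Prod>i\<le>2 * n. tt (bb i) be y powi nn i)" for y
    unfolding BB_minus by (rule prod.reindex_cong [OF inj]) auto
  then show "logeq (S2 - BB) hh (\<lambda>y. \<Prod>i\<le>2 * n. tt (bb i) be y powi nn i)"
    using c(1) by simp
  have "(\<Sum>a\<in>BB - {be}. ordf a) = (\<Sum>i\<le>2 * n. nn i)"
    unfolding BB_minus by (rule sum.reindex_cong [OF inj]) auto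
  then have "has_ord hh be (- (\<Sum>i\<le>2 * n. nn i))" using c(2) by simp
  then show "nn (2 * n + 1) = - (\<Sum>i\<le>2 * n. nn i)"
    using has_ord_unique has_ord_nn [of "2 * n + 1"] by blast
qed

text \<open>In the product formula for \<open>hh\<close>, a branch point below the slice contributes
  like \<open>t\<close> and one above it contributes nothing. The exponent is thus a partial sum of
  the orders.\<close>

lemma hh_LL:
  assumes a: "1/2 < a" "real j < a" "a < real (Suc j)" "j \<le> 2 * n"
  shows "logeq (LL a) hh (\<lambda>y. t y powi (\<Sum>i\<le>j. nn i))"
proof -
  have "real (Suc j) \<le> real (2 * n + 1)" using a(4) by (simp only: of_nat_le_iff)
  then have a2: "a < 2 * real n + 1" using a(3) by simp
  have "LL a \<subseteq> S2 - BB"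
  proof
    fix y assume y: "y \<in> LL a"
    have "y \<notin> BB"
    proof
      assume "y \<in> BB"
      then obtain i where "i \<le> 2 * n + 1" "y = bb i" by blast
      then have "a = real i" using y bb(2) by (auto simp: LL_def)
      then have "j < i" "i < Suc j" using a(2,3) by simp_all
      then show False by simp
    qed
    then show "y \<in> S2 - BB" using y LL_sub(1) by blast
  qed
  then have "logeq (LL a) hh (\<lambda>y. \<Prod>i\<le>2 * n. tt (bb i) be y powi nn i)"
    by (rule logeq_subset [OF hh_classification(1)])
  also have "logeq (LL a) (\<lambda>y. \<Prod>i\<le>2 * n. tt (bb i) be y powi nn i)
     (\<lambda>y. \<Prod>i\<le>2 * n. t y powi (if i \<le> j then nn i else 0))"
  proof (rule logeq_prod)
    fix i assume i: "i \<in> {..2 * n}"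
    show "logeq (LL a) (\<lambda>y. tt (bb i) be y powi nn i) (\<lambda>y. t y powi (if i \<le> j then nn i else 0))"
    proof (cases "i \<le> j")
      case True
      then have "real i < a" using a(2) by simp
      then have "logeq (LL a) (tt (bb i) be) t" using i by (intro pole_below a(1) a2) auto
      then show ?thesis using True logeq_powi by auto
    next
      case False
      then have "a < real i" using a(3) by simp
      then have "logeq (LL a) (tt (bb i) be) (\<lambda>_. 1)" using i by (intro pole_above a(1)) auto
      then have "logeq (LL a) (\<lambda>y. tt (bb i) be y powi nn i) (\<lambda>y. 1 powi nn i)" by (rule logeq_powi)
      then show ?thesis using False by simp
    qed
  qed
  also have "logeq (LL a) (\<lambda>y. \<Prod>i\<le>2 * n. t y powi (if i \<le> j then nn i else 0)) (\<lambda>y. t y powi (\<Sum>i\<le>j. nn i))"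
  proof (rule logeq_eq)
    fix y assume y: "y \<in> LL a"
    have "t y \<noteq> 0" using t_LL(2) [OF _ a2 y] a by simp
    then have "(\<Prod>i\<le>2 * n. t y powi (if i \<le> j then nn i else 0)) = t y powi (\<Sum>i\<le>2 * n. if i \<le> j then nn i else 0)"
      by (rule powi_sum) simp
    also have "(\<Sum>i\<le>2 * n. if i \<le> j then nn i else 0) = (\<Sum>i\<in>{..2 * n} \<inter> {i. i \<le> j}. nn i)"
      by (simp add: sum.inter_restrict)
    also have "{..2 * n} \<inter> {i. i \<le> j} = {..j}" using a(4) by auto
    finally show "(\<Prod>i\<le>2 * n. t y powi (if i \<le> j then nn i else 0)) = t y powi (\<Sum>i\<le>j. nn i)" .
  qed
  finally show ?thesis .
qed

section \<open>Exponents on a slice of rosette shape\<close>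

context
  fixes a K
  assumes a: "1 \<le> a" "a < 2 * real n + 1" and K: "rosette k K (RR a)"
begin

lemma K_jordan: "jordan_curve K" using K by (simp add: rosette_def)

lemma a_bounds: "0 < a" "1/2 < a" "a \<noteq> 1/2" using a by auto

lemma K_RR: "K \<subseteq> RR a" "th a ` K = LL a" "inj_on (th a) K" "continuous_on K (th a)"
  using rosette_connected [OF K] continuous_on_subset [OF continuous_on_th] by auto

text \<open>\<open>N\<close> lies below the slice, so the part of the sphere above the slice is the
  bounded side in the chart.\<close>

lemma above_inside: "inside (z ` LL a) = z ` (S2 \<inter> hgt -` {a<..})" "jordan_curve (z ` LL a)"
proof -
  have LN: "LL a \<subseteq> S2 - {N}" using LL_sub(2) a_bounds by blast
  have "jordan_curve ((\<lambda>w. z (th a w)) ` K)"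
  proof (rule jordan_curve_image [OF K_jordan])
    show "continuous_on K (\<lambda>w. z (th a w))"
      by (rule continuous_on_compose2 [OF continuous_on_z [OF LN] K_RR(4)]) (use K_RR(2) in auto)
    show "inj_on (\<lambda>w. z (th a w)) K"
    proof (rule inj_onI)
      fix v w assume vw: "v \<in> K" "w \<in> K" "z (th a v) = z (th a w)"
      have "th a v \<in> S2 - {N}" "th a w \<in> S2 - {N}" using vw K_RR(2) LN by blast+
      then have "th a v = th a w" using vw(3) z_eq_iff by simp
      then show "v = w" using K_RR(3) vw by (auto dest: inj_onD)
    qed
  qed
  then show J: "jordan_curve (z ` LL a)" using K_RR(2) by (simp add: image_image flip: K_RR(2))
  let ?J = "z ` LL a" and ?U = "z ` (S2 \<inter> hgt -` {a<..})" and ?V = "z ` (S2 \<inter> hgt -` {..<a} - {N})"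
  have opH: "openin (top_of_set S2) (S2 \<inter> hgt -` T)" if "open T" for T
    by (rule continuous_openin_preimage_gen [OF hgt(1) that])
  have im: "z ` W = z' -` W" if "W \<subseteq> S2 - {N}" for W
  proof
    show "z ` W \<subseteq> z' -` W"
    proof (rule image_subsetI)
      fix x assume x: "x \<in> W"
      then have "x \<in> S2" "x \<noteq> N" using that by auto
      then show "z x \<in> z' -` W" using x by simp
    qed
    show "z' -` W \<subseteq> z ` W" by (metis image_eqI subsetI vimageD z_z')
  qed
  have opz: "open (z ` W)" if "openin (top_of_set S2) W" "W \<subseteq> S2 - {N}" for W
  proof -
    have "openin (top_of_set UNIV) (UNIV \<inter> z' -` W)"
      by (rule continuous_openin_preimage [OF continuous_on_z' _ that(1)]) auto
    then show ?thesis using im [OF that(2)] by simp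
  qed
  have Us: "S2 \<inter> hgt -` {a<..} \<subseteq> S2 - {N}" using N_hgt a_bounds by auto
  have opU: "open ?U" by (rule opz [OF opH Us]) simp
  have opV: "open ?V" by (rule opz [OF openin_minus_finite [OF _ opH]]) auto
  have UV: "?U \<union> ?V = - ?J"
  proof -
    have 1: "(S2 \<inter> hgt -` {a<..}) \<union> (S2 \<inter> hgt -` {..<a} - {N}) = S2 - {N} - LL a"
      using Us by (auto simp: LL_def)
    have 2: "z ` (S2 - {N} - LL a) = z' -` (S2 - {N} - LL a)" by (rule im) blast
    have 3: "z' -` (S2 - {N} - LL a) = - (z' -` LL a)" by auto
    show ?thesis by (simp only: image_Un [symmetric] 1 2 3 im [OF LN])
  qed
  have disj: "?U \<inter> ?V = {}"
  proof -
    have V: "?V = z' -` (S2 \<inter> hgt -` {..<a} - {N})" by (rule im) blast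
    show ?thesis unfolding im [OF Us] V by auto
  qed
  have bdU: "bounded ?U"
  proof -
    have "compact (S2 \<inter> hgt -` {a..})"
      by (rule closedin_compact [OF compact_S2 continuous_closedin_preimage [OF hgt(1)]]) simp
    moreover have "S2 \<inter> hgt -` {a..} \<subseteq> S2 - {N}" using N_hgt a_bounds by auto
    ultimately have "compact (z ` (S2 \<inter> hgt -` {a..}))"
      by (intro compact_continuous_image continuous_on_z)
    then have "bounded (z ` (S2 \<inter> hgt -` {a..}))" by (rule compact_imp_bounded)
    then show ?thesis by (rule bounded_subset) auto
  qed
  have "be \<in> S2 \<inter> hgt -` {a<..}" using bb [of "2 * n + 1"] a by simp
  then have "?U \<noteq> {}" by (simp only: image_is_empty) (metis empty_iff)
  then show "inside ?J = ?U" by (rule inside_eqI [OF J opU opV disj UV bdU])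
qed

text \<open>The zero \<open>b0\<close> lies outside the curve, and its factor has a logarithm; the
  pole at \<open>be\<close>, inside, remains.\<close>

lemma t_pole: "logeq (LL a) t (\<lambda>y. (z y - z be) powi (- 1))"
proof -
  have LN: "LL a \<subseteq> S2 - {N}" using LL_sub(2) a_bounds by blast
  note J = above_inside(2)
  have "z b0 \<notin> inside (z ` LL a)"
  proof
    assume "z b0 \<in> inside (z ` LL a)"
    then obtain y where y: "y \<in> S2" "hgt y > a" "z b0 = z y" using above_inside(1) by auto
    moreover have "y \<noteq> N" using y(2) N_hgt a_bounds by auto
    ultimately have "y = b0" using z_eq_iff b0_N by auto
    then show False using y(2) bb(2) [of 0] a_bounds by simp
  qed
  moreover have "z b0 \<notin> z ` LL a"
  proof
    assume "z b0 \<in> z ` LL a"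
    then obtain y where "y \<in> LL a" "z b0 = z y" by blast
    moreover have "y \<in> S2 - {N}" using calculation(1) LN by blast
    ultimately have "b0 \<in> LL a" using z_eq_iff b0_N by auto
    then show False using ends_notin_LL a a_bounds by blast
  qed
  ultimately have "z b0 \<in> outside (z ` LL a)" using jordan_curve_facts(10) [OF J] by blast
  then have "logeq (z ` LL a) (\<lambda>w. w - z b0) (\<lambda>_. 1)"
    by (rule logeq_outside [OF jordan_curve_facts(1,9) [OF J]])
  then have "logeq (LL a) (\<lambda>y. z y - z b0) (\<lambda>_. 1)"
    by (rule logeq_compose [OF _ continuous_on_z [OF LN]]) simp
  then have "logeq (LL a) (\<lambda>y. (z y - z b0) / (z y - z be)) (\<lambda>y. 1 / (z y - z be))"
    by (intro logeq_divide) auto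
  moreover have "logeq (LL a) t (\<lambda>y. (z y - z b0) / (z y - z be))"
    by (rule logeq_eq) (use LN in \<open>auto simp: tt_def\<close>)
  ultimately have "logeq (LL a) t (\<lambda>y. 1 / (z y - z be))" by (rule logeq_trans [rotated])
  then show ?thesis by (simp only: power_int_minus1_right inverse_eq_divide)
qed

text \<open>In the chart the slice is a Jordan curve around \<open>z be\<close>, so
  \<open>z y - z be\<close> generates; by \<open>t_pole\<close> its inverse \<open>t\<close> does as
  well.\<close>

lemma LL_generator:
  assumes u: "continuous_on (LL a) u" "\<And>y. y \<in> LL a \<Longrightarrow> u y \<noteq> 0"
  obtains x where "logeq (LL a) u (\<lambda>y. t y powi x)"
proof -
  have LN: "LL a \<subseteq> S2 - {N}" using LL_sub(2) a_bounds by blast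
  have zz: "z' (z y) = y" if "y \<in> LL a" for y
  proof (rule z'_z)
    show "y \<in> S2" "y \<noteq> N" using LN that by auto
  qed
  have bi: "z be \<in> inside (z ` LL a)"
    unfolding above_inside(1) using bb [of "2 * n + 1"] a by auto
  obtain x where x: "logeq (z ` LL a) (\<lambda>w. u (z' w)) (\<lambda>w. (w - z be) powi x)"
  proof (rule jordan_generator [OF above_inside(2) bi])
    show "continuous_on (z ` LL a) (\<lambda>w. u (z' w))"
      by (rule continuous_on_compose2 [OF u(1) continuous_on_z']) (use zz in auto)
    show "u (z' w) \<noteq> 0" if "w \<in> z ` LL a" for w using u(2) zz that by auto
  qed
  have "logeq (LL a) (\<lambda>y. u (z' (z y))) (\<lambda>y. (z y - z be) powi x)"
    by (rule logeq_compose [OF x continuous_on_z [OF LN]]) simp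
  moreover have "logeq (LL a) u (\<lambda>y. u (z' (z y)))"
    by (rule logeq_eq) (simp add: zz)
  moreover have "logeq (LL a) (\<lambda>y. (z y - z be) powi x) (\<lambda>y. t y powi (- x))"
  proof -
    have "logeq (LL a) (\<lambda>y. t y powi (- x)) (\<lambda>y. ((z y - z be) powi (- 1)) powi (- x))"
      by (rule logeq_powi [OF t_pole])
    then have "logeq (LL a) (\<lambda>y. t y powi (- x)) (\<lambda>y. (z y - z be) powi x)"
      by (simp only: power_int_mult [symmetric]) simp
    then show ?thesis by (rule logeq_sym)
  qed
  ultimately have "logeq (LL a) u (\<lambda>y. t y powi (- x))"
    using logeq_trans by blast
  then show thesis by (rule that)
qed

lemma inverse_th: "\<exists>\<kappa>. continuous_on (LL a) \<kappa> \<and> \<kappa> ` LL a \<subseteq> K \<and> (\<forall>y\<in>LL a. th a (\<kappa> y) = y) \<and> (\<forall>w\<in>K. \<kappa> (th a w) = w)"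
proof -
  obtain \<kappa> where \<kappa>: "homeomorphism K (LL a) (th a) \<kappa>"
    using homeomorphism_compact [OF jordan_curve_facts(1) [OF K_jordan] K_RR(4,2,3)] by blast
  then have "continuous_on (LL a) \<kappa>" "\<kappa> ` LL a = K" "\<forall>y\<in>LL a. th a (\<kappa> y) = y" "\<forall>w\<in>K. \<kappa> (th a w) = w"
    by (simp_all add: homeomorphism_def)
  then show ?thesis by (intro exI [of _ \<kappa>] conjI) simp_all
qed

lemma on_K: "logeq (LL a) u v \<Longrightarrow> logeq K (\<lambda>w. u (th a w)) (\<lambda>w. v (th a w))"
  by (rule logeq_compose [OF _ K_RR(4)]) (use K_RR(2) in auto)

text \<open>Both \<open>t\<close> and \<open>w - c\<close> generate: each is a power of the other,
  transported along the homeomorphism \<open>th a\<close> between \<open>K\<close> and the slice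
  downstairs. The two exponents multiply to 1.\<close>

lemma t_on_K:
  assumes c: "c \<in> inside K"
  obtains y where "y \<in> {1, -1}" "logeq K (\<lambda>w. t (th a w)) (\<lambda>w. (w - c) powi y)"
proof -
  have tK: "continuous_on K (\<lambda>w. t (th a w))" "\<And>w. w \<in> K \<Longrightarrow> t (th a w) \<noteq> 0"
  proof -
    show "continuous_on K (\<lambda>w. t (th a w))"
      by (rule continuous_on_compose2 [OF t_LL(1) [OF a_bounds(1) a(2)] K_RR(4)]) (use K_RR(2) in auto)
    show "\<And>w. w \<in> K \<Longrightarrow> t (th a w) \<noteq> 0" using t_LL(2) [OF a_bounds(1) a(2)] K_RR(2) by blast
  qed
  obtain y where y: "logeq K (\<lambda>w. t (th a w)) (\<lambda>w. (w - c) powi y)"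
    using jordan_generator [OF K_jordan c tK] .
  obtain \<kappa> where \<kappa>: "continuous_on (LL a) \<kappa>" "\<kappa> ` LL a \<subseteq> K" "\<forall>y\<in>LL a. th a (\<kappa> y) = y" "\<forall>w\<in>K. \<kappa> (th a w) = w"
    using inverse_th by (elim exE conjE)
  obtain x where x: "logeq (LL a) (\<lambda>y. \<kappa> y - c) (\<lambda>y. t y powi x)"
  proof (rule LL_generator)
    show "continuous_on (LL a) (\<lambda>y. \<kappa> y - c)" by (intro continuous_intros \<kappa>)
    show "\<kappa> y - c \<noteq> 0" if "y \<in> LL a" for y using \<kappa>(2) that c by (auto simp: inside_def)
  qed
  have "logeq K (\<lambda>w. (w - c) powi 1) (\<lambda>w. \<kappa> (th a w) - c)"
    by (rule logeq_eq) (simp add: \<kappa>(4))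
  also have "logeq K (\<lambda>w. \<kappa> (th a w) - c) (\<lambda>w. t (th a w) powi x)"
    by (rule on_K [OF x])
  also have "logeq K (\<lambda>w. t (th a w) powi x) (\<lambda>w. ((w - c) powi y) powi x)"
    by (rule logeq_powi [OF y])
  finally have "logeq K (\<lambda>w. (w - c) powi 1) (\<lambda>w. (w - c) powi (y * x))"
    by (simp only: power_int_mult)
  then have "1 = y * x" by (rule logeq_powi_cancel [OF K_jordan c])
  then have "y \<in> {1, -1}" using zmult_eq_1_iff [of y x] by auto
  then show thesis using y by (rule that)
qed

text \<open>By \<open>rosette_outside\<close> all factors except the one with \<open>d = 0\<close>
  have their zeros outside \<open>K\<close>.\<close>

lemma hc_on_K:
  assumes c: "c \<in> inside K"
  shows "logeq K (\<lambda>w. hc c (th a w)) (\<lambda>w. w - c)"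
proof -
  have "logeq K (\<lambda>w. \<Prod>d<k. w - om k ^ d * c) (\<lambda>w. \<Prod>d<k. if d = 0 then w - c else 1)"
  proof (rule logeq_prod)
    fix d assume d: "d \<in> {..<k}"
    show "logeq K (\<lambda>w. w - om k ^ d * c) (\<lambda>w. if d = 0 then w - c else 1)"
    proof (cases "d = 0")
      case False
      then have "om k ^ d * c \<in> outside K" using d by (intro rosette_outside [OF K c]) auto
      then show ?thesis
        using False logeq_outside [OF jordan_curve_facts(1,9) [OF K_jordan]] by simp
    qed simp
  qed
  moreover have "(\<Prod>d<k. if d = 0 then w - c else 1) = w - c" for w
    using k2 by (simp add: prod.delta)
  ultimately have "logeq K (\<lambda>w. \<Prod>d<k. w - om k ^ d * c) (\<lambda>w. w - c)" by simp
  moreover have "logeq K (\<lambda>w. hc c (th a w)) (\<lambda>w. \<Prod>d<k. w - om k ^ d * c)"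
    by (rule logeq_eq) (simp add: th_facts(4) subsetD [OF K_RR(1)])
  ultimately show ?thesis by (rule logeq_trans [rotated])
qed

text \<open>The sign \<open>D\<close> is the exponent of \<open>t\<close> relative to
  \<open>w - c\<close>, so it tells whether \<open>th a\<close> respects the orientations measured
  by these two functions. A sign is its own inverse, which turns \<open>t\<close> as a power of
  \<open>w - c\<close> into \<open>w - c\<close> as a power of \<open>t\<close>.\<close>

lemma D_exists:
  assumes c: "c \<in> inside K"
  obtains D where "D \<in> {1, -1}" "logeq (LL a) (hc c) (\<lambda>y. t y powi D)"
proof -
  obtain D where D: "D \<in> {1, -1}" "logeq K (\<lambda>w. t (th a w)) (\<lambda>w. (w - c) powi D)"
    using t_on_K [OF c] .
  have "logeq K (\<lambda>w. t (th a w) powi D) (\<lambda>w. ((w - c) powi D) powi D)"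
    by (rule logeq_powi [OF D(2)])
  moreover have "(\<lambda>w. ((w - c) powi D) powi D) = (\<lambda>w. w - c)"
    using D(1) by (auto simp: fun_eq_iff simp flip: power_int_mult)
  ultimately have "logeq K (\<lambda>w. t (th a w) powi D) (\<lambda>w. w - c)" by simp
  then have "logeq K (\<lambda>w. hc c (th a w)) (\<lambda>w. t (th a w) powi D)"
    by (rule logeq_trans [OF hc_on_K [OF c] logeq_sym])
  moreover obtain \<kappa> where \<kappa>: "continuous_on (LL a) \<kappa>" "\<kappa> ` LL a \<subseteq> K" "\<forall>y\<in>LL a. th a (\<kappa> y) = y" "\<forall>w\<in>K. \<kappa> (th a w) = w"
    using inverse_th by (elim exE conjE)
  ultimately have "logeq (LL a) (\<lambda>y. hc c (th a (\<kappa> y))) (\<lambda>y. t (th a (\<kappa> y)) powi D)"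
    by (intro logeq_compose [where K = K and \<phi> = \<kappa>])
  moreover have "logeq (LL a) (hc c) (\<lambda>y. hc c (th a (\<kappa> y)))"
    by (rule logeq_eq) (simp add: \<kappa>(3))
  moreover have "logeq (LL a) (\<lambda>y. t (th a (\<kappa> y)) powi D) (\<lambda>y. t y powi D)"
    by (rule logeq_eq) (simp add: \<kappa>(3))
  ultimately have "logeq (LL a) (hc c) (\<lambda>y. t y powi D)"
    using logeq_trans by blast
  with D(1) show thesis by (rule that)
qed

lemma t_powi_on_K:
  assumes "c \<in> inside K" "logeq K (\<lambda>w. t (th a w) powi i) (\<lambda>w. t (th a w) powi j)"
  shows "i = j"
proof -
  obtain y where y: "y \<in> {1, -1}" "logeq K (\<lambda>w. t (th a w)) (\<lambda>w. (w - c) powi y)"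
    using t_on_K [OF assms(1)] .
  have e: "logeq K (\<lambda>w. t (th a w) powi i) (\<lambda>w. (w - c) powi (y * i))" for i
    using logeq_powi [OF y(2), of i] by (simp only: power_int_mult)
  have "logeq K (\<lambda>w. (w - c) powi (y * i)) (\<lambda>w. (w - c) powi (y * j))"
    using logeq_trans [OF logeq_sym [OF e] logeq_trans [OF assms(2) e]] .
  then have "y * i = y * j" by (rule logeq_powi_cancel [OF K_jordan assms(1)])
  then show ?thesis using y(1) by auto
qed

text \<open>Moving the test point within the connected inside of \<open>K\<close> does not change
  the class of \<open>hc c\<close> along \<open>K\<close>.\<close>

lemma D_unique:
  assumes "c \<in> inside K" "logeq (LL a) (hc c) (\<lambda>y. t y powi D)"
    "c' \<in> inside K" "logeq (LL a) (hc c') (\<lambda>y. t y powi D')"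
  shows "D = D'"
proof (rule t_powi_on_K [OF assms(1)])
  have "logeq K (\<lambda>w. w - c) (\<lambda>w. w - c')"
    by (rule logeq_connected_poles [OF jordan_curve_facts(1,6) [OF K_jordan] _ assms(1,3)]) (auto simp: inside_def)
  then have "logeq K (\<lambda>w. hc c (th a w)) (\<lambda>w. hc c' (th a w))"
    using logeq_trans [OF logeq_trans [OF hc_on_K [OF assms(1)]] logeq_sym [OF hc_on_K [OF assms(3)]]] by blast
  then show "logeq K (\<lambda>w. t (th a w) powi D) (\<lambda>w. t (th a w) powi D')"
    using logeq_trans [OF logeq_sym [OF on_K [OF assms(2)]]] logeq_trans on_K [OF assms(4)] by blast
qed

text \<open>If no rotate of \<open>c\<close> were inside \<open>K\<close>, all would be outside,
  since zeros on \<open>K\<close> are excluded, and the whole product would have a logarithm. This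
  recovers an inside test point when \<open>K\<close> was chosen independently of
  \<open>c\<close>.\<close>

lemma D_inside:
  assumes nz: "\<And>y. y \<in> LL a \<Longrightarrow> hc c y \<noteq> 0" and D: "logeq (LL a) (hc c) (\<lambda>y. t y powi D)" "D \<noteq> 0"
  shows "\<exists>d<k. om k ^ d * c \<in> inside K"
proof (rule ccontr)
  assume neg: "\<not> (\<exists>d<k. om k ^ d * c \<in> inside K)"
  obtain c0 where c0: "c0 \<in> inside K" using jordan_curve_facts(4) [OF K_jordan] by blast
  have hcK: "hc c (th a w) = (\<Prod>d<k. w - om k ^ d * c)" if "w \<in> K" for w
    using th_facts(4) K_RR(1) that by blast
  have out: "om k ^ d * c \<in> outside K" if d: "d < k" for d
  proof -
    have "om k ^ d * c \<notin> inside K" using neg d by blast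
    moreover have "om k ^ d * c \<notin> K"
    proof
      assume w: "om k ^ d * c \<in> K"
      have "(\<Prod>e<k. om k ^ d * c - om k ^ e * c) = 0" using d by auto
      then have "hc c (th a (om k ^ d * c)) = 0" using hcK [OF w] by simp
      then show False using nz w K_RR(2) by blast
    qed
    ultimately show ?thesis using jordan_curve_facts(10) [OF K_jordan] by blast
  qed
  have "logeq K (\<lambda>w. \<Prod>d<k. w - om k ^ d * c) (\<lambda>w. \<Prod>d<k. 1)"
    by (rule logeq_prod, rule logeq_outside [OF jordan_curve_facts(1,9) [OF K_jordan]]) (use out in simp)
  then have "logeq K (\<lambda>w. \<Prod>d<k. w - om k ^ d * c) (\<lambda>w. t (th a w) powi 0)" by simp
  moreover have "logeq K (\<lambda>w. hc c (th a w)) (\<lambda>w. \<Prod>d<k. w - om k ^ d * c)"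
    by (rule logeq_eq) (rule hcK)
  ultimately have "logeq K (\<lambda>w. hc c (th a w)) (\<lambda>w. t (th a w) powi 0)" by (rule logeq_trans [rotated])
  then have "logeq K (\<lambda>w. t (th a w) powi D) (\<lambda>w. t (th a w) powi 0)"
    by (rule logeq_trans [OF logeq_sym [OF on_K [OF D(1)]]])
  then have "D = 0" by (rule t_powi_on_K [OF c0])
  then show False using D(2) by simp
qed

text \<open>As \<open>K\<close> misses 0, the coordinate \<open>w\<close> is itself a nonvanishing
  function with some exponent along \<open>K\<close>, and \<open>hh\<close> pulls back to
  \<open>w ^ k\<close>.\<close>

lemma k_dvd:
  assumes "0 \<notin> RR a" "logeq (LL a) hh (\<lambda>y. t y powi W)"
  shows "int k dvd W"
proof -
  obtain c where c: "c \<in> inside K" using jordan_curve_facts(4) [OF K_jordan] by blast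
  obtain y where y: "y \<in> {1, -1}" "logeq K (\<lambda>w. t (th a w)) (\<lambda>w. (w - c) powi y)"
    using t_on_K [OF c] .
  have "0 \<notin> K" using assms(1) K_RR(1) by blast
  then have nz: "w \<noteq> 0" if "w \<in> K" for w using that by blast
  obtain x where x: "logeq K (\<lambda>w. w) (\<lambda>w. (w - c) powi x)"
    using jordan_generator [OF K_jordan c continuous_on_id nz] by blast
  have "logeq K (\<lambda>w. w powi int k) (\<lambda>w. ((w - c) powi x) powi int k)"
    by (rule logeq_powi [OF x])
  then have 1: "logeq K (\<lambda>w. w ^ k) (\<lambda>w. (w - c) powi (x * int k))"
    by (simp only: power_int_mult power_int_of_nat)
  have "logeq K (\<lambda>w. t (th a w) powi W) (\<lambda>w. ((w - c) powi y) powi W)"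
    by (rule logeq_powi [OF y(2)])
  then have 2: "logeq K (\<lambda>w. t (th a w) powi W) (\<lambda>w. (w - c) powi (y * W))"
    by (simp only: power_int_mult)
  have "logeq K (\<lambda>w. w ^ k) (\<lambda>w. hh (th a w))"
    by (rule logeq_eq) (simp add: th_facts(3) subsetD [OF K_RR(1)])
  then have "logeq K (\<lambda>w. w ^ k) (\<lambda>w. t (th a w) powi W)"
    by (rule logeq_trans [OF _ on_K [OF assms(2)]])
  then have "logeq K (\<lambda>w. (w - c) powi (x * int k)) (\<lambda>w. (w - c) powi (y * W))"
    using logeq_trans [OF logeq_trans [OF logeq_sym [OF 1]] 2] by blast
  then have "x * int k = y * W" by (rule logeq_powi_cancel [OF K_jordan c])
  then have "W = (y * x) * int k" using y(1) by auto
  then show ?thesis by simp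
qed

end

end

section \<open>Alternation of the local orders\<close>

context bse_chart
begin

lemma hc_rot: "hc (om k ^ d * c) y = hc c y"
proof (induction d)
  case (Suc d)
  have "hc (om k ^ Suc d * c) y = (\<Prod>e<k. qc (sec y) - om k ^ Suc e * (om k ^ d * c))"
    by (simp add: hc_def mult_ac)
  also have "\<dots> = (\<Prod>e<k. qc (sec y) - om k ^ e * (om k ^ d * c))"
    by (rule prod_shift [where F = "\<lambda>e. qc (sec y) - om k ^ e * (om k ^ d * c)"]) simp
  also have "\<dots> = hc (om k ^ d * c) y" by (simp add: hc_def)
  finally show ?case using Suc by simp
qed simp

text \<open>No curve \<open>K\<close> occurs here: curves at nearby heights are chosen
  independently, whereas this condition involves only the slice downstairs and is open in
  \<open>a\<close>.\<close>

definition level_deg :: "real \<Rightarrow> complex \<Rightarrow> int \<Rightarrow> bool" where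
  "level_deg a c D \<longleftrightarrow> (\<forall>y\<in>LL a. hc c y \<noteq> 0) \<and> logeq (LL a) (hc c) (\<lambda>y. t y powi D)"

text \<open>The logarithm extends to an open set \<open>W\<close> around the slice, and by
  compactness of the complement \<open>W\<close> contains all slices at nearby heights.\<close>

lemma level_deg_near:
  assumes a: "0 < a" "a < 2 * real n + 1" and D: "level_deg a c D"
  shows "\<exists>e>0. \<forall>x. \<bar>x - a\<bar> < e \<longrightarrow> level_deg x c D"
proof -
  define U where "U = (S2 \<inter> hc c -` (- {0})) - {b0, be}"
  have opU: "openin (top_of_set S2) U"
    unfolding U_def
    by (intro openin_minus_finite continuous_openin_preimage_gen [OF hc(1)]) (auto simp: open_Compl)
  have US: "U \<subseteq> S2" by (auto simp: U_def)
  have LU: "LL a \<subseteq> U"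
    using D LL_sub(1) [of a] ends_notin_LL [OF a] by (auto simp: U_def level_deg_def)
  have cl: "closedin (top_of_set U) (LL a)"
    by (rule closedin_subset_trans [OF closedin_LL LU US])
  have Unz: "t y \<noteq> 0" if "y \<in> U" for y
    using tt_nz [OF b0_N be_N, of y] that US by (auto simp: U_def)
  have c1: "continuous_on U (hc c)" by (rule continuous_on_subset [OF hc(1) US])
  have c2: "continuous_on U t"
    by (rule continuous_on_subset [OF continuous_on_tt [OF b0_N be_N]]) (auto simp: U_def)
  have c3: "continuous_on U (\<lambda>y. t y powi D)"
    by (rule continuous_on_power_int [OF c2]) (use Unz in blast)
  have nz3: "t y powi D \<noteq> 0" if "y \<in> U" for y using Unz [OF that] by simp
  have eq: "logeq (LL a) (hc c) (\<lambda>y. t y powi D)" using D by (simp add: level_deg_def)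
  obtain W where W: "openin (top_of_set U) W" "LL a \<subseteq> W" "logeq W (hc c) (\<lambda>y. t y powi D)"
    by (rule logeq_extend_nbhd [OF cl c1 c3 nz3 eq])
  have opW: "openin (top_of_set S2) W" by (rule openin_trans [OF W(1) opU])
  have WU: "W \<subseteq> U" using W(1) openin_imp_subset by blast
  have "closedin (top_of_set S2) (S2 - W)" using opW by (simp add: closedin_diff)
  then have "compact (S2 - W)" by (rule closedin_compact [OF compact_S2])
  then have "compact (hgt ` (S2 - W))"
    by (rule compact_continuous_image [OF continuous_on_subset [OF hgt(1)], rotated]) auto
  then have "open (- hgt ` (S2 - W))" by (simp add: compact_imp_closed open_Compl)
  moreover have "a \<in> - hgt ` (S2 - W)" using W(2) by (auto simp: LL_def)
  ultimately obtain e where e: "e > 0" "ball a e \<subseteq> - hgt ` (S2 - W)" by (meson openE)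
  have "level_deg x c D" if x: "\<bar>x - a\<bar> < e" for x
  proof -
    have "x \<in> ball a e" using x by (simp add: dist_real_def abs_minus_commute)
    then have "x \<notin> hgt ` (S2 - W)" using e(2) by blast
    then have LW: "LL x \<subseteq> W" by (auto simp: LL_def)
    then have "hc c y \<noteq> 0" if "y \<in> LL x" for y using that WU by (auto simp: U_def)
    then show ?thesis using logeq_subset [OF W(3) LW] by (simp add: level_deg_def)
  qed
  then show ?thesis using e(1) by blast
qed

text \<open>Upstairs the slice is a single curve around 0. If \<open>t\<close> pulls back to
  exponent \<open>y\<close> on it, then \<open>hh\<close>, which pulls back to \<open>w ^ k\<close>,
  gives \<open>k = y W\<close>. The rotates of \<open>c\<close> are either all inside the curve or
  all outside. Inside gives \<open>k = y D\<close>; outside gives \<open>y D = 0\<close>, impossible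
  as neither factor vanishes.\<close>

lemma gamma_level:
  assumes m: "m \<le> n" "2 * real m < a" "a < 2 * real m + 1" and a: "1/2 < a"
    and W: "logeq (LL a) hh (\<lambda>y. t y powi W)" and D: "level_deg a c D" "D \<noteq> 0"
  shows "W = D"
proof -
  let ?G = "RR a"
  have J: "jordan_curve ?G" by (rule RR_circle [OF m])
  have I0: "0 \<in> inside ?G" by (rule rotation_inside_0 [OF J rot_RR k2])
  have a2: "0 < a" "a < 2 * real n + 1" using a m by auto
  have G: "th a ` ?G = LL a" by (rule LL_eq [symmetric])
  have thL: "th a w \<in> LL a" if "w \<in> ?G" for w using G that by blast
  have onG: "logeq ?G (\<lambda>w. u (th a w)) (\<lambda>w. v (th a w))" if "logeq (LL a) u v" for u v
    by (rule logeq_compose [OF that continuous_on_th]) (simp add: G)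
  obtain y where y: "logeq ?G (\<lambda>w. t (th a w)) (\<lambda>w. (w - 0) powi y)"
  proof (rule jordan_generator [OF J I0])
    show "continuous_on ?G (\<lambda>w. t (th a w))"
      by (rule continuous_on_compose2 [OF t_LL(1) [OF a2] continuous_on_th]) (simp add: G)
    show "t (th a w) \<noteq> 0" if "w \<in> ?G" for w using t_LL(2) [OF a2 thL [OF that]] .
  qed
  have ty: "logeq ?G (\<lambda>w. t (th a w) powi i) (\<lambda>w. (w - 0) powi (y * i))" for i
    using logeq_powi [OF y, of i] by (simp only: power_int_mult)
  have "logeq ?G (\<lambda>w. (w - 0) powi int k) (\<lambda>w. hh (th a w))"
    by (rule logeq_eq) (simp add: th_facts(3))
  then have "logeq ?G (\<lambda>w. (w - 0) powi int k) (\<lambda>w. (w - 0) powi (y * W))"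
    by (rule logeq_trans [OF _ logeq_trans [OF onG [OF W] ty]])
  then have kW: "int k = y * W" by (rule logeq_powi_cancel [OF J I0])
  have y0: "y \<noteq> 0" using kW k2 by auto
  have hcG: "logeq ?G (\<lambda>w. \<Prod>d<k. w - om k ^ d * c) (\<lambda>w. hc c (th a w))"
    by (rule logeq_eq) (simp add: th_facts(4))
  have Dt: "logeq (LL a) (hc c) (\<lambda>y. t y powi D)" and nz: "\<And>y. y \<in> LL a \<Longrightarrow> hc c y \<noteq> 0"
    using D(1) by (auto simp: level_deg_def)
  have hcD: "logeq ?G (\<lambda>w. \<Prod>d<k. w - om k ^ d * c) (\<lambda>w. (w - 0) powi (y * D))"
    by (rule logeq_trans [OF hcG logeq_trans [OF onG [OF Dt] ty]])
  show ?thesis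
  proof (cases "c \<in> inside ?G")
    case True
    have "logeq ?G (\<lambda>w. \<Prod>d<k. w - om k ^ d * c) (\<lambda>w. \<Prod>d<k. w - 0)"
    proof (rule logeq_prod)
      fix d assume "d \<in> {..<k}"
      have i: "om k ^ d * c \<in> inside ?G" using rotation_inside_iff [OF J rot_RR k2] True by blast
      show "logeq ?G (\<lambda>w. w - om k ^ d * c) (\<lambda>w. w - 0)"
        by (rule logeq_connected_poles [OF jordan_curve_facts(1,6) [OF J] _ i I0]) (auto simp: inside_def)
    qed
    then have "logeq ?G (\<lambda>w. \<Prod>d<k. w - om k ^ d * c) (\<lambda>w. (w - 0) powi int k)" by simp
    then have "logeq ?G (\<lambda>w. (w - 0) powi int k) (\<lambda>w. (w - 0) powi (y * D))"
      by (rule logeq_trans [OF logeq_sym hcD])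
    then have "int k = y * D" by (rule logeq_powi_cancel [OF J I0])
    then show ?thesis using kW y0 by simp
  next
    case False
    have out: "om k ^ d * c \<in> outside ?G" if d: "d < k" for d
    proof -
      have "om k ^ d * c \<notin> inside ?G" using rotation_inside_iff [OF J rot_RR k2] False by blast
      moreover have "om k ^ d * c \<notin> ?G"
      proof
        assume w: "om k ^ d * c \<in> ?G"
        have "(\<Prod>e<k. om k ^ d * c - om k ^ e * c) = 0" using d by auto
        then have "hc c (th a (om k ^ d * c)) = 0" by (simp add: th_facts(4) [OF w])
        then show False using nz thL [OF w] by blast
      qed
      ultimately show ?thesis using jordan_curve_facts(10) [OF J] by blast
    qed
    have "logeq ?G (\<lambda>w. \<Prod>d<k. w - om k ^ d * c) (\<lambda>w. \<Prod>d<k. 1)"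
      by (rule logeq_prod, rule logeq_outside [OF jordan_curve_facts(1,9) [OF J]]) (use out in simp)
    then have "logeq ?G (\<lambda>w. \<Prod>d<k. w - om k ^ d * c) (\<lambda>w. (w - 0) powi 0)" by simp
    then have "logeq ?G (\<lambda>w. (w - 0) powi 0) (\<lambda>w. (w - 0) powi (y * D))"
      by (rule logeq_trans [OF logeq_sym hcD])
    then have "0 = y * D" by (rule logeq_powi_cancel [OF J I0])
    then show ?thesis using y0 D(2) by simp
  qed
qed

lemma hc_nz_LL:
  assumes K: "rosette k K (RR a)" and c: "c \<in> inside K" and y: "y \<in> LL a"
  shows "hc c y \<noteq> 0"
proof -
  obtain w where w: "w \<in> K" "y = th a w" using rosette_connected(1) [OF K] y by blast
  then have "w \<in> RR a" using rosette_connected(2) [OF K] by blast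
  then have "hc c y = (\<Prod>d<k. w - om k ^ d * c)" using th_facts(4) w by simp
  moreover have "w \<noteq> om k ^ d * c" if d: "d < k" for d
  proof (cases "d = 0")
    case True
    have "c \<notin> K" using c by (simp add: inside_def)
    then show ?thesis using True w(1) by auto
  next
    case False
    then have "om k ^ d * c \<in> outside K" using rosette_outside [OF K c] d by simp
    then have "om k ^ d * c \<notin> K" by (simp add: outside_def)
    then show ?thesis using w(1) by auto
  qed
  ultimately show ?thesis by simp
qed

text \<open>Each height has a sign, and it is locally constant: a test point that works at
  \<open>a\<close> keeps its exponent at nearby heights, where \<open>D_inside\<close> puts one of
  its rotates inside the new curve. The interval includes both roses, because these are the heights
  adjacent to the circular slices on either side.\<close>

lemma rosette_levels:
  assumes m: "m \<in> {1..n}"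
  obtains D c c' where "D \<in> {1, -1}" "level_deg (real (2 * m - 1)) c D" "level_deg (real (2 * m)) c' D"
proof -
  let ?I = "{2 * real m - 1..2 * real m}"
  define Kf where "Kf a = (SOME K. rosette k K (RR a))" for a
  have I: "1 \<le> a" "a < 2 * real n + 1" if "a \<in> ?I" for a
  proof -
    have "1 \<le> real m" "real m \<le> real n" using m by auto
    then show "1 \<le> a" "a < 2 * real n + 1" using that by auto
  qed
  have K: "rosette k (Kf a) (RR a)" if "a \<in> ?I" for a
    unfolding Kf_def by (rule someI_ex, rule RR_rosette [OF m]) (use that in auto)
  define PP where "PP a D \<longleftrightarrow> D \<in> {1, -1} \<and> (\<exists>c\<in>inside (Kf a). logeq (LL a) (hc c) (\<lambda>y. t y powi D))" for a D
  have PP_ex: "\<exists>D. PP a D" if a: "a \<in> ?I" for a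
  proof -
    note K_jordan [OF I(1) [OF a] I(2) [OF a] K [OF a]]
    then obtain c where c: "c \<in> inside (Kf a)" using jordan_curve_facts(4) by blast
    obtain D where D: "D \<in> {1, -1}" "logeq (LL a) (hc c) (\<lambda>y. t y powi D)"
      by (rule D_exists [OF I(1) [OF a] I(2) [OF a] K [OF a] c])
    show ?thesis unfolding PP_def by (intro exI [of _ D] conjI D(1) bexI [of _ c] D(2) c)
  qed
  have PP_unique: "D = D'" if a: "a \<in> ?I" and P: "PP a D" "PP a D'" for a D D'
  proof -
    obtain c where c: "c \<in> inside (Kf a)" "logeq (LL a) (hc c) (\<lambda>y. t y powi D)" using P(1) by (auto simp: PP_def)
    obtain c' where c': "c' \<in> inside (Kf a)" "logeq (LL a) (hc c') (\<lambda>y. t y powi D')" using P(2) by (auto simp: PP_def)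
    show ?thesis by (rule D_unique [OF I(1) [OF a] I(2) [OF a] K [OF a] c c'])
  qed
  define f where "f a = (SOME D. PP a D)" for a
  have Pf: "PP a (f a)" if "a \<in> ?I" for a
    unfolding f_def by (rule someI_ex [OF PP_ex [OF that]])
  have lev: "\<exists>c. level_deg a c (f a)" if a: "a \<in> ?I" for a
  proof -
    obtain c where c: "c \<in> inside (Kf a)" "logeq (LL a) (hc c) (\<lambda>y. t y powi f a)" using Pf [OF a] by (auto simp: PP_def)
    then have "level_deg a c (f a)" using hc_nz_LL [OF K [OF a] c(1)] by (simp add: level_deg_def)
    then show ?thesis by blast
  qed
  have "f constant_on ?I"
  proof (rule locally_constant_imp_constant)
    fix a assume a: "a \<in> ?I"
    obtain c where c: "level_deg a c (f a)" using lev [OF a] by blast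
    have "0 < a" using I(1) [OF a] by simp
    then obtain e where e: "e > 0" "\<And>x. \<bar>x - a\<bar> < e \<Longrightarrow> level_deg x c (f a)"
      using level_deg_near [OF _ I(2) [OF a] c] by blast
    have f1: "f a \<in> {1, -1}" using Pf [OF a] by (simp add: PP_def)
    have "f x = f a" if x: "x \<in> ?I \<inter> ball a e" for x
    proof -
      have xI: "x \<in> ?I" using x by blast
      have "level_deg x c (f a)" using e(2) [of x] x by (auto simp: dist_real_def abs_minus_commute)
      then have l: "\<And>y. y \<in> LL x \<Longrightarrow> hc c y \<noteq> 0" "logeq (LL x) (hc c) (\<lambda>y. t y powi f a)"
        by (auto simp: level_deg_def)
      have "f a \<noteq> 0" using f1 by auto
      then obtain d where d: "om k ^ d * c \<in> inside (Kf x)"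
        using D_inside [OF I(1) [OF xI] I(2) [OF xI] K [OF xI] l] by blast
      have "hc (om k ^ d * c) = hc c" by (rule ext) (rule hc_rot)
      then have "logeq (LL x) (hc (om k ^ d * c)) (\<lambda>y. t y powi f a)" using l(2) by simp
      then have "PP x (f a)" using f1 d unfolding PP_def by (intro conjI bexI)
      then show ?thesis using PP_unique [OF xI Pf [OF xI]] by simp
    qed
    then have fT: "\<forall>x\<in>?I \<inter> ball a e. f x = f a" by blast
    have "openin (top_of_set ?I) (?I \<inter> ball a e)" by (rule openin_open_Int) simp
    moreover have "a \<in> ?I \<inter> ball a e" using a e(1) by (intro IntI) simp_all
    ultimately have "openin (top_of_set ?I) (?I \<inter> ball a e) \<and> a \<in> ?I \<inter> ball a e \<and>
      (\<forall>x\<in>?I \<inter> ball a e. f x = f a)" using fT by (intro conjI)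
    then show "\<exists>T. openin (top_of_set ?I) T \<and> a \<in> T \<and> (\<forall>x\<in>T. f x = f a)"
      by (rule exI [where x = "?I \<inter> ball a e"])
  qed simp
  then obtain D where D: "\<And>a. a \<in> ?I \<Longrightarrow> f a = D" by (auto simp: constant_on_def)
  have ends: "real (2 * m - 1) \<in> ?I" "real (2 * m) \<in> ?I" using m by (auto simp: of_nat_diff)
  have "D \<in> {1, -1}" using Pf [OF ends(1)] D [OF ends(1)] by (simp add: PP_def)
  moreover obtain c where "level_deg (real (2 * m - 1)) c D" using lev [OF ends(1)] D [OF ends(1)] by auto
  moreover obtain c' where "level_deg (real (2 * m)) c' D" using lev [OF ends(2)] D [OF ends(2)] by auto
  ultimately show thesis by (rule that)
qed

text \<open>By \<open>hh_LL\<close>, the exponent of \<open>hh\<close> along the circular slices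
  between heights \<open>2 m\<close> and \<open>2 m + 1\<close> (above 1/2 when
  \<open>m = 0\<close>).\<close>

definition WW :: "nat \<Rightarrow> int" where "WW m = (\<Sum>i\<le>2 * m. nn i)"

lemma WW_near:
  assumes m: "m \<le> n" and a: "a = real (2 * m) \<or> a = real (2 * m + 1)" "1 \<le> a" "a < 2 * real n + 1"
    and D: "level_deg a c D" "D \<noteq> 0"
  shows "WW m = D"
proof -
  have "0 < a" using a by simp
  then obtain e where e: "e > 0" "\<And>x. \<bar>x - a\<bar> < e \<Longrightarrow> level_deg x c D"
    using level_deg_near [OF _ a(3) D(1)] by blast
  \<comment> \<open>Small enough to stay within \<open>e\<close> of \<open>a\<close>, in the
    interval of circular slices and above height 1/2, whether \<open>x\<close> is taken above or
    below \<open>a\<close>.\<close>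
  define \<delta> where "\<delta> = min e 1 / 3"
  have \<delta>: "0 < \<delta>" "\<delta> < e" "\<delta> \<le> 1/3" using e(1) by (auto simp: \<delta>_def)
  obtain x where x: "\<bar>x - a\<bar> < e" "2 * real m < x" "x < 2 * real m + 1" "1/2 < x"
  proof (cases "a = real (2 * m)")
    case True
    then show thesis using that [of "a + \<delta>"] \<delta> a(2) by auto
  next
    case False
    then have "a = 2 * real m + 1" using a(1) by simp
    then show thesis using that [of "a - \<delta>"] \<delta> by auto
  qed
  have "logeq (LL x) hh (\<lambda>y. t y powi (\<Sum>i\<le>2 * m. nn i))"
    by (rule hh_LL) (use x m in auto)
  then show ?thesis
    unfolding WW_def by (rule gamma_level [OF m x(2,3,4) _ e(2) [OF x(1)] D(2)])
qed

text \<open>The sign found on the interval from \<open>2 m - 1\<close> to \<open>2 m\<close> is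
  valid at both ends, so it equals the exponents of the circular slices just below and just
  above.\<close>

lemma WW_constant: "WW 0 \<in> {1, -1} \<and> (\<forall>m\<le>n. WW m = WW 0)"
proof -
  have step: "\<exists>D\<in>{1, -1}. WW (m - 1) = D \<and> WW m = D" if m: "m \<in> {1..n}" for m
  proof -
    obtain D c c' where D: "D \<in> {1, -1}" "level_deg (real (2 * m - 1)) c D" "level_deg (real (2 * m)) c' D"
      by (rule rosette_levels [OF m])
    have D0: "D \<noteq> 0" using D(1) by auto
    have m1: "1 \<le> real m" "real m \<le> real n" using m by auto
    have eq: "2 * m - 1 = 2 * (m - 1) + 1" using m by auto
    have "WW (m - 1) = D"
      by (rule WW_near [OF _ _ _ _ D(2) D0]) (use m m1 eq in \<open>auto simp: of_nat_diff\<close>)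
    moreover have "WW m = D"
      by (rule WW_near [OF _ _ _ _ D(3) D0]) (use m m1 in auto)
    ultimately show ?thesis using D(1) by blast
  qed
  have "WW m = WW 0" if "m \<le> n" for m
    using that
  proof (induction m)
    case (Suc m)
    then show ?case using step [of "Suc m"] by auto
  qed simp
  moreover have "WW 0 \<in> {1, -1}" using step [of 1] n1 by auto
  ultimately show ?thesis by blast
qed

lemma dvd_partial_sum:
  assumes "m < n" shows "int k dvd (\<Sum>i\<le>2 * m + 1. nn i)"
proof -
  \<comment> \<open>The midpoint between \<open>2 m + 1\<close> and \<open>2 m + 2\<close>, where
    the slice consists of \<open>k\<close> curves off the axis; the branch points below it are those
    of index at most \<open>2 m + 1\<close>.\<close>
  let ?a = "2 * real m + 3/2"
  have sm: "Suc m \<in> {1..n}" using assms by auto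
  have am: "2 * real (Suc m) - 1 < ?a" "?a < 2 * real (Suc m)" by auto
  obtain K where K: "rosette k K (RR ?a)" using RR_curves(1) [OF sm am] by blast
  have "real (Suc m) \<le> real n" using assms by simp
  then have a: "1 \<le> ?a" "?a < 2 * real n + 1" by auto
  have "logeq (LL ?a) hh (\<lambda>y. t y powi (\<Sum>i\<le>2 * m + 1. nn i))"
    by (rule hh_LL) (use assms in auto)
  then show ?thesis by (rule k_dvd [OF a K RR_curves(2) [OF sm am]])
qed

text \<open>The local monodromy of the cover alternates in sign along the axis.\<close>

lemma nn_mod:
  obtains v where "v \<in> {1, -1}" "\<And>i. i \<le> 2 * n + 1 \<Longrightarrow> int k dvd nn i - (- 1) ^ i * v"
proof -
  let ?v = "WW 0"
  have v: "?v \<in> {1, -1}" and W: "\<And>m. m \<le> n \<Longrightarrow> (\<Sum>i\<le>2 * m. nn i) = ?v"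
    using WW_constant by (auto simp: WW_def)
  have "int k dvd nn i - (- 1) ^ i * ?v" if i: "i \<le> 2 * n + 1" for i
  proof (cases "even i")
    case True
    then obtain m where m: "i = 2 * m" by blast
    show ?thesis
    proof (cases m)
      case 0
      then show ?thesis using W [of 0] m by simp
    next
      case (Suc m')
      define s where "s = (\<Sum>j\<le>2 * m' + 1. nn j)"
      have "nn i = ?v - s" using W [of m] i m Suc by (simp add: s_def)
      moreover have "int k dvd s" unfolding s_def by (rule dvd_partial_sum) (use i m Suc in simp)
      ultimately show ?thesis using m by simp
    qed
  next
    case False
    then obtain m where m: "i = 2 * m + 1" by (auto elim: oddE)
    show ?thesis
    proof (cases "m = n")
      case True
      then have "nn i = - ?v" using hh_classification(2) W [of n] m by simp
      then show ?thesis using m by simp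
    next
      case False
      then have mn: "m < n" using i m by simp
      define s where "s = (\<Sum>j\<le>2 * m + 1. nn j)"
      have "s = ?v + nn i" using W [of m] mn m by (simp add: s_def)
      moreover have "int k dvd s" unfolding s_def by (rule dvd_partial_sum [OF mn])
      ultimately show ?thesis using m by (simp add: add.commute)
    qed
  qed
  with v show thesis by (rule that)
qed

end

section \<open>The lifting criterion\<close>

text \<open>The restriction of a closed map to the full preimage of a subset is again closed. This
  allows subsets \<open>T\<close> that are not closed, such as the sphere without the branch
  points.\<close>

lemma continuous_on_descend_subset:
  fixes \<phi> :: "'a::t2_space \<Rightarrow> 'b::t2_space" and m :: "'a \<Rightarrow> 'c::topological_space"
  assumes "compact A" "continuous_on A \<phi>" "T \<subseteq> \<phi> ` A" and m: "continuous_on (A \<inter> \<phi> -` T) m"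
    and l: "\<And>x. x \<in> A \<inter> \<phi> -` T \<Longrightarrow> l (\<phi> x) = m x"
  shows "continuous_on T l"
proof -
  have "closedin (top_of_set T) (T \<inter> l -` C)" if C: "closed C" for C
  proof -
    have "closedin (top_of_set (A \<inter> \<phi> -` T)) (A \<inter> \<phi> -` T \<inter> m -` C)"
      using continuous_closedin_preimage [OF m C] .
    then obtain E where E: "closed E" "A \<inter> \<phi> -` T \<inter> m -` C = A \<inter> \<phi> -` T \<inter> E"
      by (auto simp: closedin_closed)
    have "T \<inter> l -` C = T \<inter> \<phi> ` (A \<inter> E)"
    proof
      show "T \<inter> l -` C \<subseteq> T \<inter> \<phi> ` (A \<inter> E)"
      proof
        fix y assume y: "y \<in> T \<inter> l -` C"
        then obtain x where x: "x \<in> A" "y = \<phi> x" using assms(3) by blast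
        then have "x \<in> A \<inter> \<phi> -` T \<inter> m -` C" using y l [of x] by simp
        then have "x \<in> A \<inter> E" using E(2) by blast
        then show "y \<in> T \<inter> \<phi> ` (A \<inter> E)" using x y by blast
      qed
      show "T \<inter> \<phi> ` (A \<inter> E) \<subseteq> T \<inter> l -` C"
      proof
        fix y assume "y \<in> T \<inter> \<phi> ` (A \<inter> E)"
        then obtain x where x: "x \<in> A" "x \<in> E" "y = \<phi> x" "y \<in> T" by blast
        then have "x \<in> A \<inter> \<phi> -` T \<inter> m -` C" using E(2) by blast
        then show "y \<in> T \<inter> l -` C" using x l [of x] by simp
      qed
    qed
    moreover have "compact (A \<inter> E)" by (rule compact_Int_closed [OF assms(1) E(1)])
    then have "compact (\<phi> ` (A \<inter> E))"
      by (rule compact_continuous_image [OF continuous_on_subset [OF assms(2)], rotated]) auto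
    then have "closed (\<phi> ` (A \<inter> E))" by (rule compact_imp_closed)
    ultimately show ?thesis by (simp add: closedin_closed_Int)
  qed
  then show ?thesis unfolding continuous_closedin_preimage_eq by blast
qed

lemma homeomorphic_map_top_of_set:
  assumes "homeomorphism T T f g" shows "homeomorphic_map (top_of_set T) (top_of_set T) f"
proof -
  have "f \<in> T \<rightarrow> T" "g \<in> T \<rightarrow> T" using assms by (auto simp: homeomorphism_def)
  then have "homeomorphic_maps (top_of_set T) (top_of_set T) f g"
    using assms by (auto simp: homeomorphic_maps_def homeomorphism_def)
  then show ?thesis using homeomorphic_map_maps by blast
qed

lemma root_of_unity_om:
  assumes "k > 0" "w ^ k = 1" obtains i where "i < k" "w = om k ^ i"
proof -
  have "bij_betw (\<lambda>i. cis (2 * pi * real i / real k)) {..<k} {z. z ^ k = 1}"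
    by (rule Complex.bij_betw_roots_unity [OF assms(1)])
  then obtain i where "i < k" "w = cis (2 * pi * real i / real k)"
    using assms(2) by (auto simp: bij_betw_def image_iff)
  moreover have "cis (2 * pi * real i / real k) = om k ^ i"
    by (simp add: om_def Complex.DeMoivre mult_ac)
  ultimately show thesis using that by simp
qed

context bse_cover
begin

section \<open>Fibres over the complement of the branch points\<close>

definition S0 :: "(real^3) set" where "S0 = {x \<in> S. qc x \<noteq> 0}"

lemma p_S0: "x \<in> S \<Longrightarrow> p x \<in> branch_set k S p \<longleftrightarrow> qc x = 0"
  using hh_eq_0_iff [OF p_in] hh(2) k2 by fastforce

lemma S0_eq: "S0 = S \<inter> p -` (S2 - branch_set k S p)"
  using p_S0 p_in by (auto simp: S0_def)

lemma zeta_S0: "x \<in> S0 \<Longrightarrow> (zeta k ^^ i) x \<in> S0"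
  by (simp add: S0_def zeta_pow_in_S)

lemma p_zeta: "x \<in> S \<Longrightarrow> p ((zeta k ^^ i) x) = p x"
  using cover zeta_pow_in_S unfolding balanced_superelliptic_cover_def by metis

lemma same_fibre_eq:
  assumes "x \<in> S" "y \<in> S" "p x = p y" "qc x = qc y"
  shows "x = y"
  using assms p_eq_iff qc_eqI by blast

lemma same_fibre_zeta:
  assumes "x \<in> S" "y \<in> S" "p x = p y"
  obtains i where "i < k" "y = (zeta k ^^ i) x"
proof -
  obtain i where "x$3 = y$3" "i < k" "qc y = om k ^ i * qc x"
    using assms p_eq_iff by blast
  then have "y = (zeta k ^^ i) x" by (intro qc_eqI) simp_all
  with \<open>i < k\<close> show thesis by (rule that)
qed

lemma descend_S0:
  fixes m :: "real^3 \<Rightarrow> 'c::topological_space"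
  assumes m: "continuous_on S0 m" "\<And>x. x \<in> S0 \<Longrightarrow> m (zeta k x) = m x"
  shows "continuous_on (S2 - branch_set k S p) (\<lambda>y. m (sec y))" "\<And>x. x \<in> S0 \<Longrightarrow> m (sec (p x)) = m x"
proof -
  have pow: "m ((zeta k ^^ i) x) = m x" if "x \<in> S0" for x i
    by (induction i) (use m(2) zeta_S0 that in auto)
  show e: "m (sec (p x)) = m x" if x: "x \<in> S0" for x
  proof -
    have xS: "x \<in> S" using x by (simp add: S0_def)
    have "p x = p (sec (p x))" using sec(2) [OF p_in [OF xS]] by simp
    then obtain i where "sec (p x) = (zeta k ^^ i) x"
      by (rule same_fibre_zeta [OF xS sec(1) [OF p_in [OF xS]]])
    then show ?thesis using pow [OF x] by simp
  qed
  show "continuous_on (S2 - branch_set k S p) (\<lambda>y. m (sec y))"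
  proof (rule continuous_on_descend_subset [OF compact_S continuous_on_p])
    show "S2 - branch_set k S p \<subseteq> p ` S" using p_S by blast
    show "continuous_on (S \<inter> p -` (S2 - branch_set k S p)) m" using m(1) by (simp add: S0_eq)
    show "m (sec (p x)) = m x" if "x \<in> S \<inter> p -` (S2 - branch_set k S p)" for x
      using e that by (simp add: S0_eq)
  qed
qed

text \<open>The lift is prescribed by its planar coordinate \<open>G\<close>, whose
  \<open>k\<close>-th power is \<open>hh (f (p x))\<close>; exactly one point over
  \<open>f (p x)\<close> has this coordinate, and over a branch point the fibre is a single point.
  The value of \<open>u\<close> gives bijectivity: multiplication by \<open>om k ^ i\<close>
  upstairs turns into multiplication by its \<open>u\<close>-th power.\<close>

lemma lift_exists:
  assumes f: "homeomorphism S2 S2 f f'" "f ` branch_set k S p = branch_set k S p"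
    and u: "u \<in> {1, -1::int}" and r: "continuous_on (S2 - branch_set k S p) r"
    and eq: "\<And>y. y \<in> S2 - branch_set k S p \<Longrightarrow> hh (f y) = hh y powi u * r y ^ k"
  shows "liftable S p f"
proof -
  let ?B = "branch_set k S p"
  have fX: "f y \<in> S2" if "y \<in> S2" for y using homeomorphism_image1 [OF f(1)] that by blast
  have f'X: "f' y \<in> S2" if "y \<in> S2" for y using homeomorphism_image2 [OF f(1)] that by blast
  have finj: "y = y'" if "y \<in> S2" "y' \<in> S2" "f y = f y'" for y y'
    using homeomorphism_apply1 [OF f(1)] that by metis
  have BX: "?B \<subseteq> S2" by (rule branch_set_subset [OF cover])
  have fB: "f y \<in> ?B \<longleftrightarrow> y \<in> ?B" if y: "y \<in> S2" for y
  proof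
    assume "f y \<in> ?B"
    then obtain b where b: "b \<in> ?B" "f y = f b" using f(2) by blast
    then show "y \<in> ?B" using finj [OF y _ b(2)] BX by blast
  qed (use f(2) in blast)
  have cf: "continuous_on S2 f" using f(1) by (simp add: homeomorphism_def)
  define G where "G x = qc x powi u * r (p x)" for x
  have pS0: "p x \<in> S2 - ?B" if "x \<in> S0" for x using that by (simp add: S0_eq)
  have S0S: "x \<in> S" if "x \<in> S0" for x using that by (simp add: S0_def)
  have Gk: "G x ^ k = hh (f (p x))" if x: "x \<in> S0" for x
  proof -
    have "G x ^ k = (qc x powi u) ^ k * r (p x) ^ k" by (simp add: G_def power_mult_distrib)
    also have "(qc x powi u) ^ k = (qc x ^ k) powi u"
      by (metis power_int_mult power_int_of_nat mult.commute)
    finally show ?thesis using eq [OF pS0 [OF x]] hh(2) [OF S0S [OF x]] by simp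
  qed
  have Gc: "continuous_on S0 G"
  proof -
    have "continuous_on S0 (\<lambda>x. r (p x))"
      by (rule continuous_on_compose2 [OF r continuous_on_subset [OF continuous_on_p]]) (use pS0 S0S in auto)
    moreover have "continuous_on S0 (\<lambda>x. qc x powi u)"
      by (intro continuous_on_power_int continuous_on_qc) (auto simp: S0_def)
    ultimately show ?thesis unfolding G_def by (rule continuous_on_mult [rotated])
  qed
  have Gz: "G ((zeta k ^^ i) x) = (om k ^ i) powi u * G x" if "x \<in> S0" for i x
    using p_zeta [OF S0S [OF that], of i] by (simp add: G_def power_int_mult_distrib)
  define ok where "ok x x' \<longleftrightarrow> x' \<in> S \<and> p x' = f (p x) \<and> (qc x \<noteq> 0 \<longrightarrow> qc x' = G x)" for x x'
  have ok_ex: "\<exists>x'. ok x x'" if x: "x \<in> S" for x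
  proof (cases "qc x = 0")
    case True
    have "ok x (sec (f (p x)))"
      using sec [OF fX [OF p_in [OF x]]] True by (simp add: ok_def)
    then show ?thesis by blast
  next
    case False
    then have x0: "x \<in> S0" using x by (simp add: S0_def)
    let ?s = "sec (f (p x))"
    have fp: "f (p x) \<in> S2" by (rule fX [OF p_in [OF x]])
    have s: "?s \<in> S" "p ?s = f (p x)" using sec [OF fp] by auto
    have "f (p x) \<notin> ?B" using fB [OF p_in [OF x]] p_S0 [OF x] False by blast
    then have s0: "qc ?s \<noteq> 0" using p_S0 [OF s(1)] s(2) by simp
    have "G x ^ k = qc ?s ^ k" using Gk [OF x0] hh(2) [OF s(1)] s(2) by simp
    then have "(G x / qc ?s) ^ k = 1" using s0 by (simp add: power_divide)
    then obtain i where "G x / qc ?s = om k ^ i"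
      by (rule root_of_unity_om [rotated]) (use k2 in auto)
    then have "qc ((zeta k ^^ i) ?s) = G x" using s0 by (simp add: divide_simps)
    then have "ok x ((zeta k ^^ i) ?s)"
      using zeta_pow_in_S [OF s(1)] p_zeta [OF s(1)] s(2) by (simp add: ok_def)
    then show ?thesis by blast
  qed
  have zero: "qc x' = 0" if x: "x \<in> S" "qc x = 0" and x': "x' \<in> S" "p x' = f (p x)" for x x'
  proof -
    have "p x \<in> ?B" using p_S0 [OF x(1)] x(2) by simp
    then have "p x' \<in> ?B" using fB [OF p_in [OF x(1)]] x'(2) by simp
    then show ?thesis using p_S0 [OF x'(1)] by simp
  qed
  have ok_unique: "a = b" if x: "x \<in> S" and ab: "ok x a" "ok x b" for x a b
  proof (rule same_fibre_eq)
    show "qc a = qc b"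
    proof (cases "qc x = 0")
      case True
      then show ?thesis using zero [OF x True] ab by (simp add: ok_def)
    qed (use ab in \<open>simp add: ok_def\<close>)
  qed (use ab in \<open>simp_all add: ok_def\<close>)
  define F where "F x = (SOME x'. ok x x')" for x
  have F: "ok x (F x)" if "x \<in> S" for x
    unfolding F_def by (rule someI_ex [OF ok_ex [OF that]])
  have FS: "F x \<in> S" "p (F x) = f (p x)" if "x \<in> S" for x using F [OF that] by (auto simp: ok_def)
  have FG: "qc (F x) = G x" if "x \<in> S0" for x
    using F [of x] that by (simp add: ok_def S0_def)
  \<comment> \<open>The closed graph treats the points on the axis, where \<open>G\<close> does not
    determine the lift, together with all others.\<close>
  have cont: "continuous_on S F"
  proof (rule continuous_from_closed_graph [OF compact_S])
    show "F \<in> S \<rightarrow> S" using FS by blast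
    show "closed ((\<lambda>x. (x, F x)) ` S)"
      unfolding closed_sequential_limits
    proof (intro allI impI, elim conjE)
      fix X :: "nat \<Rightarrow> (real^3) \<times> (real^3)" and L
      assume X: "\<forall>i. X i \<in> (\<lambda>x. (x, F x)) ` S" and lim: "X \<longlonglongrightarrow> L"
      obtain x y where L: "L = (x, y)" by (cases L)
      define a where "a i = fst (X i)" for i
      have a: "a i \<in> S" "X i = (a i, F (a i))" for i
        using X by (auto simp: a_def image_iff) (metis fst_conv)+
      have la: "a \<longlonglongrightarrow> x"
      proof -
        have "a = (\<lambda>i. fst (X i))" by (simp add: a_def fun_eq_iff)
        then show ?thesis using tendsto_fst [OF lim] L by simp
      qed
      have lb: "(\<lambda>i. F (a i)) \<longlonglongrightarrow> y"
        using tendsto_snd [OF lim] L a(2) by simp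
      have clS: "closed S" by (rule compact_imp_closed [OF compact_S])
      have xS: "x \<in> S" by (rule closed_sequentially [OF clS _ la]) (use a in blast)
      have yS: "y \<in> S" by (rule closed_sequentially [OF clS _ lb]) (use FS a in blast)
      have "(\<lambda>i. p (F (a i))) \<longlonglongrightarrow> p y"
        by (rule continuous_on_tendsto_compose [OF continuous_on_p lb yS]) (use FS a in simp)
      moreover have "(\<lambda>i. f (p (a i))) \<longlonglongrightarrow> f (p x)"
      proof (rule continuous_on_tendsto_compose [OF cf])
        show "(\<lambda>i. p (a i)) \<longlonglongrightarrow> p x"
          by (rule continuous_on_tendsto_compose [OF continuous_on_p la xS]) (use a in simp)
      qed (use p_in xS a in auto)
      moreover have "(\<lambda>i. p (F (a i))) = (\<lambda>i. f (p (a i)))" using FS a by simp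
      ultimately have py: "p y = f (p x)" using LIMSEQ_unique by metis
      have "ok x y"
      proof (cases "qc x = 0")
        case False
        then have x0: "x \<in> S0" using xS by (simp add: S0_def)
        have lq: "(\<lambda>i. qc (a i)) \<longlonglongrightarrow> qc x"
          by (rule continuous_on_tendsto_compose [OF continuous_on_qc [of UNIV] la]) auto
        have ev: "\<forall>\<^sub>F i in sequentially. a i \<in> S0"
          using tendsto_imp_eventually_ne [OF lq False] by eventually_elim (use a in \<open>simp add: S0_def\<close>)
        have "(\<lambda>i. G (a i)) \<longlonglongrightarrow> G x"
          by (rule continuous_on_tendsto_compose [OF Gc la x0 ev])
        moreover have "(\<lambda>i. qc (F (a i))) \<longlonglongrightarrow> qc y"
          by (rule continuous_on_tendsto_compose [OF continuous_on_qc [of UNIV] lb]) auto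
        moreover have "\<forall>\<^sub>F i in sequentially. qc (F (a i)) = G (a i)"
          using ev by eventually_elim (rule FG)
        ultimately have "(\<lambda>i. G (a i)) \<longlonglongrightarrow> qc y" using tendsto_cong by metis
        then have "qc y = G x" using \<open>(\<lambda>i. G (a i)) \<longlonglongrightarrow> G x\<close> LIMSEQ_unique by blast
        then show ?thesis using yS py by (simp add: ok_def)
      qed (use yS py in \<open>simp add: ok_def\<close>)
      then have "y = F x" using ok_unique [OF xS _ F [OF xS]] by blast
      then show "L \<in> (\<lambda>x. (x, F x)) ` S" using L xS by blast
    qed
  qed
  have om_u: "(om k ^ i) powi u = 1 \<longleftrightarrow> om k ^ i = 1" for i using u by (auto simp: power_int_minus)
  have inj: "inj_on F S"
  proof (rule inj_onI)
    fix x x' assume x: "x \<in> S" "x' \<in> S" "F x = F x'"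
    then have "f (p x) = f (p x')" using FS by metis
    then have pp: "p x = p x'" using finj p_in x(1,2) by blast
    then obtain i where i: "x' = (zeta k ^^ i) x" by (rule same_fibre_zeta [OF x(1,2)])
    show "x = x'"
    proof (rule same_fibre_eq [OF x(1,2) pp])
      show "qc x = qc x'"
      proof (cases "qc x = 0")
        case False
        then have x0: "x \<in> S0" using x(1) by (simp add: S0_def)
        have "G x' = G x" using FG x0 zeta_S0 [OF x0] i x(3) by metis
        moreover have "G x \<noteq> 0"
        proof -
          have "f (p x) \<in> S2" "f (p x) \<notin> ?B" using fX fB pS0 [OF x0] by auto
          then show ?thesis using Gk [OF x0] hh_eq_0_iff k2 by (metis zero_power zero_less_numeral less_le_trans)
        qed
        ultimately have "(om k ^ i) powi u = 1" using Gz [OF x0, of i] i by simp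
        then show ?thesis using om_u i by simp
      qed (simp add: i)
    qed
  qed
  have surj: "F ` S = S"
  proof
    show "F ` S \<subseteq> S" using FS by blast
    show "S \<subseteq> F ` S"
    proof
      fix y assume y: "y \<in> S"
      define x where "x = sec (f' (p y))"
      have x: "x \<in> S" "p x = f' (p y)" using sec [OF f'X [OF p_in [OF y]]] by (auto simp: x_def)
      have pFx: "p (F x) = p y"
        using FS(2) [OF x(1)] x(2) homeomorphism_apply2 [OF f(1) p_in [OF y]] by simp
      obtain j where j: "j < k" "y = (zeta k ^^ j) (F x)"
        by (rule same_fibre_zeta [OF FS(1) [OF x(1)] y pFx])
      show "y \<in> F ` S"
      proof (cases "qc x = 0")
        case True
        then have "qc (F x) = 0" using zero [OF x(1) True] FS [OF x(1)] by blast
        then have "y = F x" using j by (intro qc_eqI) simp_all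
        then show ?thesis using x(1) by blast
      next
        case False
        then have x0: "x \<in> S0" using x(1) by (simp add: S0_def)
        obtain i where i: "(om k ^ i) powi u = om k ^ j"
        proof (cases "u = 1")
          case True
          then show thesis using that [of j] by simp
        next
          case False
          then have "u = -1" using u by simp
          moreover have "om k ^ (k - j) * om k ^ j = 1" using j(1) by (simp flip: power_add)
          then have "inverse (om k ^ (k - j)) = om k ^ j" by (rule inverse_unique)
          ultimately show thesis using that [of "k - j"] by simp
        qed
        let ?x = "(zeta k ^^ i) x"
        have x0': "?x \<in> S0" by (rule zeta_S0 [OF x0])
        have "qc (F ?x) = om k ^ j * qc (F x)" using FG [OF x0'] FG [OF x0] Gz [OF x0, of i] i by simp
        then have "qc (F ?x) = qc y" using j(2) by simp
        moreover have "p (F ?x) = p y"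
          using FS(2) [OF S0S [OF x0']] p_zeta [OF x(1), of i] FS(2) [OF x(1)] pFx by simp
        ultimately have "F ?x = y" using same_fibre_eq [OF FS(1) [OF S0S [OF x0']] y] by blast
        then show ?thesis using S0S [OF x0'] by blast
      qed
    qed
  qed
  obtain F' where "homeomorphism S S F F'"
    using homeomorphism_compact [OF compact_S cont surj inj] by blast
  then have "homeomorphic_map (top_of_set S) (top_of_set S) F" by (rule homeomorphic_map_top_of_set)
  then show ?thesis unfolding liftable_def using FS(2) by blast
qed

section \<open>From a lift to an exponent\<close>

lemma connected_S2_minus:
  assumes "finite A" "b \<in> A" "A \<subseteq> S2" shows "connected (S2 - A)"
proof -
  obtain y y' where y: "homeomorphism (S2 - {b}) (UNIV::complex set) y y'"
    using S2_minus_point [of b] assms by (auto simp: homeomorphic_def)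
  let ?C = "y ` (A - {b})"
  have "connected (UNIV - ?C)"
    by (rule connected_open_delete_finite) (use assms in auto)
  moreover have "continuous_on (UNIV - ?C) y'" using y by (auto simp: homeomorphism_def intro: continuous_on_subset)
  ultimately have "connected (y' ` (UNIV - ?C))" by (rule connected_continuous_image [rotated])
  moreover have "y' ` (UNIV - ?C) = S2 - A"
  proof
    show "y' ` (UNIV - ?C) \<subseteq> S2 - A"
    proof (rule image_subsetI)
      fix w assume w: "w \<in> UNIV - ?C"
      have "y' w \<in> S2 - {b}" using homeomorphism_image2 [OF y] by blast
      moreover have "y' w \<notin> A - {b}"
      proof
        assume "y' w \<in> A - {b}"
        then have "y (y' w) \<in> ?C" by (rule imageI)
        then show False using w homeomorphism_apply2 [OF y] by simp
      qed
      ultimately show "y' w \<in> S2 - A" by blast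
    qed
    show "S2 - A \<subseteq> y' ` (UNIV - ?C)"
    proof
      fix x assume x: "x \<in> S2 - A"
      then have xb: "x \<in> S2 - {b}" using assms(2) by blast
      have "y x \<notin> ?C"
      proof
        assume "y x \<in> ?C"
        then obtain c where c: "c \<in> A - {b}" "y x = y c" by blast
        then have "c \<in> S2 - {b}" using assms(3) by blast
        then have "x = c" using homeomorphism_apply1 [OF y] xb c(2) by metis
        then show False using c x by blast
      qed
      then show "x \<in> y' ` (UNIV - ?C)" using homeomorphism_apply1 [OF y xb] by (metis DiffI UNIV_I imageI)
    qed
  qed
  ultimately show ?thesis by simp
qed

text \<open>A lift conjugates the rotation to a power of itself. The exponent, a priori varying over the
  surface, is constant: the sum of the corresponding roots of unity over a fibre descends to the
  connected base, and on the circular slices it has modulus \<open>k\<close>.\<close>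

lemma lift_power:
  assumes f: "homeomorphism S2 S2 f f'" "f ` branch_set k S p = branch_set k S p" and lift: "liftable S p f"
  obtains u :: int and r where "continuous_on (S2 - branch_set k S p) r"
    "\<And>y. y \<in> S2 - branch_set k S p \<Longrightarrow> r y \<noteq> 0"
    "\<And>y. y \<in> S2 - branch_set k S p \<Longrightarrow> hh (f y) = hh y powi u * r y ^ k"
proof -
  let ?B = "branch_set k S p"
  obtain F where F: "homeomorphic_map (top_of_set S) (top_of_set S) F" "\<And>x. x \<in> S \<Longrightarrow> p (F x) = f (p x)"
    using lift by (auto simp: liftable_def)
  have cF: "continuous_on S F" and FS: "\<And>x. x \<in> S \<Longrightarrow> F x \<in> S"
    using homeomorphic_imp_continuous_map [OF F(1)] by auto
  have finj: "y = y'" if "y \<in> S2" "y' \<in> S2" "f y = f y'" for y y'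
    using homeomorphism_apply1 [OF f(1)] that by metis
  have BX: "?B \<subseteq> S2" by (rule branch_set_subset [OF cover])
  have fB: "f y \<notin> ?B" if y: "y \<in> S2" "y \<notin> ?B" for y
  proof
    assume "f y \<in> ?B"
    then obtain b where b: "b \<in> ?B" "f y = f b" using f(2) by blast
    then show False using finj [OF y(1) _ b(2)] BX y(2) by blast
  qed
  have S0S: "x \<in> S" if "x \<in> S0" for x using that by (simp add: S0_def)
  have pS0: "p x \<in> S2 - ?B" if "x \<in> S0" for x using that by (simp add: S0_eq)
  have FS0: "F x \<in> S0" if x: "x \<in> S0" for x
  proof -
    have "p (F x) \<notin> ?B" using F(2) [OF S0S [OF x]] fB pS0 [OF x] by simp
    then show ?thesis using p_S0 [OF FS [OF S0S [OF x]]] FS [OF S0S [OF x]] by (simp add: S0_def)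
  qed
  have cz: "continuous_on S0 ((zeta k) ^^ i)" for i
  proof (induction i)
    case (Suc i)
    have cz1: "continuous_on A (zeta k)" for A
    proof -
      have "continuous_on A (\<lambda>v. zeta k v $ i)" for i
      proof -
        have "continuous_on A (\<lambda>v. (vector [cos t * v$1 - sin t * v$2, sin t * v$1 + cos t * v$2, v$3] :: real^3) $ j)"
          if "j = 1 \<or> j = 2 \<or> j = 3" for j t
          using that by (elim disjE; simp) (auto intro!: continuous_intros)
        then show ?thesis using exhaust_3 [of i] unfolding zeta_def rotz_def by blast
      qed
      then show ?thesis using continuous_on_vec_lambda [of A "\<lambda>j v. zeta k v $ j"] by simp
    qed
    have "(zeta k) ^^ Suc i = (\<lambda>x. zeta k ((zeta k ^^ i) x))" by auto
    then show ?case using continuous_on_compose2 [OF cz1 [of UNIV] Suc] by simp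
  qed (auto simp: id_def)
  \<comment> \<open>A lift sends fibres to fibres, so this is a root of unity: the rotation at
    \<open>F x\<close> that corresponds to \<open>zeta k\<close> at \<open>x\<close>.\<close>
  define \<rho> where "\<rho> x = qc (F (zeta k x)) / qc (F x)" for x
  have z1: "zeta k x \<in> S0" if "x \<in> S0" for x using zeta_S0 [OF that, of 1] by simp
  have \<rho>_root: "\<exists>i<k. \<rho> x = om k ^ i" if x: "x \<in> S0" for x
  proof -
    have "p (F x) = p (F (zeta k x))"
      using F(2) S0S x z1 p_zeta [OF S0S [OF x], of 1] by simp
    then obtain i where "i < k" "F (zeta k x) = (zeta k ^^ i) (F x)"
      by (rule same_fibre_zeta [OF FS [OF S0S [OF x]] FS [OF S0S [OF z1 [OF x]]]])
    moreover have "qc (F x) \<noteq> 0" using FS0 [OF x] by (simp add: S0_def)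
    ultimately show ?thesis by (intro exI [of _ i]) (simp add: \<rho>_def)
  qed
  have cqF: "continuous_on S0 (\<lambda>x. qc (F ((zeta k ^^ i) x)))" for i
    by (rule continuous_on_compose2 [OF continuous_on_qc [of UNIV]
        continuous_on_compose2 [OF cF cz]]) (use zeta_S0 S0S in auto)
  have c\<rho>: "continuous_on S0 (\<lambda>x. \<rho> ((zeta k ^^ i) x))" for i
  proof -
    have "continuous_on S0 (\<lambda>x. qc (F ((zeta k ^^ Suc i) x)) / qc (F ((zeta k ^^ i) x)))"
      by (intro continuous_on_divide cqF) (use FS0 zeta_S0 in \<open>auto simp: S0_def\<close>)
    then show ?thesis by (simp add: \<rho>_def)
  qed
  define \<Sigma> where "\<Sigma> x = (\<Sum>i<k. \<rho> ((zeta k ^^ i) x))" for x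
  have c\<Sigma>: "continuous_on S0 \<Sigma>"
    unfolding \<Sigma>_def by (intro continuous_on_sum c\<rho>)
  have zk: "(zeta k ^^ k) x = x" for x by (rule qc_eqI) simp_all
  have \<Sigma>z: "\<Sigma> (zeta k x) = \<Sigma> x" for x
  proof -
    have "\<Sigma> (zeta k x) = (\<Sum>i<k. \<rho> ((zeta k ^^ Suc i) x))"
      by (simp add: \<Sigma>_def funpow_swap1)
    also have "\<dots> + \<rho> x = \<Sigma> x + \<rho> ((zeta k ^^ k) x)"
      unfolding \<Sigma>_def
      using sum.lessThan_Suc_shift [of "\<lambda>i. \<rho> ((zeta k ^^ i) x)" k] by (simp add: add.commute)
    finally show ?thesis by (simp add: zk)
  qed
  note d\<Sigma> = descend_S0 [OF c\<Sigma> \<Sigma>z]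
  have finB: "finite ?B" and neB: "bb 0 \<in> ?B" using branch_set_eq by auto
  have fin\<rho>: "finite (\<rho> ` S0)"
    by (rule finite_subset [of _ "(\<lambda>i. om k ^ i) ` {..<k}"]) (use \<rho>_root in auto)
  have "(\<lambda>y. \<Sigma> (sec y)) constant_on (S2 - ?B)"
  proof (rule continuous_finite_range_constant [OF connected_S2_minus [OF finB neB BX] d\<Sigma>(1)])
    have "finite ((\<lambda>h. \<Sum>i<k. h i) ` (PiE {..<k} (\<lambda>_. \<rho> ` S0)))"
      by (rule finite_imageI, rule finite_PiE) (simp, rule fin\<rho>)
    moreover have "(\<lambda>y. \<Sigma> (sec y)) ` (S2 - ?B) \<subseteq> (\<lambda>h. \<Sum>i<k. h i) ` (PiE {..<k} (\<lambda>_. \<rho> ` S0))"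
    proof (rule image_subsetI)
      fix y assume y: "y \<in> S2 - ?B"
      have s: "sec y \<in> S0" using sec [of y] y by (simp add: S0_eq)
      let ?h = "\<lambda>i\<in>{..<k}. \<rho> ((zeta k ^^ i) (sec y))"
      have "?h \<in> PiE {..<k} (\<lambda>_. \<rho> ` S0)" using zeta_S0 [OF s] by auto
      moreover have "\<Sigma> (sec y) = (\<Sum>i<k. ?h i)" by (simp add: \<Sigma>_def)
      ultimately show "\<Sigma> (sec y) \<in> (\<lambda>h. \<Sum>i<k. h i) ` (PiE {..<k} (\<lambda>_. \<rho> ` S0))" by blast
    qed
    ultimately show "finite ((\<lambda>y. \<Sigma> (sec y)) ` (S2 - ?B))" by (rule finite_subset [rotated])
  qed
  then obtain C where C: "\<And>y. y \<in> S2 - ?B \<Longrightarrow> \<Sigma> (sec y) = C" by (auto simp: constant_on_def)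
  have \<Sigma>C: "\<Sigma> x = C" if x: "x \<in> S0" for x using C [OF pS0 [OF x]] d\<Sigma>(2) [OF x] by simp
  \<comment> \<open>The circular slice at height 1/2 is connected and invariant, so \<rho> is
    constant on whole fibres there; this evaluates the constant sum.\<close>
  have J: "jordan_curve (RR (1/2))" using RR_circle [of 0 "1/2"] by simp
  have z12: "0 \<notin> RR (1/2)"
    using rotation_inside_0 [OF J rot_RR k2] by (simp add: inside_def)
  let ?T = "at_height (1/2) ` RR (1/2)"
  have T: "?T \<subseteq> S0"
  proof (rule image_subsetI)
    fix w assume w: "w \<in> RR (1/2)"
    then have "w \<noteq> 0" using z12 by blast
    then show "at_height (1/2) w \<in> S0" using w by (simp add: S0_def RR_iff)
  qed
  have "connected ?T" by (rule connected_continuous_image [OF continuous_on_at_height jordan_curve_facts(2) [OF J]])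
  moreover have "continuous_on ?T \<rho>" using continuous_on_subset [OF c\<rho> [of 0] T] by simp
  moreover have "finite (\<rho> ` ?T)" by (rule finite_subset [OF image_mono [OF T] fin\<rho>])
  ultimately have "\<rho> constant_on ?T" by (rule continuous_finite_range_constant)
  then obtain c where c: "\<And>x. x \<in> ?T \<Longrightarrow> \<rho> x = c" by (auto simp: constant_on_def)
  obtain w0 where w0: "w0 \<in> RR (1/2)" using jordan_curve_facts(3) [OF J] by blast
  let ?x0 = "at_height (1/2) w0"
  have x0: "?x0 \<in> ?T" using w0 by blast
  have zT: "(zeta k ^^ i) x \<in> ?T" if "x \<in> ?T" for i x
  proof -
    have zS: "(zeta k ^^ i) x \<in> S" and z3: "((zeta k ^^ i) x) $ 3 = 1/2"
      using that T zeta_S0 S0S by auto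
    have eq: "at_height (1/2) (qc ((zeta k ^^ i) x)) = (zeta k ^^ i) x" by (rule at_height_qc [OF z3])
    then have "qc ((zeta k ^^ i) x) \<in> RR (1/2)" using zS by (simp only: RR_iff)
    then show ?thesis using imageI [of _ "RR (1/2)" "at_height (1/2)"] eq by metis
  qed
  have "\<Sigma> ?x0 = of_nat k * c" using c [OF zT [OF x0]] by (simp add: \<Sigma>_def)
  then have Ck: "C = of_nat k * c" using \<Sigma>C T x0 by force
  obtain u0 where u0: "c = om k ^ u0" using \<rho>_root [of ?x0] T x0 c [OF x0] by auto
  have \<rho>c: "\<rho> x = c" if x: "x \<in> S0" for x
  proof -
    define s where "s i = \<rho> ((zeta k ^^ i) x) / c" for i
    have c0: "c \<noteq> 0" using u0 by simp
    have n1: "cmod (s i) = 1" for i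
      using \<rho>_root [OF zeta_S0 [OF x, of i]] u0 by (auto simp: s_def norm_divide)
    \<comment> \<open>Numbers of modulus 1 whose sum equals their count are all 1, as their real
      parts show.\<close>
    have "(\<Sum>i<k. s i) = of_nat k"
      using \<Sigma>C [OF x] Ck c0 by (simp add: s_def \<Sigma>_def flip: sum_divide_distrib)
    then have "(\<Sum>i<k. 1 - Re (s i)) = 0"
      by (simp add: sum_subtractf flip: Re_sum)
    moreover have "1 - Re (s i) \<ge> 0" for i using complex_Re_le_cmod [of "s i"] n1 by simp
    ultimately have "1 - Re (s i) = 0" if "i < k" for i
      using that by (simp add: sum_nonneg_eq_0_iff)
    then have R: "Re (s 0) = 1" using k2 by force
    have "(Re (s 0))\<^sup>2 + (Im (s 0))\<^sup>2 = 1" using n1 [of 0] by (simp add: cmod_def)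
    then have "Im (s 0) = 0" using R by simp
    then have "s 0 = 1" using R by (simp add: complex_eq_iff)
    then show ?thesis using c0 by (simp add: s_def)
  qed
  define u where "u = int u0"
  \<comment> \<open>The power of \<open>qc x\<close> cancels the factor that \<open>qc (F x)\<close>
    picks up under the rotation, so \<open>G\<close> descends to the sphere.\<close>
  define G where "G x = qc (F x) * qc x powi (- u)" for x
  have cG: "continuous_on S0 G"
    unfolding G_def
    by (intro continuous_on_mult continuous_on_power_int continuous_on_qc)
      (use cqF [of 0] in \<open>auto simp: S0_def\<close>)
  have Gz: "G (zeta k x) = G x" if x: "x \<in> S0" for x
  proof -
    have "qc (F x) \<noteq> 0" using FS0 [OF x] by (simp add: S0_def)
    then have "qc (F (zeta k x)) = om k powi u * qc (F x)"
      using \<rho>c [OF x] u0 by (simp add: \<rho>_def u_def divide_simps)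
    then have "G (zeta k x) = om k powi u * om k powi (- u) * G x"
      by (simp add: G_def power_int_mult_distrib)
    then show ?thesis by (simp add: power_int_minus)
  qed
  note d = descend_S0 [OF cG Gz]
  have secS0: "sec y \<in> S0" if "y \<in> S2 - ?B" for y using sec [of y] that by (simp add: S0_eq)
  show thesis
  proof (rule that [OF d(1)])
    fix y assume y: "y \<in> S2 - ?B"
    have s: "qc (sec y) \<noteq> 0" "qc (F (sec y)) \<noteq> 0" using secS0 [OF y] FS0 [OF secS0 [OF y]] by (auto simp: S0_def)
    show "G (sec y) \<noteq> 0" using s by (simp add: G_def)
    have sS: "sec y \<in> S" by (rule S0S [OF secS0 [OF y]])
    have "hh (f y) = qc (F (sec y)) ^ k"
      using hh(2) [OF FS [OF sS]] F(2) [OF sS] sec(2) [of y] y by simp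
    also have "qc (F (sec y)) = qc (sec y) powi u * G (sec y)"
      using s by (simp add: G_def power_int_minus)
    also have "\<dots> ^ k = (qc (sec y) powi u) ^ k * G (sec y) ^ k" by (rule power_mult_distrib)
    also have "(qc (sec y) powi u) ^ k = hh y powi u"
      unfolding hh_def by (metis power_int_mult power_int_of_nat mult.commute)
    finally show "hh (f y) = hh y powi u * G (sec y) ^ k" .
  qed
qed

end

section \<open>Counting the cosets\<close>

text \<open>The track of a marked point is connected and stays in the finite set \<open>B\<close>.
  Hence the permutation of \<open>B\<close> is an invariant of the mapping class.\<close>

lemma homotopic_agree_on_marked:
  assumes B: "finite B" "B \<subseteq> S2" and ht: "mhtp B f h" and b: "b \<in> B"
  shows "f b = h b"
proof -
  obtain H where H: "continuous_map (prod_topology (top_of_set {0..1::real}) (nsphere 2)) (nsphere 2) H"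
    "\<forall>x. H (0, x) = f x" "\<forall>x. H (1, x) = h x" "\<forall>t\<in>{0..1}. preserves_marked B (\<lambda>x. H (t, x))"
    using ht unfolding homotopic_with_def by (elim exE conjE)
  let ?g = "\<lambda>t. H (t, b)"
  have bS: "b \<in> S2" using b B(2) by (rule rev_subsetD)
  have "continuous_map (top_of_set {0..1::real}) (prod_topology (top_of_set {0..1}) (nsphere 2)) (\<lambda>t. (t, b))"
    by (intro continuous_map_pairedI) (use bS in auto)
  then have "continuous_map (top_of_set {0..1}) (nsphere 2) (H \<circ> (\<lambda>t. (t, b)))"
    by (rule continuous_map_compose [OF _ H(1)])
  then have "continuous_map (top_of_set {0..1}) (top_of_set S2) (H \<circ> (\<lambda>t. (t, b)))"
    by (simp only: nsphere_2 [symmetric])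
  then have "continuous_on {0..1} (H \<circ> (\<lambda>t. (t, b)))" by simp
  then have "continuous_on {0..1} ?g" by (simp only: o_def)
  then have con: "connected (?g ` {0..1})" by (rule connected_continuous_image) simp
  have gB: "?g t \<in> B" if "t \<in> {0..1}" for t
    using H(4) that b unfolding preserves_marked_def by blast
  then have "finite (?g ` {0..1})" by (intro finite_subset [OF image_subsetI B(1)])
  then obtain c where c: "?g ` {0..1} \<subseteq> {c}"
    using connected_finite_iff_sing [OF con] by blast
  have gc: "H (t, b) = c" if "t \<in> {0..1}" for t using imageI [OF that, of ?g] c by blast
  show ?thesis using gc [of 0] gc [of 1] H(2,3) by simp
qed

lemma card_image_eqI:
  assumes "\<And>x y. x \<in> M \<Longrightarrow> y \<in> M \<Longrightarrow> F x = F y \<longleftrightarrow> G x = G y"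
  shows "card (F ` M) = card (G ` M)"
proof -
  let ?T = "\<lambda>y. G (inv_into M F y)"
  have T: "?T (F x) = G x" if "x \<in> M" for x
    using assms [OF inv_into_into [of "F x" F M] that] f_inv_into_f [of "F x" F M] that by blast
  have "inj_on ?T (F ` M)"
    by (rule inj_onI) (use T assms in auto)
  moreover have "?T ` F ` M = G ` M" by (simp add: image_image T cong: image_cong)
  ultimately show ?thesis using card_image by metis
qed

lemma sign_eqI:
  fixes a b c d :: int
  assumes "a \<in> {1, - 1}" "b \<in> {1, - 1}" "c \<in> {1, - 1}" "d \<in> {1, - 1}" "a = b \<longleftrightarrow> c = d"
  shows "a = b * d * c"
  using assms by (elim insertE emptyE) simp_all

context bse_chart
begin

section \<open>Lifting as a congruence between orders\<close>

lemma BB_sub: "BB \<subseteq> S2 - {N}" "BB \<subseteq> S2"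
  using bb_N by auto

text \<open>When the orders are divisible by \<open>k\<close>, the exponents in the product formula
  and the remaining logarithm can all be divided by \<open>k\<close>.\<close>

lemma kth_root:
  assumes c: "continuous_on (S2 - BB) \<phi>" "\<And>y. y \<in> S2 - BB \<Longrightarrow> \<phi> y \<noteq> 0"
    and ord: "\<And>b. b \<in> BB \<Longrightarrow> has_ord \<phi> b (m b)" and dv: "\<And>b. b \<in> BB \<Longrightarrow> int k dvd m b"
  obtains r where "continuous_on (S2 - BB) r" "\<And>y. y \<in> S2 - BB \<Longrightarrow> \<phi> y = r y ^ k"
proof -
  have beB: "be \<in> BB" by blast
  have o: "has_ord \<phi> a (m a)" if "a \<in> BB - {be}" for a using ord that by blast
  have "logeq (S2 - BB) \<phi> (\<lambda>x. \<Prod>a\<in>BB - {be}. tt a be x powi m a)"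
    by (rule sphere_classification(1) [OF finite_BB BB_sub(1) beB c(1)]) (erule c(2), erule o)
  then obtain l where l: "continuous_on (S2 - BB) l"
    "\<forall>x\<in>S2 - BB. \<phi> x = (\<Prod>a\<in>BB - {be}. tt a be x powi m a) * exp (l x)"
    unfolding logeq_def by (elim exE conjE)
  define r where "r x = (\<Prod>a\<in>BB - {be}. tt a be x powi (m a div int k)) * exp (l x / of_nat k)" for x
  have ct: "continuous_on (S2 - BB) (tt a be)" if a: "a \<in> BB" for a
  proof -
    have "a \<in> S2 - {N}" using BB_sub(1) a by (rule subsetD)
    then show ?thesis by (rule continuous_on_subset [OF continuous_on_tt [OF _ be_N]]) auto
  qed
  have nz: "tt a be x \<noteq> 0" if a: "a \<in> BB" and x: "x \<in> S2 - BB" for a x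
  proof -
    have "a \<in> S2 - {N}" using BB_sub(1) a by (rule subsetD)
    moreover have "x \<in> S2 - {a, be}" using x a beB by blast
    ultimately show ?thesis using tt_nz [OF _ be_N] by blast
  qed
  show thesis
  proof (rule that)
    have "continuous_on (S2 - BB) (\<lambda>x. tt a be x powi (m a div int k))" if a: "a \<in> BB - {be}" for a
      by (rule continuous_on_power_int [OF ct]) (use a nz in blast)+
    then have "continuous_on (S2 - BB) (\<lambda>x. \<Prod>a\<in>BB - {be}. tt a be x powi (m a div int k))"
      by (rule continuous_on_prod)
    moreover have "continuous_on (S2 - BB) (\<lambda>x. exp (l x / of_nat k))"
      by (intro continuous_intros l) (use k2 in simp)
    ultimately show "continuous_on (S2 - BB) r" unfolding r_def by (rule continuous_on_mult)
    fix x assume x: "x \<in> S2 - BB"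
    have "r x ^ k = (\<Prod>a\<in>BB - {be}. (tt a be x powi (m a div int k)) ^ k) * exp (l x / of_nat k) ^ k"
      unfolding r_def power_mult_distrib prod_power_distrib ..
    also have "exp (l x / of_nat k) ^ k = exp (l x)"
      using k2 by (simp flip: exp_of_nat_mult)
    also have "(\<Prod>a\<in>BB - {be}. (tt a be x powi (m a div int k)) ^ k) = (\<Prod>a\<in>BB - {be}. tt a be x powi m a)"
    proof (rule prod.cong [OF refl])
      fix a assume "a \<in> BB - {be}"
      then have "m a = (m a div int k) * int k" using dv by simp
      then show "(tt a be x powi (m a div int k)) ^ k = tt a be x powi m a"
        by (metis power_int_mult power_int_of_nat)
    qed
    finally show "\<phi> x = r x ^ k" using l(2) x by simp
  qed
qed

lemma has_ord_hh: "b \<in> BB \<Longrightarrow> has_ord hh b (ordf b)"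
  using has_ord_nn by blast

lemma marked_in: "f \<in> marked_homeos BB \<Longrightarrow> b \<in> BB \<Longrightarrow> f b \<in> BB"
  unfolding marked_homeos_iff by blast

text \<open>Degree 1 means local degree 1, so pulling back along \<open>f\<close> transports orders
  without a change of sign.\<close>

lemma has_ord_hh_marked:
  assumes f: "f \<in> marked_homeos BB" and b: "b \<in> BB"
  shows "has_ord (\<lambda>y. hh (f y)) b (ordf (f b))"
proof -
  obtain f' where f': "homeomorphism S2 S2 f f'" using f marked_homeos_iff by blast
  have "orient f 1"
    by (rule orient_of_deg_1 [OF sphere_chart_axioms f']) (use f marked_homeos_iff in blast)
  moreover have "b \<in> S2 - {N}" using b BB_sub(1) by (rule rev_subsetD)
  moreover have fb: "f b \<in> BB" by (rule marked_in [OF f b])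
  moreover have "f b \<in> S2 - {N}" using fb BB_sub(1) by (rule rev_subsetD)
  ultimately have "has_ord (\<lambda>y. hh (f y)) b (1 * ordf (f b))"
    using orient_pullback [OF f'] has_ord_hh by blast
  then show ?thesis by (simp only: mult_1_left)
qed

text \<open>The quotient of \<open>hh o f\<close> by \<open>hh powi u\<close> has orders divisible
  by \<open>k\<close>, hence a \<open>k\<close>-th root, which is the function \<open>r\<close>
  required by \<open>lift_exists\<close>.\<close>

lemma liftableI:
  assumes f: "f \<in> marked_homeos BB" and u: "u \<in> {1, -1}"
    and dv: "\<And>b. b \<in> BB \<Longrightarrow> int k dvd ordf (f b) - u * ordf b"
  shows "liftable S p f"
proof -
  obtain f' where f': "homeomorphism S2 S2 f f'" using f marked_homeos_iff by blast
  have fB: "f ` BB = BB" using f marked_homeos_iff by blast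
  have fX: "f y \<in> S2 - BB" if y: "y \<in> S2 - BB" for y
  proof -
    have "preserves_marked BB f" by (rule marked_homeos_preserves [OF f BB_sub(2)])
    then have "f ` (S2 - BB) \<subseteq> S2 - BB" unfolding preserves_marked_def by (elim conjE)
    then show ?thesis using imageI [OF y] by (rule subsetD)
  qed
  let ?g = "\<lambda>y. hh (f y) / hh y powi u"
  have c: "continuous_on (S2 - BB) (\<lambda>y. hh (f y))"
  proof (rule continuous_on_compose2 [OF hh_BB(1)])
    show "continuous_on (S2 - BB) f"
      by (rule continuous_on_subset [of S2]) (use f' in \<open>auto simp: homeomorphism_def\<close>)
    show "f ` (S2 - BB) \<subseteq> S2 - BB" by (rule image_subsetI) (erule fX)
  qed
  have cg: "continuous_on (S2 - BB) ?g"
    by (intro continuous_on_divide continuous_on_power_int c hh_BB(1)) (use hh_BB(2) in simp_all)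
  have gnz: "?g y \<noteq> 0" if "y \<in> S2 - BB" for y
    using hh_BB(2) [OF that] hh_BB(2) [OF fX [OF that]] by simp
  have go: "has_ord ?g b (ordf (f b) - ordf b * u)" if "b \<in> BB" for b
    by (intro has_ord_divide has_ord_powi has_ord_hh has_ord_hh_marked f that)
  have gd: "int k dvd ordf (f b) - ordf b * u" if "b \<in> BB" for b
    using dv [OF that] by (simp add: mult.commute)
  obtain r where r: "continuous_on (S2 - BB) r" "\<And>y. y \<in> S2 - BB \<Longrightarrow> ?g y = r y ^ k"
    using kth_root [OF cg gnz go gd] by metis
  show ?thesis
  proof (rule lift_exists [OF f' _ u])
    show "f ` branch_set k S p = branch_set k S p" using fB by (simp only: branch_set_eq)
    show "continuous_on (S2 - branch_set k S p) r" using r(1) by (simp only: branch_set_eq)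
    fix y assume "y \<in> S2 - branch_set k S p"
    then have y: "y \<in> S2 - BB" by (simp only: branch_set_eq)
    show "hh (f y) = hh y powi u * r y ^ k"
      using r(2) [OF y, symmetric] hh_BB(2) [OF y] by simp
  qed
qed

text \<open>Orders are compared in the equation supplied by \<open>lift_power\<close>; the factor
  \<open>r ^ k\<close> contributes a multiple of \<open>k\<close>.\<close>

lemma liftableD:
  assumes f: "f \<in> marked_homeos BB" and lift: "liftable S p f"
  shows "\<exists>u. \<forall>b\<in>BB. int k dvd ordf (f b) - u * ordf b"
proof -
  obtain f' where f': "homeomorphism S2 S2 f f'" using f marked_homeos_iff by blast
  have fB: "f ` branch_set k S p = branch_set k S p"
    using f unfolding branch_set_eq marked_homeos_iff by blast
  obtain u r where r: "continuous_on (S2 - BB) r" "\<And>y. y \<in> S2 - BB \<Longrightarrow> r y \<noteq> 0"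
    "\<And>y. y \<in> S2 - BB \<Longrightarrow> hh (f y) = hh y powi u * r y ^ k"
    using lift_power [OF f' fB lift] unfolding branch_set_eq by metis
  have "int k dvd ordf (f b) - u * ordf b" if b: "b \<in> BB" for b
  proof -
    let ?W = "S2 - (BB - {b})"
    have W: "openin (top_of_set S2) ?W" by (rule openin_minus_finite_X) simp
    have bN: "b \<in> S2 - {N}" using b BB_sub(1) by (rule rev_subsetD)
    have bW: "b \<in> ?W" using bN by blast
    have eq: "?W - {b} = S2 - BB" using b by blast
    obtain m where m: "has_ord r b m"
      by (rule has_ord_exists [OF W bW, of r]) (use bN r(1,2) eq in auto)
    have "has_ord (\<lambda>y. hh y powi u * r y powi int k) b (ordf b * u + m * int k)"
      by (intro has_ord_mult has_ord_powi has_ord_hh b m)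
    then have "has_ord (\<lambda>y. hh (f y)) b (ordf b * u + m * int k)"
    proof (rule has_ord_cong [OF _ W bW])
      show "logeq (?W - {b} - {N}) (\<lambda>y. hh (f y)) (\<lambda>y. hh y powi u * r y powi int k)"
        by (rule logeq_eq) (use r(3) eq in auto)
    qed
    then have "ordf (f b) = ordf b * u + m * int k"
      using has_ord_unique [OF has_ord_hh_marked [OF f b]] by blast
    then show ?thesis by (simp add: mult.commute)
  qed
  then show ?thesis by blast
qed

section \<open>Signs of the branch points\<close>

definition EE :: "(nat \<Rightarrow> real) set" where "EE = (\<lambda>j. bb (2 * j)) ` {..n}"
definition sg :: "(nat \<Rightarrow> real) \<Rightarrow> int" where "sg b = (if b \<in> EE then 1 else - 1)"

lemma sg_cases: "sg b \<in> {1, - 1}" by (simp add: sg_def)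

lemma sg_bb: assumes i: "i \<le> 2 * n + 1" shows "sg (bb i) = (- 1) ^ i"
proof (cases "even i")
  case True
  then obtain j where j: "i = 2 * j" by (elim evenE)
  then have "j \<le> n" using i by simp
  then have "bb i \<in> EE" unfolding EE_def j by blast
  then show ?thesis using True by (simp add: sg_def)
next
  case False
  have "bb i \<notin> EE"
  proof
    assume "bb i \<in> EE"
    then obtain j where j: "j \<le> n" "bb i = bb (2 * j)" unfolding EE_def by blast
    have "i = 2 * j" by (rule inj_onD [OF bb_inj j(2)]) (use i j(1) in auto)
    then show False using False by simp
  qed
  then show ?thesis using False by (simp add: sg_def)
qed

lemma card_BB: "card BB = 2 * n + 2"
  using card_image [OF bb_inj] by simp

lemma card_EE: "card EE = n + 1" "EE \<subseteq> BB"
proof -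
  have "inj_on (\<lambda>j. bb (2 * j)) {..n}"
  proof (rule inj_onI)
    fix i j assume "i \<in> {..n}" "j \<in> {..n}" "bb (2 * i) = bb (2 * j)"
    then have "2 * i = 2 * j" by (intro inj_onD [OF bb_inj]) auto
    then show "i = j" by simp
  qed
  then show "card EE = n + 1" unfolding EE_def by (simp add: card_image)
  show "EE \<subseteq> BB" unfolding EE_def by auto
qed

lemma card_sg: assumes "s \<in> {1, - 1}" shows "card {b \<in> BB. sg b = s} = n + 1"
proof (cases "s = 1")
  case True
  then have "{b \<in> BB. sg b = s} = EE" using card_EE(2) by (auto simp: sg_def)
  then show ?thesis using card_EE(1) by simp
next
  case False
  then have "{b \<in> BB. sg b = s} = BB - EE" using assms by (auto simp: sg_def)
  then show ?thesis using card_Diff_subset [OF finite_subset [OF card_EE(2) finite_BB] card_EE(2)]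
      card_EE(1) card_BB by simp
qed

text \<open>Modulo \<open>k\<close> the orders are the signs times one common sign \<open>v\<close>,
  which is a unit and cancels.\<close>

lemma dvd_ordf_sg:
  assumes f: "f \<in> marked_homeos BB"
  shows "(\<forall>b\<in>BB. int k dvd ordf (f b) - u * ordf b) \<longleftrightarrow> (\<forall>b\<in>BB. int k dvd sg (f b) - u * sg b)"
proof -
  obtain v where v: "v \<in> {1, - 1}" "\<And>i. i \<le> 2 * n + 1 \<Longrightarrow> int k dvd nn i - (- 1) ^ i * v"
    using nn_mod by metis
  have ov: "int k dvd ordf b - sg b * v" if b: "b \<in> BB" for b
  proof -
    obtain i where i: "i \<le> 2 * n + 1" "b = bb i" using b by blast
    show ?thesis using v(2) [OF i(1)] unfolding i(2) sg_bb [OF i(1)] .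
  qed
  have vv: "v * v = 1" using v(1) by auto
  have "int k dvd ordf (f b) - u * ordf b \<longleftrightarrow> int k dvd sg (f b) - u * sg b" if b: "b \<in> BB" for b
  proof -
    have o1: "int k dvd ordf (f b) - sg (f b) * v" by (rule ov [OF marked_in [OF f b]])
    have o2: "int k dvd u * (ordf b - sg b * v)" by (intro dvd_mult ov b)
    have d: "int k dvd (ordf (f b) - sg (f b) * v) - u * (ordf b - sg b * v)"
      by (rule dvd_diff [OF o1 o2])
    have "ordf (f b) - u * ordf b =
        ((ordf (f b) - sg (f b) * v) - u * (ordf b - sg b * v)) + (sg (f b) - u * sg b) * v"
      by (simp add: algebra_simps)
    then have "int k dvd ordf (f b) - u * ordf b \<longleftrightarrow> int k dvd (sg (f b) - u * sg b) * v"
      using d by (simp only: dvd_add_right_iff)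
    also have "\<dots> \<longleftrightarrow> int k dvd sg (f b) - u * sg b"
      using v(1) by (elim insertE emptyE; simp only: mult_1_right mult_minus1_right dvd_minus_iff)
    finally show ?thesis .
  qed
  then show ?thesis by blast
qed

lemma liftable_2: "k = 2 \<Longrightarrow> f \<in> marked_homeos BB \<Longrightarrow> liftable S p f"
proof -
  assume k: "k = 2" and f: "f \<in> marked_homeos BB"
  have "int k dvd sg (f b) - 1 * sg b" for b using k by (simp add: sg_def)
  then have "\<forall>b\<in>BB. int k dvd ordf (f b) - 1 * ordf b" unfolding dvd_ordf_sg [OF f] by blast
  then show ?thesis using liftableI [OF f, of 1] by blast
qed

lemma liftable_iff:
  assumes k: "k \<ge> 3" and f: "f \<in> marked_homeos BB"
  shows "liftable S p f \<longleftrightarrow> (\<exists>u\<in>{1, - 1}. \<forall>b\<in>BB. sg (f b) = u * sg b)"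
proof
  assume "liftable S p f"
  then obtain u where u: "\<forall>b\<in>BB. int k dvd sg (f b) - u * sg b"
    using liftableD [OF f] dvd_ordf_sg [OF f] by blast
  \<comment> \<open>The exponent obtained from \<open>liftableD\<close> is an arbitrary integer;
    evaluation at \<open>b0\<close>, where \<open>sg\<close> is 1, shows that it is congruent to
    this sign.\<close>
  let ?u = "sg (f b0)"
  have b0: "b0 \<in> BB" by blast
  have sb0: "sg b0 = 1" using sg_bb [of 0] by simp
  have "int k dvd ?u - u * sg b0" using u b0 by blast
  then have "int k dvd ?u - u" by (simp only: sb0 mult_1_right)
  have "sg (f b) = ?u * sg b" if b: "b \<in> BB" for b
  proof -
    have "int k dvd (sg (f b) - u * sg b) - (?u - u) * sg b"
      by (rule dvd_diff) (use u b \<open>int k dvd ?u - u\<close> in auto)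
    moreover have "(sg (f b) - u * sg b) - (?u - u) * sg b = sg (f b) - ?u * sg b"
      by (simp add: algebra_simps)
    ultimately have d: "int k dvd sg (f b) - ?u * sg b" by simp
    \<comment> \<open>Two signs differ by at most 2, so for \<open>k \<ge> 3\<close> a congruence
      between them is an equality.\<close>
    have "\<bar>sg (f b) - ?u * sg b\<bar> < int k" using k by (auto simp: sg_def)
    then have "sg (f b) - ?u * sg b = 0" using d dvd_imp_le_int [of "sg (f b) - ?u * sg b" "int k"] by linarith
    then show ?thesis by simp
  qed
  then show "\<exists>u\<in>{1, - 1}. \<forall>b\<in>BB. sg (f b) = u * sg b" using sg_cases by blast
next
  assume "\<exists>u\<in>{1, - 1}. \<forall>b\<in>BB. sg (f b) = u * sg b"
  then obtain u where u: "u \<in> {1, - 1}" "\<forall>b\<in>BB. sg (f b) = u * sg b" by blast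
  then have "\<forall>b\<in>BB. int k dvd ordf (f b) - u * ordf b" unfolding dvd_ordf_sg [OF f] by simp
  then show "liftable S p f" using liftableI [OF f u(1)] by blast
qed

text \<open>The sign pattern \<open>sg \<circ> f\<close> up to a global sign, encoded by the set of the marked points other
  than \<open>b0\<close> on which it agrees with its value at \<open>b0\<close>.\<close>

definition pattern :: "((nat \<Rightarrow> real) \<Rightarrow> (nat \<Rightarrow> real)) \<Rightarrow> (nat \<Rightarrow> real) set" where
  "pattern f = {b \<in> BB - {b0}. sg (f b) = sg (f b0)}"

lemma pattern_eq_iff:
  "pattern f = pattern h \<longleftrightarrow> (\<exists>u\<in>{1, - 1}. \<forall>b\<in>BB. sg (f b) = u * sg (h b))"
proof
  assume eq: "pattern f = pattern h"
  have "sg (f b) = sg (f b0) * sg (h b0) * sg (h b)" if b: "b \<in> BB" for b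
  proof (cases "b = b0")
    case True
    then show ?thesis by (simp add: sg_def)
  next
    case False
    then have "b \<in> BB - {b0}" using b by simp
    then have "sg (f b) = sg (f b0) \<longleftrightarrow> b \<in> pattern f" "sg (h b) = sg (h b0) \<longleftrightarrow> b \<in> pattern h"
      unfolding pattern_def mem_Collect_eq by simp_all
    then have "sg (f b) = sg (f b0) \<longleftrightarrow> sg (h b) = sg (h b0)" by (simp only: eq)
    then show ?thesis by (rule sign_eqI [OF sg_cases sg_cases sg_cases sg_cases])
  qed
  moreover have "sg (f b0) * sg (h b0) \<in> {1, - 1}" by (simp add: sg_def)
  ultimately show "\<exists>u\<in>{1, - 1}. \<forall>b\<in>BB. sg (f b) = u * sg (h b)"
    by (intro bexI [of _ "sg (f b0) * sg (h b0)"] ballI)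
next
  assume "\<exists>u\<in>{1, - 1}. \<forall>b\<in>BB. sg (f b) = u * sg (h b)"
  then obtain u where u1: "u \<in> {1, - 1}" and u: "\<forall>b\<in>BB. sg (f b) = u * sg (h b)" by (elim bexE)
  have u0: "u \<noteq> 0" using u1 by auto
  have b0: "b0 \<in> BB" by blast
  have "sg (f b) = sg (f b0) \<longleftrightarrow> sg (h b) = sg (h b0)" if b: "b \<in> BB" for b
    unfolding bspec [OF u b] bspec [OF u b0] using u0 by (simp only: mult_cancel_left simp_thms)
  then show "pattern f = pattern h" unfolding pattern_def by (intro Collect_cong conj_cong refl) simp
qed

text \<open>Each sign is taken at \<open>n + 1\<close> marked points, and \<open>b0\<close> accounts
  for one of them. Conversely \<open>T\<close> determines the half \<open>insert b0 T\<close>, which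
  some permutation of the marked points carries to \<open>EE\<close>, and every permutation is
  realised.\<close>

lemma pattern_image: "pattern ` marked_homeos BB = {T. T \<subseteq> BB - {b0} \<and> card T = n}"
proof (rule subset_antisym)
  have b0: "b0 \<in> BB" by blast
  show "pattern ` marked_homeos BB \<subseteq> {T. T \<subseteq> BB - {b0} \<and> card T = n}"
  proof (rule image_subsetI)
    fix f assume f: "f \<in> marked_homeos BB"
    have fB: "f ` BB = BB" using f marked_homeos_iff by blast
    have inj: "inj_on f BB" using finite_BB fB by (simp add: eq_card_imp_inj_on)
    let ?D = "{b \<in> BB. sg (f b) = sg (f b0)}"
    have "f ` ?D = {b \<in> BB. sg b = sg (f b0)}"
    proof (rule subset_antisym)
      show "f ` ?D \<subseteq> {b \<in> BB. sg b = sg (f b0)}" using marked_in [OF f] by blast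
      show "{b \<in> BB. sg b = sg (f b0)} \<subseteq> f ` ?D"
      proof
        fix c assume c: "c \<in> {b \<in> BB. sg b = sg (f b0)}"
        then have "c \<in> f ` BB" using fB by blast
        then show "c \<in> f ` ?D" using c by blast
      qed
    qed
    moreover have "card (f ` ?D) = card ?D"
      by (rule card_image) (rule inj_on_subset [OF inj], blast)
    ultimately have D: "card ?D = n + 1" using card_sg [OF sg_cases] by simp
    have "pattern f = ?D - {b0}" unfolding pattern_def by blast
    moreover have "b0 \<in> ?D" using b0 by blast
    ultimately have "card (pattern f) = n" using D by simp
    moreover have "pattern f \<subseteq> BB - {b0}" unfolding pattern_def by blast
    ultimately show "pattern f \<in> {T. T \<subseteq> BB - {b0} \<and> card T = n}" by blast
  qed
  show "{T. T \<subseteq> BB - {b0} \<and> card T = n} \<subseteq> pattern ` marked_homeos BB"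
  proof
    fix T assume "T \<in> {T. T \<subseteq> BB - {b0} \<and> card T = n}"
    then have T: "T \<subseteq> BB - {b0}" "card T = n" by auto
    let ?A = "insert b0 T"
    have fT: "finite T" by (rule finite_subset [OF T(1)]) simp
    have AB: "?A \<subseteq> BB" using T(1) b0 by blast
    have b0T: "b0 \<notin> T" using T(1) by blast
    have cA: "card ?A = card EE" using fT T(2) b0T card_EE(1) by simp
    have fA: "finite ?A" "finite EE" using fT finite_subset [OF card_EE(2) finite_BB] by simp_all
    have cA': "card (BB - ?A) = card (BB - EE)"
      using card_Diff_subset [OF fA(1) AB] card_Diff_subset [OF fA(2) card_EE(2)] cA by simp
    obtain h1 where h1: "bij_betw h1 ?A EE"
      using finite_same_card_bij [OF fA cA] by blast
    obtain h2 where h2: "bij_betw h2 (BB - ?A) (BB - EE)"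
      using finite_same_card_bij [OF _ _ cA'] finite_BB by blast
    define \<sigma> where "\<sigma> b = (if b \<in> ?A then h1 b else h2 b)" for b
    have "bij_betw \<sigma> (?A \<union> (BB - ?A)) (EE \<union> (BB - EE))"
      unfolding \<sigma>_def by (rule bij_betw_disjoint_Un [OF h1 h2]) blast+
    moreover have "?A \<union> (BB - ?A) = BB" "EE \<union> (BB - EE) = BB" using AB card_EE(2) by blast+
    ultimately have "bij_betw \<sigma> BB BB" by simp
    then obtain f where f: "f \<in> marked_homeos BB" "\<And>b. b \<in> BB \<Longrightarrow> f b = \<sigma> b"
      using realize_permutation [OF finite_BB BB_sub(2)] by metis
    have s1: "sg (f b) = 1" if "b \<in> ?A" for b
    proof -
      have "f b = h1 b" using f(2) AB that unfolding \<sigma>_def by auto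
      then show ?thesis using h1 that unfolding bij_betw_def sg_def by auto
    qed
    have s2: "sg (f b) = - 1" if b: "b \<in> BB" "b \<notin> ?A" for b
    proof -
      have "f b = h2 b" using f(2) [OF b(1)] b(2) unfolding \<sigma>_def by simp
      moreover have "h2 b \<in> BB - EE" using h2 b unfolding bij_betw_def by blast
      ultimately show ?thesis unfolding sg_def by simp
    qed
    have "pattern f = T"
    proof (rule subset_antisym)
      show "pattern f \<subseteq> T"
      proof
        fix b assume b: "b \<in> pattern f"
        then have "sg (f b) = 1" using s1 [of b0] unfolding pattern_def by simp
        then show "b \<in> T" using s2 [of b] b unfolding pattern_def by fastforce
      qed
      show "T \<subseteq> pattern f" using s1 T(1) unfolding pattern_def by auto
    qed
    then show "T \<in> pattern ` marked_homeos BB" using f(1) by blast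
  qed
qed

text \<open>Two right cosets agree when \<open>f\<close> composed with the inverse of
  \<open>h\<close> lifts, that is, when the signs taken by \<open>f\<close> and by \<open>h\<close>
  agree up to a global sign. Only values on marked points enter, so the criterion depends on the
  mapping classes alone.\<close>

lemma coset_eq_iff:
  assumes k: "k \<ge> 3" and f: "f \<in> marked_homeos BB" and h: "h \<in> marked_homeos BB"
  shows "LMod S p BB #>\<^bsub>Mod_group BB\<^esub> mapping_class BB f = LMod S p BB #>\<^bsub>Mod_group BB\<^esub> mapping_class BB h
    \<longleftrightarrow> pattern f = pattern h"
proof
  let ?G = "Mod_group BB" and ?c = "mapping_class BB" and ?L = "LMod S p BB"
  interpret group ?G by (rule group_Mod_group [OF BB_sub(2)])
  have sub: "subgroup ?L ?G" using subgroup_LMod [OF cover] unfolding branch_set_eq .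
  have car: "?c f \<in> carrier ?G" "?c h \<in> carrier ?G" using f h by (auto simp: Mod_group_def)
  {
    assume "?L #>\<^bsub>?G\<^esub> ?c f = ?L #>\<^bsub>?G\<^esub> ?c h"
    then have "?c f \<in> ?L #>\<^bsub>?G\<^esub> ?c h" using rcos_self [OF car(1) sub] by simp
    then obtain x where x: "x \<in> marked_homeos BB" "liftable S p x" "?c f = ?c x \<otimes>\<^bsub>?G\<^esub> ?c h"
      unfolding r_coset_def LMod_def by blast
    then have "?c f = ?c (x \<circ> h)" using mult_mapping_class [OF BB_sub(2) x(1) h] by simp
    then have "f \<in> ?c (x \<circ> h)" using mapping_class_self [OF f BB_sub(2)] by simp
    then have "mhtp BB (x \<circ> h) f" unfolding mapping_class_def by simp
    then have eq: "f b = x (h b)" if "b \<in> BB" for b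
      using homotopic_agree_on_marked [OF finite_BB BB_sub(2) _ that] by fastforce
    obtain u where u: "u \<in> {1, - 1}" "\<forall>b\<in>BB. sg (x b) = u * sg b"
      using liftable_iff [OF k x(1)] x(2) by blast
    have "sg (f b) = u * sg (h b)" if b: "b \<in> BB" for b
      using u(2) marked_in [OF h b] unfolding eq [OF b] by blast
    then show "pattern f = pattern h" unfolding pattern_eq_iff using u(1) by blast
  }
  {
    assume "pattern f = pattern h"
    then obtain u where u: "u \<in> {1, - 1}" "\<forall>b\<in>BB. sg (f b) = u * sg (h b)"
      unfolding pattern_eq_iff by blast
    obtain h' where h': "h' \<in> marked_homeos BB" "homeomorphic_maps (nsphere 2) (nsphere 2) h h'"
      using marked_homeos_inv [OF h BB_sub(2)] .
    have inv: "h' (h y) = y" "h (h' y) = y" if "y \<in> S2" for y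
      using h'(2) that unfolding homeomorphic_maps_def by blast+
    let ?x = "f \<circ> h'"
    have x: "?x \<in> marked_homeos BB" by (rule marked_homeos_comp [OF f h'(1)])
    have "sg (?x b) = u * sg b" if b: "b \<in> BB" for b
    proof -
      have "sg (f (h' b)) = u * sg (h (h' b))" using u(2) marked_in [OF h'(1) b] by blast
      moreover have "h (h' b) = b" using inv(2) b BB_sub(2) by blast
      ultimately show ?thesis by simp
    qed
    then have "liftable S p ?x" using liftable_iff [OF k x] u(1) by blast
    then have xL: "?c ?x \<in> ?L" unfolding LMod_def using x by blast
    have "mhtp BB f (?x \<circ> h)"
    proof (rule homotopic_with_equal)
      show "preserves_marked BB f" "preserves_marked BB (?x \<circ> h)"
        by (intro marked_homeos_preserves marked_homeos_comp f h x BB_sub(2))+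
      show "continuous_map (nsphere 2) (nsphere 2) f" by (rule marked_homeos_continuous [OF f])
    qed (use inv(1) in simp)
    then have "?c f = ?c (?x \<circ> h)" by (rule mapping_class_eqI)
    also have "\<dots> = ?c ?x \<otimes>\<^bsub>?G\<^esub> ?c h" by (rule mult_mapping_class [OF BB_sub(2) x h, symmetric])
    finally have "?c f \<in> ?L #>\<^bsub>?G\<^esub> ?c h" unfolding r_coset_def using xL by blast
    then show "?L #>\<^bsub>?G\<^esub> ?c f = ?L #>\<^bsub>?G\<^esub> ?c h"
      using repr_independence [OF _ car(2) sub] by blast
  }
qed

lemma LMod_2: "k = 2 \<Longrightarrow> LMod S p BB = carrier (Mod_group BB)"
proof -
  assume k: "k = 2"
  have "{f \<in> marked_homeos BB. liftable S p f} = marked_homeos BB" using liftable_2 [OF k] by blast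
  then show ?thesis by (simp add: LMod_def Mod_group_def)
qed

lemma card_cosets:
  assumes k: "k \<ge> 3"
  shows "card (rcosets\<^bsub>Mod_group BB\<^esub> (LMod S p BB)) = (2 * n + 1) choose n"
proof -
  let ?G = "Mod_group BB" and ?c = "mapping_class BB" and ?L = "LMod S p BB"
  have "rcosets\<^bsub>?G\<^esub> ?L = (\<lambda>f. ?L #>\<^bsub>?G\<^esub> ?c f) ` marked_homeos BB"
    by (auto simp: RCOSETS_def Mod_group_def)
  then have "card (rcosets\<^bsub>?G\<^esub> ?L) = card (pattern ` marked_homeos BB)"
    using card_image_eqI [of "marked_homeos BB" "\<lambda>f. ?L #>\<^bsub>?G\<^esub> ?c f" pattern] coset_eq_iff [OF k] by simp
  also have "\<dots> = card {T. T \<subseteq> BB - {b0} \<and> card T = n}" by (simp only: pattern_image)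
  also have "\<dots> = card (BB - {b0}) choose n" by (rule n_subsets) simp
  also have "card (BB - {b0}) = 2 * n + 1"
  proof -
    have "b0 \<in> BB" by blast
    then have "card (BB - {b0}) = card BB - 1" by (rule card_Diff_singleton)
    then show ?thesis using card_BB by simp
  qed
  finally show ?thesis .
qed

end

text \<open>The left side is half of \<open>(2 * n + 2) choose (n + 1)\<close>: selecting the half
  that contains a given point picks one set out of each complementary pair.\<close>

lemma central_binomial_half:
  "real ((2 * n + 1) choose n) = fact (2 * n + 2) / (2 * (fact (n + 1))\<^sup>2)"
proof -
  have e: "2 * n + 1 - n = n + 1" by simp
  have cancel: "(2 * c * y) / (2 * (c * x)\<^sup>2) = y / (x * (c * x))" if "c \<noteq> 0" for c x y :: real
    using that by (simp add: power2_eq_square)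
  have f2: "(fact (2 * n + 2) :: real) = 2 * (real n + 1) * fact (2 * n + 1)"
    using fact_Suc [of "2 * n + 1", where ?'a = real] by (simp add: algebra_simps)
  have f1: "(fact (n + 1) :: real) = (real n + 1) * fact n"
    by (simp add: algebra_simps)
  have "real ((2 * n + 1) choose n) = fact (2 * n + 1) / (fact n * fact (n + 1))"
    using binomial_fact [of n "2 * n + 1", where ?'a = real] unfolding e by simp
  also have "\<dots> = fact (2 * n + 2) / (2 * (fact (n + 1))\<^sup>2)"
    unfolding f2 f1 by (rule cancel [symmetric]) simp
  finally show ?thesis .
qed

theorem mainTheorem5:
  fixes g k n :: nat and S :: "(real^3) set" and p :: "real^3 \<Rightarrow> (nat \<Rightarrow> real)"
    and B :: "(nat \<Rightarrow> real) set"
  assumes "g \<ge> 2" and "k \<ge> 2" and "(k - 1) dvd g" and "n = g div (k - 1)"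
    and "balanced_superelliptic_surface g k n S"
    and "balanced_superelliptic_cover k S p"
    and "B = branch_set k S p"
  shows "(k = 2 \<longrightarrow> LMod S p B = carrier (Mod_group B)) \<and>
         (k \<ge> 3 \<longrightarrow> real (card (rcosets\<^bsub>Mod_group B\<^esub> (LMod S p B))) =
            fact (2 * n + 2) / (2 * (fact (n + 1))\<^sup>2))"
proof -
  have "n \<noteq> 0"
  proof
    assume "n = 0"
    then have "g = 0" using assms(3,4) by (simp add: dvd_div_eq_0_iff)
    then show False using assms(1) by simp
  qed
  then interpret bse_cover g k n S p
    by (unfold_locales) (use assms in auto)
  \<comment> \<open>Any point on this slice can serve as the point at infinity of the chart.\<close>
  have "LL (1/2) \<noteq> {}" by (rule LL_connected(2)) simp_all
  then obtain N where N: "N \<in> S2" "hgt N = 1/2" unfolding LL_def by blast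
  obtain z z' where zz: "sphere_chart S2 N z z'" using sphere_chart_S2 [OF N(1)] .
  interpret sphere_chart S2 N z z' by (rule zz)
  interpret bse_chart g k n S p N z z'
    by unfold_locales (rule N(2))
  have B: "B = BB" using assms(7) branch_set_eq by simp
  show ?thesis unfolding B
  proof (intro conjI impI)
    show "LMod S p BB = carrier (Mod_group BB)" if "k = 2" using LMod_2 [OF that] .
    show "real (card (rcosets\<^bsub>Mod_group BB\<^esub> (LMod S p BB))) =
        fact (2 * n + 2) / (2 * (fact (n + 1))\<^sup>2)" if "k \<ge> 3"
      unfolding card_cosets [OF that] by (rule central_binomial_half)
  qed
qed

end
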